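(* Let $p\ge1$, let $\mathcal H$ be a (finite- or infinite-dimensional) complex Hilbert space and let $\{A,S,\Pi\}$ be an $S$-node, that is, $A,S\in\mathcal B(\mathcal H)$, $S=S^*$, $\Pi=\begin{bmatrix}\Phi_1&\Phi_2\end{bmatrix}\in\mathcal B(\mathbb C^{2p},\mathcal H)$ with $\Phi_1,\Phi_2\in\mathcal B(\mathbb C^p,\mathcal H)$, and $AS-SA^*=\mathrm i\,\Pi J\Pi^*$, where $J=\begin{bmatrix}0&I_p\\ I_p&0\end{bmatrix}$. Let the operators $I-zA$ have bounded inverses for $z$ in the domains $\{z:\ \Im(z)\le0\}$ and $\{z:\ \Im(z)>0,\ |z|\ge r_0\}$ for some $r_0>0$. Assume that $S\ge\varepsilon I$ for some $\varepsilon>0$ and that $\mathrm{Ker}\,\Phi_2=0$. Finally, let $$\limsup_{r\to\infty}\big(\ln(\mathcal M(r))/r^{\varkappa}\big)<\infty$$ for some $0<\varkappa<1$, where $$\mathcal M(r)=\sup_{r_0<|z|<r}\|(I-zA)^{-1}\| .$$ Let $c(z)=\mathfrak A_{21}(S,z)=-\mathrm i z\,\Phi_2^*(I-zA^* )^{-1}S^{-1}\Phi_2$. Then $\widehat c(\zeta)\in D^{(p\times p)}$ and $\widehat c(\zeta)^{-1}\in D^{(p\times p)}$, that is, $\widehat c(\zeta)$ is an outer matrix function.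
   Context: Notation: $\mathbb C_+$ is the open upper half-plane, $\mathbb D=\{|\zeta|<1\}$, $\mathcal B(\mathcal H_1,\mathcal H_2)$ denotes bounded linear operators, $\mathcal B(\mathcal H)=\mathcal B(\mathcal H,\mathcal H)$, $I$ is the identity operator and $I_p$ the $p\times p$ identity matrix. $c(z)$ is the lower left $p\times p$ block $\mathfrak A_{21}(S,z)$ of the $2p\times2p$ matrix function $\mathfrak A(S,z)=I_{2p}-\mathrm i z\,\Pi^*(I-zA^* )^{-1}S^{-1}\Pi J$. Hat notation: fix $z_0\in\mathbb C_+$ and put $\widehat c(\zeta)=c\big((\overline{z_0}\zeta-z_0)(\zeta-1)^{-1}\big)$, $\zeta\in\mathbb D$ (this substitution maps $\mathbb D$ onto $\mathbb C_+$; membership in the classes below does not depend on the choice of $z_0\in\mathbb C_+$). Outer functions: a scalar outer function on $\mathbb D$ is an analytic function of the form $h(\zeta)=\alpha\exp\Big\{\frac1{2\pi}\int_0^{2\pi}\ln(\omega(\vartheta))\frac{e^{\mathrm i\vartheta}+\zeta}{e^{\mathrm i\vartheta}-\zeta}\,d\vartheta\Big\}$ with $|\alpha|=1$ and $\ln\omega$ integrable on $[0,2\pi]$. Smirnov class $D$: functions holomorphic in $\mathbb D$ that are ratios of a function from $H^\infty(\mathbb D)$ and an outer function from $H^\infty(\mathbb D)$. $D^{(p\times p)}$ is the class of $p\times p$ matrix functions with entries in $D$. A $p\times p$ matrix function $f$ is called an outer matrix function if $f\in D^{(p\times p)}$ and $\det f$ is an outer function. *)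

theory Defs
  imports "HOL-Complex_Analysis.Complex_Analysis"
begin

section \<open>Complex Hilbert spaces\<close>

text \<open>
  A complex Hilbert space is given by its underlying real Hilbert space together with a complex
  scalar multiplication and a complex inner product whose real part is the real inner product;
  in particular the norm of \<open>x\<close> is the square root of \<open>cinner x x\<close>.  Completeness is the library
  class \<open>complete_space\<close>.  The inner product is linear in its first argument.
\<close>

class chilbert_space = real_inner + complete_space +
  fixes scaleC :: "complex \<Rightarrow> 'a \<Rightarrow> 'a" (infixr "*\<^sub>C" 75)
    and cinner :: "'a \<Rightarrow> 'a \<Rightarrow> complex"
  assumes scaleC_add_right: "c *\<^sub>C (x + y) = c *\<^sub>C x + c *\<^sub>C y"
    and scaleC_add_left: "(c + d) *\<^sub>C x = c *\<^sub>C x + d *\<^sub>C x"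
    and scaleC_scaleC: "c *\<^sub>C d *\<^sub>C x = (c * d) *\<^sub>C x"
    and scaleC_of_real: "complex_of_real r *\<^sub>C x = r *\<^sub>R x"
    and cinner_commute: "cinner x y = cnj (cinner y x)"
    and cinner_add_left: "cinner (x + y) w = cinner x w + cinner y w"
    and cinner_scaleC_left: "cinner (c *\<^sub>C x) y = c * cinner x y"
    and Re_cinner: "Re (cinner x y) = inner x y"
begin

subclass banach ..

end

instantiation complex :: chilbert_space
begin

definition scaleC_complex :: "complex \<Rightarrow> complex \<Rightarrow> complex"
  where "scaleC_complex c x = c * x"

definition cinner_complex :: "complex \<Rightarrow> complex \<Rightarrow> complex"
  where "cinner_complex x y = x * cnj y"

instance
  by standard
    (simp_all add: scaleC_complex_def cinner_complex_def algebra_simps inner_complex_def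
      scaleR_conv_of_real)

end

instantiation vec :: (chilbert_space, finite) chilbert_space
begin

definition scaleC_vec :: "complex \<Rightarrow> ('a, 'b) vec \<Rightarrow> ('a, 'b) vec"
  where "scaleC_vec c x = (\<chi> i. c *\<^sub>C x $ i)"

definition cinner_vec :: "('a, 'b) vec \<Rightarrow> ('a, 'b) vec \<Rightarrow> complex"
  where "cinner_vec x y = (\<Sum>i\<in>UNIV. cinner (x $ i) (y $ i))"

instance
proof
  fix x y w :: "('a, 'b) vec" and c d :: complex and r :: real
  show "c *\<^sub>C (x + y) = c *\<^sub>C x + c *\<^sub>C y" "(c + d) *\<^sub>C x = c *\<^sub>C x + d *\<^sub>C x"
    "c *\<^sub>C d *\<^sub>C x = (c * d) *\<^sub>C x" "complex_of_real r *\<^sub>C x = r *\<^sub>R x"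
    by (simp_all add: vec_eq_iff scaleC_vec_def scaleC_add_right scaleC_add_left scaleC_scaleC
        scaleC_of_real)
  show "cinner x y = cnj (cinner y x)"
    unfolding cinner_vec_def cnj_sum by (intro sum.cong refl cinner_commute)
  show "cinner (x + y) w = cinner x w + cinner y w"
    by (simp add: cinner_vec_def cinner_add_left sum.distrib)
  show "cinner (c *\<^sub>C x) y = c * cinner x y"
    by (simp add: cinner_vec_def scaleC_vec_def cinner_scaleC_left sum_distrib_left)
  show "Re (cinner x y) = inner x y"
    by (simp add: cinner_vec_def inner_vec_def Re_cinner)
qed

end

section \<open>Bounded operators\<close>

definition bounded_clinear :: "('a::chilbert_space \<Rightarrow> 'b::chilbert_space) \<Rightarrow> bool"
  where "bounded_clinear f \<longleftrightarrow> bounded_linear f \<and> (\<forall>c x. f (c *\<^sub>C x) = c *\<^sub>C f x)"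

definition cadjoint :: "('a::chilbert_space \<Rightarrow> 'b::chilbert_space) \<Rightarrow> 'b \<Rightarrow> 'a"
  where "cadjoint f = (THE g. \<forall>x y. cinner (f x) y = cinner x (g y))"

text \<open>When \<open>T\<close> has a bounded inverse, that inverse is \<open>inv T\<close>.\<close>

definition has_bounded_inverse :: "('a::chilbert_space \<Rightarrow> 'a) \<Rightarrow> bool"
  where "has_bounded_inverse T \<longleftrightarrow>
    (\<exists>R. bounded_clinear R \<and> (\<forall>x. R (T x) = x) \<and> (\<forall>x. T (R x) = x))"

text \<open>The operator \<open>I - z T\<close>.\<close>

definition id_minus :: "complex \<Rightarrow> ('a::chilbert_space \<Rightarrow> 'a) \<Rightarrow> 'a \<Rightarrow> 'a"
  where "id_minus z T = (\<lambda>x. x - z *\<^sub>C T x)"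

section \<open>S-nodes\<close>

text \<open>
  The space of \<open>2p\<close>-vectors is \<open>complex ^ ('p + 'p)\<close>: the indices \<open>Inl i\<close> are the first \<open>p\<close>
  coordinates and the indices \<open>Inr i\<close> the last \<open>p\<close> ones.  The operator \<open>P\<close> below is the third
  component (usually a capital Pi) of an S-node.
\<close>

definition block_mat ::
  "'a ^ 'p ^ 'p \<Rightarrow> 'a ^ 'p ^ 'p \<Rightarrow> 'a ^ 'p ^ 'p \<Rightarrow> 'a ^ 'p ^ 'p \<Rightarrow> 'a ^ ('p::finite + 'p) ^ ('p + 'p)"
  where "block_mat B11 B12 B21 B22 = (\<chi> i j.
    (case i of
      Inl k \<Rightarrow> (case j of Inl l \<Rightarrow> B11 $ k $ l | Inr l \<Rightarrow> B12 $ k $ l)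
    | Inr k \<Rightarrow> (case j of Inl l \<Rightarrow> B21 $ k $ l | Inr l \<Rightarrow> B22 $ k $ l)))"

definition lower_left :: "'a ^ ('p::finite + 'p) ^ ('p + 'p) \<Rightarrow> 'a ^ 'p ^ 'p"
  where "lower_left M = (\<chi> i j. M $ Inr i $ Inl j)"

definition J_mat :: "complex ^ ('p::finite + 'p) ^ ('p + 'p)"
  where "J_mat = block_mat 0 (mat 1) (mat 1) 0"

text \<open>The row operator \<open>[\<Phi>1 \<Phi>2]\<close>.\<close>

definition row_op ::
  "(complex ^ 'p::finite \<Rightarrow> 'h::chilbert_space) \<Rightarrow> (complex ^ 'p \<Rightarrow> 'h) \<Rightarrow> complex ^ ('p + 'p) \<Rightarrow> 'h"
  where "row_op \<Phi>1 \<Phi>2 v = \<Phi>1 (\<chi> i. v $ Inl i) + \<Phi>2 (\<chi> i. v $ Inr i)"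

definition S_node ::
  "('h::chilbert_space \<Rightarrow> 'h) \<Rightarrow> ('h \<Rightarrow> 'h) \<Rightarrow> (complex ^ ('p::finite + 'p) \<Rightarrow> 'h) \<Rightarrow> bool"
  where "S_node A S P \<longleftrightarrow>
    bounded_clinear A \<and> bounded_clinear S \<and> bounded_clinear P \<and> cadjoint S = S \<and>
    (\<forall>x. A (S x) - S (cadjoint A x) = \<i> *\<^sub>C P (J_mat *v cadjoint P x))"

definition transfer_mat ::
  "('h::chilbert_space \<Rightarrow> 'h) \<Rightarrow> ('h \<Rightarrow> 'h) \<Rightarrow> (complex ^ ('p::finite + 'p) \<Rightarrow> 'h) \<Rightarrow> complex
    \<Rightarrow> complex ^ ('p + 'p) ^ ('p + 'p)"
  where "transfer_mat A S P z =
    mat 1 - matrix (\<lambda>v. (\<i> * z) *\<^sub>C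
      cadjoint P (inv (id_minus z (cadjoint A)) (inv S (P (J_mat *v v)))))"

definition c_fun ::
  "('h::chilbert_space \<Rightarrow> 'h) \<Rightarrow> ('h \<Rightarrow> 'h) \<Rightarrow> (complex ^ ('p::finite + 'p) \<Rightarrow> 'h) \<Rightarrow> complex
    \<Rightarrow> complex ^ 'p ^ 'p"
  where "c_fun A S P z = lower_left (transfer_mat A S P z)"

text \<open>
  The supremum of the norm of the inverse of \<open>I - z A\<close> over the annulus \<open>r0 < |z| < r\<close>, as a real
  supremum: it is meaningful for \<open>r > r0\<close> when these inverses exist and are uniformly bounded on the
  annulus, which holds by continuity when \<open>I - z A\<close> is boundedly invertible for all \<open>|z| \<ge> r0\<close>.
\<close>

definition resolvent_sup :: "('h::chilbert_space \<Rightarrow> 'h) \<Rightarrow> real \<Rightarrow> real \<Rightarrow> real"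
  where "resolvent_sup A r0 r =
    (SUP z\<in>{z. r0 < norm z \<and> norm z < r}. onorm (inv (id_minus z A)))"

section \<open>Function classes in the unit disk\<close>

definition hat :: "complex \<Rightarrow> (complex \<Rightarrow> 'a) \<Rightarrow> complex \<Rightarrow> 'a"
  where "hat z0 f \<zeta> = f ((cnj z0 * \<zeta> - z0) / (\<zeta> - 1))"

definition H_infty :: "(complex \<Rightarrow> complex) set"
  where "H_infty = {f. f holomorphic_on ball 0 1 \<and> bounded (f ` ball 0 1)}"

text \<open>
  Integrability of \<open>ln \<omega>\<close> in the sense of extended real values forces \<open>0 < \<omega> < \<infinity>\<close> almost everywhere.
  Positivity is stated separately because \<open>ln\<close> is a total function on the reals in the library.
\<close>

definition outer_fun :: "(complex \<Rightarrow> complex) \<Rightarrow> bool"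
  where "outer_fun h \<longleftrightarrow> h holomorphic_on ball 0 1 \<and>
    (\<exists>\<alpha> \<omega>. norm \<alpha> = 1 \<and>
      (AE \<theta> in lebesgue. \<theta> \<in> {0..2 * pi} \<longrightarrow> 0 < \<omega> \<theta>) \<and>
      set_integrable lebesgue {0..2 * pi} (\<lambda>\<theta>. ln (\<omega> \<theta>) :: real) \<and>
      (\<forall>\<zeta>\<in>ball 0 1. h \<zeta> = \<alpha> * exp (1 / (2 * pi) *
        (LINT \<theta>:{0..2 * pi}|lebesgue.
          complex_of_real (ln (\<omega> \<theta>)) * ((exp (\<i> * \<theta>) + \<zeta>) / (exp (\<i> * \<theta>) - \<zeta>))))))"

definition smirnov :: "(complex \<Rightarrow> complex) set"
  where "smirnov = {f. f holomorphic_on ball 0 1 \<and>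
    (\<exists>g\<in>H_infty. \<exists>h\<in>H_infty. outer_fun h \<and> (\<forall>\<zeta>\<in>ball 0 1. f \<zeta> = g \<zeta> / h \<zeta>))}"

definition smirnov_mat :: "(complex \<Rightarrow> complex ^ 'p ^ 'p) set"
  where "smirnov_mat = {f. \<forall>i j. (\<lambda>\<zeta>. f \<zeta> $ i $ j) \<in> smirnov}"

definition outer_mat_fun :: "(complex \<Rightarrow> complex ^ 'p::finite ^ 'p) \<Rightarrow> bool"
  where "outer_mat_fun f \<longleftrightarrow> f \<in> smirnov_mat \<and> outer_fun (\<lambda>\<zeta>. det (f \<zeta>))"

end

theory Submission
  imports Defs "HOL-Real_Asymp.Real_Asymp" "HOL-Computational_Algebra.Fundamental_Theorem_Algebra"
begin

text \<open>
  Write \<open>[c d]\<close> for the lower block row of the transfer matrix.  The operator identity of the S-node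
  gives, on the closed upper half-plane, the identity
  \<open>c(z) d(z)* + d(z) c(z)* = 2 Im z X(z)* S\<^sup>-\<^sup>1 X(z)\<close> with \<open>X(z) = (I - cnj z A)\<^sup>-\<^sup>1 \<Phi>2\<close>
  (\<open>J_identity\<close>).  Its right-hand side is positive definite for \<open>Im z > 0\<close>, since \<open>\<Phi>2\<close> is injective;
  hence \<open>c(z)\<close> is invertible there.

  The growth condition bounds the resolvent of the adjoint of \<open>A\<close>, hence also \<open>c\<close> and \<open>d\<close>, by
  \<open>exp (C (1 + |z|\<^sup>\<kappa>))\<close> on the closed half-plane.  In the disk the point \<open>z = \<infinity>\<close> becomes \<open>\<zeta> = 1\<close> and the bound becomes
  \<open>exp (K |1 - \<zeta>|\<^sup>-\<^sup>\<kappa>)\<close>.  Because \<open>\<kappa> < 1\<close>, the weight \<open>|1 - \<zeta>|\<^sup>-\<^sup>\<kappa>\<close> is integrable on the circle, and it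
  is comparable to the real part of \<open>(1 - \<zeta>)\<^sup>-\<^sup>\<kappa>\<close>.  So every holomorphic function with this bound is
  made bounded by an outer factor \<open>exp (- K (1 - \<zeta>)\<^sup>-\<^sup>\<kappa>)\<close> and lies in the Smirnov class
  (\<open>smirnov_quotient\<close>).  This settles the entries of \<open>c\<close>; by Cramer's rule it also settles those of
  \<open>c\<^sup>-\<^sup>1\<close> once \<open>det c\<close> is known to be outer.

  The determinant is the real problem: \<open>det c\<close> may have infinitely many zeros on the real line, so
  \<open>ln |det c|\<close> has no evident integrable minorant near the boundary.  The pencil \<open>c + \<delta> d\<close> with
  \<open>\<delta> > 0\<close> does not have this defect.  Pairing the row \<open>[c d]\<close> at \<open>z\<close> with the other row of the transfer
  matrix at \<open>cnj z\<close> bounds the row from below by \<open>exp (- K (1 + |z|\<^sup>\<kappa>))\<close> for large \<open>|z|\<close>, and the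
  positivity above transfers this bound to \<open>c + \<delta> d\<close>; on bounded sets a continuity argument suffices.
  So \<open>ln |det (c + \<delta> d)|\<close> is dominated on both sides by the weight (\<open>ln_det_pencil_bound\<close>), and the
  Schwarz integral formula on circles of radius \<open>r < 1\<close> passes to the
  limit \<open>r \<rightarrow> 1\<close> by dominated convergence: \<open>det (c + \<delta> d)\<close> is outer (\<open>outer_with_log_modulus\<close>).

  Finally let \<open>\<delta>\<close> tend to \<open>0\<close>.  By the J-identity all roots of the polynomial \<open>\<delta> \<mapsto> det (c + \<delta> d)\<close> have
  nonpositive real part, on the boundary as well, so its modulus decreases as \<open>\<delta>\<close> decreases to \<open>0\<close>.
  Since \<open>det c\<close> does not vanish at the centre of the disk, monotone convergence shows that the
  boundary values \<open>ln |det (c + \<delta> d)|\<close> have an integrable limit, and the outer representation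
  survives in the limit (\<open>outer_with_decreasing_limit\<close>).
\<close>

text \<open>The dollar sign selects vector components here, never coefficients of power series.\<close>

no_notation fps_nth (infixl "$" 75)

section \<open>Outer functions given by their logarithmic modulus\<close>

abbreviation circle_angles :: "real measure"
  where "circle_angles \<equiv> lebesgue_on {0..2 * pi}"

definition schwarz_kernel :: "real \<Rightarrow> complex \<Rightarrow> complex"
  where "schwarz_kernel \<theta> \<zeta> = (exp (\<i> * \<theta>) + \<zeta>) / (exp (\<i> * \<theta>) - \<zeta>)"

definition schwarz_integral :: "(real \<Rightarrow> real) \<Rightarrow> complex \<Rightarrow> complex"
  where "schwarz_integral u \<zeta> = complex_of_real (1 / (2 * pi)) *
    (\<integral>\<theta>. complex_of_real (u \<theta>) * schwarz_kernel \<theta> \<zeta> \<partial>circle_angles)"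

text \<open>
  The density of an outer function enters only through its logarithm.  Recording the logarithm \<open>u\<close>
  itself makes positivity of the density automatic, turns products into sums, and gives limit
  theorems for \<open>u\<close> directly.
\<close>

definition outer_with :: "(complex \<Rightarrow> complex) \<Rightarrow> (real \<Rightarrow> real) \<Rightarrow> bool"
  where "outer_with f u \<longleftrightarrow> integrable circle_angles u \<and>
    (\<exists>\<alpha>. norm \<alpha> = 1 \<and> (\<forall>\<zeta>\<in>ball 0 1. f \<zeta> = \<alpha> * exp (schwarz_integral u \<zeta>)))"

lemma outer_with_imp_outer_fun:
  assumes "f holomorphic_on ball 0 1" "outer_with f u"
  shows "outer_fun f"
proof -
  from assms obtain \<alpha> where u: "integrable circle_angles u" and \<alpha>: "norm \<alpha> = 1"
    and f: "\<And>\<zeta>. \<zeta> \<in> ball 0 1 \<Longrightarrow> f \<zeta> = \<alpha> * exp (schwarz_integral u \<zeta>)"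
    unfolding outer_with_def by blast
  show ?thesis
    unfolding outer_fun_def
  proof (intro conjI assms(1) exI[of _ \<alpha>] exI[of _ "\<lambda>\<theta>. exp (u \<theta>)"] \<alpha> ballI)
    show "set_integrable lebesgue {0..2 * pi} (\<lambda>\<theta>. ln (exp (u \<theta>)))"
      using u by (simp add: set_integrable_def integrable_restrict_space)
    fix \<zeta> :: complex assume "\<zeta> \<in> ball 0 1"
    then show "f \<zeta> = \<alpha> * exp (1 / (2 * pi) *
        (LINT \<theta>:{0..2 * pi}|lebesgue.
          complex_of_real (ln (exp (u \<theta>))) * ((exp (\<i> * \<theta>) + \<zeta>) / (exp (\<i> * \<theta>) - \<zeta>))))"
      by (simp add: f schwarz_integral_def schwarz_kernel_def set_lebesgue_integral_def
          integral_restrict_space)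
  qed auto
qed

lemma norm_exp_i_minus_ge:
  "1 - norm \<zeta> \<le> norm (exp (\<i> * complex_of_real \<theta>) - \<zeta>)"
  using norm_triangle_ineq2[of "exp (\<i> * complex_of_real \<theta>)" \<zeta>] by simp

lemma norm_schwarz_kernel_le:
  assumes "norm \<zeta> < 1"
  shows "norm (schwarz_kernel \<theta> \<zeta>) \<le> 2 / (1 - norm \<zeta>)"
proof -
  have "norm (exp (\<i> * complex_of_real \<theta>) + \<zeta>) \<le> 2"
    using norm_triangle_ineq[of "exp (\<i> * complex_of_real \<theta>)" \<zeta>] assms by simp
  then show ?thesis
    unfolding schwarz_kernel_def norm_divide
    using norm_exp_i_minus_ge[of \<zeta> \<theta>] assms by (intro frac_le) auto
qed

lemma continuous_on_schwarz_kernel: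
  assumes "norm \<zeta> < 1"
  shows "continuous_on X (\<lambda>\<theta>. schwarz_kernel \<theta> \<zeta>)"
proof -
  have "exp (\<i> * complex_of_real \<theta>) - \<zeta> \<noteq> 0" for \<theta>
    using norm_exp_i_minus_ge[of \<zeta> \<theta>] assms by auto
  then show ?thesis
    unfolding schwarz_kernel_def by (intro continuous_intros) auto
qed

lemma measurable_schwarz_kernel:
  assumes "norm \<zeta> < 1"
  shows "(\<lambda>\<theta>. schwarz_kernel \<theta> \<zeta>) \<in> borel_measurable circle_angles"
  by (intro continuous_imp_measurable_on_sets_lebesgue continuous_on_schwarz_kernel assms) auto

lemma integrable_schwarz:
  assumes "norm \<zeta> < 1" "integrable circle_angles u"
  shows "integrable circle_angles (\<lambda>\<theta>. complex_of_real (u \<theta>) * schwarz_kernel \<theta> \<zeta>)"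
proof (rule Bochner_Integration.integrable_bound)
  show "integrable circle_angles (\<lambda>\<theta>. u \<theta> * (2 / (1 - norm \<zeta>)))"
    using assms by auto
  show "(\<lambda>\<theta>. complex_of_real (u \<theta>) * schwarz_kernel \<theta> \<zeta>) \<in> borel_measurable circle_angles"
    using measurable_schwarz_kernel[OF assms(1)] assms(2) by measurable
  show "AE \<theta> in circle_angles. norm (complex_of_real (u \<theta>) * schwarz_kernel \<theta> \<zeta>)
      \<le> norm (u \<theta> * (2 / (1 - norm \<zeta>)))"
  proof (rule AE_I2)
    fix \<theta>
    have "\<bar>u \<theta>\<bar> * norm (schwarz_kernel \<theta> \<zeta>) \<le> \<bar>u \<theta>\<bar> * (2 / (1 - norm \<zeta>))"
      by (intro mult_left_mono norm_schwarz_kernel_le assms) auto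
    also have "\<dots> = norm (u \<theta> * (2 / (1 - norm \<zeta>)))"
      using assms(1) by (simp add: abs_mult)
    finally show "norm (complex_of_real (u \<theta>) * schwarz_kernel \<theta> \<zeta>) \<le> norm (u \<theta> * (2 / (1 - norm \<zeta>)))"
      by (simp add: norm_mult)
  qed
qed

lemma schwarz_integral_add:
  assumes "norm \<zeta> < 1" "integrable circle_angles u" "integrable circle_angles v"
  shows "schwarz_integral (\<lambda>\<theta>. u \<theta> + v \<theta>) \<zeta> = schwarz_integral u \<zeta> + schwarz_integral v \<zeta>"
  unfolding schwarz_integral_def
  using integrable_schwarz[OF assms(1,2)] integrable_schwarz[OF assms(1,3)]
  by (simp add: ring_distribs)

lemma outer_with_mult:
  assumes "outer_with f u" "outer_with g v"
  shows "outer_with (\<lambda>\<zeta>. f \<zeta> * g \<zeta>) (\<lambda>\<theta>. u \<theta> + v \<theta>)"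
proof -
  from assms(1) obtain \<alpha> where u: "integrable circle_angles u" and \<alpha>: "norm \<alpha> = 1"
    and f: "\<And>\<zeta>. \<zeta> \<in> ball 0 1 \<Longrightarrow> f \<zeta> = \<alpha> * exp (schwarz_integral u \<zeta>)"
    unfolding outer_with_def by blast
  from assms(2) obtain \<beta> where v: "integrable circle_angles v" and \<beta>: "norm \<beta> = 1"
    and g: "\<And>\<zeta>. \<zeta> \<in> ball 0 1 \<Longrightarrow> g \<zeta> = \<beta> * exp (schwarz_integral v \<zeta>)"
    unfolding outer_with_def by blast
  show ?thesis unfolding outer_with_def
  proof (intro conjI exI[of _ "\<alpha> * \<beta>"] ballI)
    fix \<zeta> :: complex assume "\<zeta> \<in> ball 0 1"
    then show "f \<zeta> * g \<zeta> = \<alpha> * \<beta> * exp (schwarz_integral (\<lambda>\<theta>. u \<theta> + v \<theta>) \<zeta>)"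
      using u v by (simp add: f g schwarz_integral_add exp_add)
  qed (use u v \<alpha> \<beta> in \<open>auto simp: norm_mult\<close>)
qed

lemma schwarz_integral_tendsto:
  assumes "norm \<zeta> < 1" "integrable circle_angles w"
    and "\<And>n. u n \<in> borel_measurable circle_angles" "v \<in> borel_measurable circle_angles"
    and lim: "AE \<theta> in circle_angles. (\<lambda>n. u n \<theta>) \<longlonglongrightarrow> v \<theta>"
    and bound: "\<And>n. AE \<theta> in circle_angles. \<bar>u n \<theta>\<bar> \<le> w \<theta>"
  shows "(\<lambda>n. schwarz_integral (u n) \<zeta>) \<longlonglongrightarrow> schwarz_integral v \<zeta>"
  unfolding schwarz_integral_def
proof (intro tendsto_mult_left integral_dominated_convergence)
  note [measurable] = measurable_schwarz_kernel[OF assms(1)] assms(3,4)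
  show "(\<lambda>\<theta>. complex_of_real (v \<theta>) * schwarz_kernel \<theta> \<zeta>) \<in> borel_measurable circle_angles"
    by measurable
  show "(\<lambda>\<theta>. complex_of_real (u n \<theta>) * schwarz_kernel \<theta> \<zeta>) \<in> borel_measurable circle_angles" for n
    by measurable
  show "integrable circle_angles (\<lambda>\<theta>. w \<theta> * (2 / (1 - norm \<zeta>)))"
    using assms by auto
  show "AE \<theta> in circle_angles. (\<lambda>n. complex_of_real (u n \<theta>) * schwarz_kernel \<theta> \<zeta>)
      \<longlonglongrightarrow> complex_of_real (v \<theta>) * schwarz_kernel \<theta> \<zeta>"
    using lim by eventually_elim (intro tendsto_intros)
  show "AE \<theta> in circle_angles. norm (complex_of_real (u n \<theta>) * schwarz_kernel \<theta> \<zeta>)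
      \<le> w \<theta> * (2 / (1 - norm \<zeta>))" for n
    using bound[of n]
  proof eventually_elim
    case (elim \<theta>)
    then show ?case
      using norm_schwarz_kernel_le[OF assms(1), of \<theta>]
      unfolding norm_mult by (intro mult_mono) auto
  qed
qed

text \<open>
  Beppo Levi's theorem for decreasing sequences.  The finite limit almost everywhere comes out
  of the integrals alone; this is what admits boundary values that vanish at some points.
\<close>

lemma integrable_decreasing_limit:
  fixes u :: "nat \<Rightarrow> 'a \<Rightarrow> real"
  assumes int: "\<And>n. integrable M (u n)"
    and dec: "AE x in M. decseq (\<lambda>n. u n x)"
    and below: "\<And>n. B \<le> integral\<^sup>L M (u n)"
  obtains v where "integrable M v" "AE x in M. (\<lambda>n. u n x) \<longlonglongrightarrow> v x"
proof -
  note [measurable] = borel_measurable_integrable[OF int]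
  \<comment> \<open>These functions are nonnegative and increasing, and their integrals are bounded.\<close>
  define w where "w n x = ennreal (u 0 x - u n x)" for n x
  have [measurable]: "w n \<in> borel_measurable M" for n
    unfolding w_def by measurable
  have "integral\<^sup>N M (w n) \<le> ennreal (integral\<^sup>L M (u 0) - B)" for n
  proof -
    have "integral\<^sup>N M (w n) = ennreal (\<integral>x. u 0 x - u n x \<partial>M)"
      unfolding w_def
    proof (rule nn_integral_eq_integral)
      show "AE x in M. 0 \<le> u 0 x - u n x"
        using dec by eventually_elim (auto simp: decseq_def)
    qed (use int in auto)
    also have "\<dots> \<le> ennreal (integral\<^sup>L M (u 0) - B)"
      using below[of n] int by (intro ennreal_leI) simp
    finally show ?thesis .
  qed
  then have "(SUP n. integral\<^sup>N M (w n)) \<le> ennreal (integral\<^sup>L M (u 0) - B)"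
    by (intro SUP_least)
  moreover have "(\<integral>\<^sup>+x. (SUP n. w n x) \<partial>M) = (SUP n. integral\<^sup>N M (w n))"
  proof (rule nn_integral_monotone_convergence_SUP_AE)
    show "AE x in M. w i x \<le> w (Suc i) x" for i
      using dec by eventually_elim (auto simp: w_def decseq_def intro!: ennreal_leI)
  qed simp
  ultimately have "(\<integral>\<^sup>+x. (SUP n. w n x) \<partial>M) \<noteq> \<infinity>"
    by (metis ennreal_less_top infinity_ennreal_def leD)
  then have fin: "AE x in M. (SUP n. w n x) \<noteq> \<infinity>"
    by (intro nn_integral_PInf_AE) auto
  define v where "v x = lim (\<lambda>n. u n x)" for x
  have lim: "AE x in M. (\<lambda>n. u n x) \<longlonglongrightarrow> v x"
    using fin dec
  proof eventually_elim
    case (elim x)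
    then obtain K where K: "(SUP n. w n x) = ennreal K" "K \<ge> 0"
      by (cases "SUP n. w n x") auto
    have "w n x \<le> ennreal K" for n
      unfolding K(1)[symmetric] by (intro SUP_upper) auto
    then have "u 0 x - K \<le> u n x" for n
      using K(2) by (auto simp: w_def ennreal_le_iff algebra_simps)
    moreover have "u n x \<le> u 0 x" for n
      using elim by (auto simp: decseq_def)
    ultimately have "Bseq (\<lambda>n. u n x)"
      by (intro BseqI'[of _ "\<bar>u 0 x\<bar> + \<bar>K\<bar>"]) (smt (verit) real_norm_def)
    then have "convergent (\<lambda>n. u n x)"
      using elim by (intro Bseq_monoseq_convergent decseq_imp_monoseq)
    then show ?case by (simp add: v_def convergent_LIMSEQ_iff)
  qed
  have [measurable]: "v \<in> borel_measurable M"
    unfolding v_def by measurable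
  have "decseq (\<lambda>n. integral\<^sup>L M (u n))"
    unfolding decseq_Suc_iff
  proof
    fix n show "integral\<^sup>L M (u (Suc n)) \<le> integral\<^sup>L M (u n)"
      using dec by (intro integral_mono_AE int) (auto elim!: eventually_mono simp: decseq_def)
  qed
  then obtain L where L: "(\<lambda>n. integral\<^sup>L M (u n)) \<longlonglongrightarrow> L"
    using decseq_convergent[of _ B] below by blast
  have "integrable M (\<lambda>x. - v x)"
  proof (rule integrable_monotone_convergence)
    show "AE x in M. incseq (\<lambda>n. - u n x)"
      using dec by eventually_elim (auto simp: incseq_def decseq_def)
    show "AE x in M. (\<lambda>n. - u n x) \<longlonglongrightarrow> - v x"
      using lim by eventually_elim (intro tendsto_minus)
    show "(\<lambda>i. LINT x|M. - u i x) \<longlonglongrightarrow> - L"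
      using L by (simp add: tendsto_minus_cancel_left)
  qed (use int in auto)
  then have "integrable M v" by simp
  with lim show ?thesis by (intro that)
qed

lemma schwarz_kernel_0 [simp]: "schwarz_kernel \<theta> 0 = 1"
  by (simp add: schwarz_kernel_def)

lemma schwarz_integral_0:
  "schwarz_integral u 0 = complex_of_real (1 / (2 * pi) * integral\<^sup>L circle_angles u)"
  by (simp add: schwarz_integral_def integral_complex_of_real)

text \<open>
  The value at the centre controls the mean of \<open>u n\<close>, because \<open>ln |f n 0|\<close> is that mean; as \<open>g 0 \<noteq> 0\<close>,
  these means stay bounded below, and the decreasing functions \<open>u n\<close> have an integrable limit.  The
  functions \<open>u 0\<close> and \<open>v\<close> then enclose all \<open>u n\<close>, so the Schwarz integrals converge everywhere, and
  so do the unimodular factors.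
\<close>

lemma outer_with_decreasing_limit:
  assumes outer: "\<And>n. outer_with (f n) (u n)"
    and dec: "AE \<theta> in circle_angles. decseq (\<lambda>n. u n \<theta>)"
    and lim: "\<And>\<zeta>. \<zeta> \<in> ball 0 1 \<Longrightarrow> (\<lambda>n. f n \<zeta>) \<longlonglongrightarrow> g \<zeta>"
    and nz: "g 0 \<noteq> 0"
  obtains v where "outer_with g v"
proof -
  from outer have int: "\<And>n. integrable circle_angles (u n)"
    and "\<exists>\<alpha>. norm \<alpha> = 1 \<and> (\<forall>\<zeta>\<in>ball 0 1. f n \<zeta> = \<alpha> * exp (schwarz_integral (u n) \<zeta>))" for n
    unfolding outer_with_def by auto
  then obtain \<alpha> where \<alpha>: "\<And>n. norm (\<alpha> n) = 1"
    and f: "\<And>n \<zeta>. \<zeta> \<in> ball 0 1 \<Longrightarrow> f n \<zeta> = \<alpha> n * exp (schwarz_integral (u n) \<zeta>)"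
    by metis
  have mean: "integral\<^sup>L circle_angles (u n) = 2 * pi * ln (norm (f n 0))" for n
    by (simp add: f \<alpha> norm_mult schwarz_integral_0)
  have "(\<lambda>n. integral\<^sup>L circle_angles (u n)) \<longlonglongrightarrow> 2 * pi * ln (norm (g 0))"
    unfolding mean using nz by (intro tendsto_intros lim) auto
  then have "bounded (range (\<lambda>n. integral\<^sup>L circle_angles (u n)))"
    by (intro convergent_imp_bounded)
  then obtain B where "\<And>n. \<bar>integral\<^sup>L circle_angles (u n)\<bar> \<le> B"
    unfolding bounded_iff by auto
  then have below: "- B \<le> integral\<^sup>L circle_angles (u n)" for n
    by (smt (verit))
  obtain v where v: "integrable circle_angles v"
    and uv: "AE \<theta> in circle_angles. (\<lambda>n. u n \<theta>) \<longlonglongrightarrow> v \<theta>"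
    using integrable_decreasing_limit[OF int dec below] by blast
  have conv: "(\<lambda>n. schwarz_integral (u n) \<zeta>) \<longlonglongrightarrow> schwarz_integral v \<zeta>"
    if "norm \<zeta> < 1" for \<zeta>
  proof (rule schwarz_integral_tendsto[OF that _ _ _ uv])
    show "integrable circle_angles (\<lambda>\<theta>. \<bar>u 0 \<theta>\<bar> + \<bar>v \<theta>\<bar>)"
      using int v by auto
    show "AE \<theta> in circle_angles. \<bar>u n \<theta>\<bar> \<le> \<bar>u 0 \<theta>\<bar> + \<bar>v \<theta>\<bar>" for n
      using dec uv
    proof eventually_elim
      case (elim \<theta>)
      then have "v \<theta> \<le> u n \<theta>" by (intro decseq_ge)
      moreover have "u n \<theta> \<le> u 0 \<theta>" using elim(1) by (auto simp: decseq_def)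
      ultimately show ?case by linarith
    qed
  qed (use int v in auto)
  define \<beta> where "\<beta> = g 0 / exp (schwarz_integral v 0)"
  have \<alpha>\<beta>: "\<alpha> \<longlonglongrightarrow> \<beta>"
  proof -
    have "\<alpha> = (\<lambda>n. f n 0 / exp (schwarz_integral (u n) 0))"
      by (auto simp: f)
    also have "\<dots> \<longlonglongrightarrow> \<beta>"
      unfolding \<beta>_def by (intro tendsto_intros lim conv) auto
    finally show ?thesis .
  qed
  have "norm \<beta> = 1"
    using LIMSEQ_unique[OF tendsto_norm[OF \<alpha>\<beta>], of 1] \<alpha> by simp
  moreover have "g \<zeta> = \<beta> * exp (schwarz_integral v \<zeta>)" if "\<zeta> \<in> ball 0 1" for \<zeta>
  proof (rule LIMSEQ_unique[OF lim[OF that]])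
    show "(\<lambda>n. f n \<zeta>) \<longlonglongrightarrow> \<beta> * exp (schwarz_integral v \<zeta>)"
      unfolding f[OF that] using that by (intro tendsto_intros \<alpha>\<beta> conv) auto
  qed
  ultimately show ?thesis
    using that v unfolding outer_with_def by blast
qed

lemma circle_Cauchy_integral:
  fixes f :: "complex \<Rightarrow> complex"
  assumes "continuous_on (cball 0 1) f" "f holomorphic_on ball 0 1" "norm z < 1"
  shows "((\<lambda>t. f (cis t) * (cis t / (cis t - z))) has_integral 2 * pi * f z) {0..2 * pi}"
proof -
  have "((\<lambda>u. f u / (u - z)) has_contour_integral (2 * of_real pi * \<i> * f z)) (circlepath 0 1)"
    using assms by (intro Cauchy_integral_circlepath) auto
  then have "((\<lambda>t. f (cis t) / (cis t - z) * \<i> * cis t) has_integral (2 * of_real pi * \<i> * f z)) {0..2 * pi}"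
    unfolding circlepath_def by (subst (asm) has_contour_integral_part_circlepath_iff) auto
  from has_integral_mult_right[OF this, of "-\<i>"] show ?thesis
    by (simp add: mult_ac)
qed

text \<open>
  The kernel is \<open>2 w / (w - z) - 1\<close> on the circle.  Applied to \<open>f\<close> it gives \<open>2 f z - f 0\<close> by the
  Cauchy formula; applied to the conjugate of \<open>f\<close> it gives \<open>cnj (f 0)\<close>, because the conjugate of the
  kernel extends holomorphically into the disk.  The formula is half the sum of the two.
\<close>

lemma Schwarz_formula:
  fixes f :: "complex \<Rightarrow> complex"
  assumes contf: "continuous_on (cball 0 1) f" and holf: "f holomorphic_on ball 0 1"
    and z: "norm z < 1"
  shows "f z = \<i> * Im (f 0) + schwarz_integral (\<lambda>\<theta>. Re (f (cis \<theta>))) z"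
proof -
  have ne: "cis t - z \<noteq> 0" for t
    using z by (metis norm_cis less_irrefl eq_iff_diff_eq_0)
  have ne': "1 - cnj z * w \<noteq> 0" if "norm w \<le> 1" for w
  proof
    assume "1 - cnj z * w = 0"
    then have "norm (cnj z * w) = 1" by (metis eq_iff_diff_eq_0 norm_one)
    moreover have "norm (cnj z * w) \<le> norm z * 1"
      using that by (simp add: norm_mult mult_left_le)
    ultimately show False using z by simp
  qed
  have 1: "((\<lambda>t. f (cis t) * (cis t / (cis t - z))) has_integral 2 * pi * f z) {0..2 * pi}"
    by (rule circle_Cauchy_integral[OF contf holf z])
  have 2: "((\<lambda>t. f (cis t) * (cis t / (cis t - 0))) has_integral 2 * pi * f 0) {0..2 * pi}"
    by (rule circle_Cauchy_integral[OF contf holf]) simp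
  have 3: "((\<lambda>t. f (cis t) / (1 - cnj z * cis t) * (cis t / (cis t - 0))) has_integral
      2 * pi * (f 0 / (1 - cnj z * 0))) {0..2 * pi}"
    using ne' by (intro circle_Cauchy_integral continuous_intros holomorphic_intros contf holf) auto
  have conj: "cnj (1 / (1 - cnj z * cis t)) = cis t / (cis t - z)" for t
  proof -
    have "cnj (1 - cnj z * cis t) = 1 - z * inverse (cis t)"
      by (simp add: cis_cnj)
    also have "\<dots> = (cis t - z) / cis t"
      by (simp add: field_simps)
    finally have "cnj (1 - cnj z * cis t) = (cis t - z) / cis t" .
    then show ?thesis by simp
  qed
  from 3 have "((\<lambda>t. f (cis t) / (1 - cnj z * cis t)) has_integral 2 * pi * f 0) {0..2 * pi}"
    by simp
  note has_integral_linear[OF this bounded_linear_cnj]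
  moreover have "cnj \<circ> (\<lambda>t. f (cis t) / (1 - cnj z * cis t)) = (\<lambda>t. cnj (f (cis t)) * (cis t / (cis t - z)))"
  proof
    fix t show "(cnj \<circ> (\<lambda>t. f (cis t) / (1 - cnj z * cis t))) t = cnj (f (cis t)) * (cis t / (cis t - z))"
      unfolding conj[symmetric] by (simp add: divide_inverse)
  qed
  ultimately have 4: "((\<lambda>t. cnj (f (cis t)) * (cis t / (cis t - z))) has_integral 2 * pi * cnj (f 0)) {0..2 * pi}"
    by simp
  have 5: "((\<lambda>t. cnj (f (cis t))) has_integral 2 * pi * cnj (f 0)) {0..2 * pi}"
    using has_integral_linear[OF 2 bounded_linear_cnj] by (simp add: o_def)
  have 6: "((\<lambda>t. of_real (Re (f (cis t))) * schwarz_kernel t z) has_integral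
      2 * pi * (f z - \<i> * Im (f 0))) {0..2 * pi}"
  proof (rule has_integral_eq_rhs[OF has_integral_eq[rotated]])
    show "((\<lambda>t. f (cis t) * (cis t / (cis t - z)) + cnj (f (cis t)) * (cis t / (cis t - z)) -
        (f (cis t) * (cis t / (cis t - 0)) + cnj (f (cis t))) / 2) has_integral
        (2 * pi * f z + 2 * pi * cnj (f 0) - (2 * pi * f 0 + 2 * pi * cnj (f 0)) / 2)) {0..2 * pi}"
      by (intro has_integral_add has_integral_diff has_integral_divide 1 2 4 5)
    show "2 * pi * (f z - \<i> * Im (f 0))
        = 2 * pi * f z + 2 * pi * cnj (f 0) - (2 * pi * f 0 + 2 * pi * cnj (f 0)) / 2"
      by (auto simp: complex_eq_iff field_simps)
    fix t
    define q where "q = cis t / (cis t - z)"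
    have kernel: "schwarz_kernel t z = 2 * q - 1"
      unfolding q_def
      using ne[of t] by (simp add: schwarz_kernel_def cis_conv_exp field_simps)
    have re: "complex_of_real (Re (f (cis t))) = (f (cis t) + cnj (f (cis t))) / 2"
      by (simp add: complex_eq_iff)
    show "f (cis t) * (cis t / (cis t - z)) + cnj (f (cis t)) * (cis t / (cis t - z)) -
        (f (cis t) * (cis t / (cis t - 0)) + cnj (f (cis t))) / 2
        = of_real (Re (f (cis t))) * schwarz_kernel t z"
      unfolding q_def[symmetric] kernel re by (simp add: field_simps)
  qed
  have "continuous_on {0..2 * pi} (\<lambda>t. f (cis t))"
    using contf by (rule continuous_on_compose2) (auto intro!: continuous_intros)
  then have "continuous_on {0..2 * pi} (\<lambda>t. of_real (Re (f (cis t))) * schwarz_kernel t z)"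
    by (intro continuous_intros continuous_on_schwarz_kernel z)
  then have "(\<lambda>t. of_real (Re (f (cis t))) * schwarz_kernel t z) absolutely_integrable_on {0..2 * pi}"
    by (rule absolutely_integrable_continuous_real)
  then have "integrable circle_angles (\<lambda>t. of_real (Re (f (cis t))) * schwarz_kernel t z)"
    by (simp add: set_integrable_def integrable_restrict_space)
  from lebesgue_integral_eq_integral[OF this] 6
  have "(\<integral>t. of_real (Re (f (cis t))) * schwarz_kernel t z \<partial>circle_angles) = 2 * pi * (f z - \<i> * Im (f 0))"
    by (simp add: integral_unique)
  then show ?thesis
    by (simp add: schwarz_integral_def)
qed

text \<open>
  The constant is not the best one; any positive one makes the distance from \<open>1\<close> to a point of the
  circle comparable to its angle.
\<close>

lemma sin_ge_third:
  assumes "0 \<le> x" "x \<le> pi / 2"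
  shows "x / 3 \<le> sin x"
proof -
  have "\<bar>sin x - x\<bar> \<le> x ^ 3 / 6"
    using Maclaurin_sin_bound[of x 3] assms(1) by (simp add: sin_coeff_def eval_nat_numeral field_simps)
  moreover have "x ^ 3 \<le> 4 * x"
  proof -
    have "x\<^sup>2 \<le> 2\<^sup>2"
      using assms pi_less_4 by (intro power_mono) auto
    then have "x\<^sup>2 * x \<le> 4 * x"
      using assms(1) by (intro mult_right_mono) auto
    then show ?thesis by (simp add: power2_eq_square power3_eq_cube)
  qed
  ultimately show ?thesis
    by linarith
qed

lemma norm_one_minus_cis_powr_le:
  assumes "0 < \<theta>" "\<theta> < 2 * pi" "0 \<le> \<kappa>"
  shows "norm (1 - cis \<theta>) powr (- \<kappa>) \<le> 3 powr \<kappa> * (\<theta> powr (- \<kappa>) + (2 * pi - \<theta>) powr (- \<kappa>))"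
proof -
  have eq: "norm (1 - cis \<theta>) = 2 * sin (\<theta> / 2)"
    using dist_exp_i_1[of \<theta>] sin_ge_zero[of "\<theta> / 2"] assms
    by (simp add: cis_conv_exp norm_minus_commute)
  have *: "norm (1 - cis \<theta>) powr (- \<kappa>) \<le> 3 powr \<kappa> * t powr (- \<kappa>)"
    if "0 < t" "t / 3 \<le> norm (1 - cis \<theta>)" for t
  proof -
    have "norm (1 - cis \<theta>) powr (- \<kappa>) \<le> (t / 3) powr (- \<kappa>)"
      using that assms(3) by (intro powr_mono2') auto
    also have "\<dots> = 3 powr \<kappa> * t powr (- \<kappa>)"
      using that by (simp add: powr_divide powr_minus field_simps)
    finally show ?thesis .
  qed
  show ?thesis
  proof (cases "\<theta> \<le> pi")
    case True
    have "norm (1 - cis \<theta>) powr (- \<kappa>) \<le> 3 powr \<kappa> * \<theta> powr (- \<kappa>)"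
      using sin_ge_third[of "\<theta> / 2"] assms True by (intro *) (auto simp: eq)
    also have "\<dots> \<le> 3 powr \<kappa> * (\<theta> powr (- \<kappa>) + (2 * pi - \<theta>) powr (- \<kappa>))"
      by (intro mult_left_mono) auto
    finally show ?thesis .
  next
    case False
    have "(2 * pi - \<theta>) / 3 \<le> norm (1 - cis \<theta>)"
      using sin_ge_third[of "pi - \<theta> / 2"] assms False by (simp add: eq sin_diff)
    then have "norm (1 - cis \<theta>) powr (- \<kappa>) \<le> 3 powr \<kappa> * (2 * pi - \<theta>) powr (- \<kappa>)"
      using assms by (intro *) auto
    also have "\<dots> \<le> 3 powr \<kappa> * (\<theta> powr (- \<kappa>) + (2 * pi - \<theta>) powr (- \<kappa>))"
      by (intro mult_left_mono) auto
    finally show ?thesis .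
  qed
qed

lemma integrable_circle_powr:
  assumes "\<kappa> < 1"
  shows "integrable circle_angles (\<lambda>\<theta>. \<theta> powr (- \<kappa>))"
    and "integrable circle_angles (\<lambda>\<theta>. (2 * pi - \<theta>) powr (- \<kappa>))"
proof -
  have *: "integrable circle_angles g"
    if "g integrable_on {0..2 * pi}" "\<And>x. 0 \<le> g x" for g :: "real \<Rightarrow> real"
    using nonnegative_absolutely_integrable_1[of g "{0..2 * pi}"] that
    by (simp add: set_integrable_def integrable_restrict_space)
  have int: "(\<lambda>\<theta>. \<theta> powr (- \<kappa>)) integrable_on {0..2 * pi}"
    using assms by (intro integrable_on_powr_from_0) auto
  then show "integrable circle_angles (\<lambda>\<theta>. \<theta> powr (- \<kappa>))"
    by (intro *) auto
  from int obtain I where "((\<lambda>\<theta>. \<theta> powr (- \<kappa>)) has_integral I) (cbox 0 (2 * pi))"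
    by (auto simp: integrable_on_def)
  from has_integral_affinity[OF this, of "-1" "2 * pi"]
  have "((\<lambda>\<theta>. (2 * pi - \<theta>) powr (- \<kappa>)) has_integral I) ((\<lambda>x. 2 * pi - x) ` {0..2 * pi})"
    by simp
  moreover have "(\<lambda>x. 2 * pi - x) ` {0..2 * pi} = {0..2 * pi}"
    by (auto intro!: image_eqI[of _ _ "2 * pi - x" for x])
  ultimately show "integrable circle_angles (\<lambda>\<theta>. (2 * pi - \<theta>) powr (- \<kappa>))"
    by (intro *) (auto simp: integrable_on_def)
qed

lemma AE_circle_interior: "AE \<theta> in circle_angles. 0 < \<theta> \<and> \<theta> < 2 * pi"
proof -
  have "AE \<theta> in lebesgue. \<theta> \<noteq> 0 \<and> \<theta> \<noteq> 2 * pi"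
    by (intro AE_conjI AE_completion AE_lborel_singleton)
  then have "AE \<theta> in lebesgue. \<theta> \<in> {0..2 * pi} \<longrightarrow> 0 < \<theta> \<and> \<theta> < 2 * pi"
    by eventually_elim auto
  then show ?thesis
    by (subst AE_restrict_space_iff) auto
qed

lemma cis_neq_1:
  assumes "0 < \<theta>" "\<theta> < 2 * pi"
  shows "cis \<theta> \<noteq> 1"
proof
  assume "cis \<theta> = 1"
  then have "sin (\<theta> / 2) = 0"
    using dist_exp_i_1[of \<theta>] by (simp add: cis_conv_exp)
  moreover have "sin (\<theta> / 2) > 0"
    using assms by (intro sin_gt_zero) auto
  ultimately show False by simp
qed

text \<open>
  A singular inner factor could only sit at the point \<open>1\<close>, and the bound with \<open>\<kappa> < 1\<close> leaves it too
  little room.  In detail, a holomorphic logarithm of \<open>f\<close> is represented by the Schwarz formula on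
  every circle of radius less than \<open>1\<close>, and the real parts on these circles have a common integrable
  majorant, so the radii may tend to \<open>1\<close>.
\<close>

lemma outer_with_log_modulus:
  fixes f :: "complex \<Rightarrow> complex"
  assumes holf: "f holomorphic_on ball 0 1" and contf: "continuous_on (cball 0 1 - {1}) f"
    and nz: "\<And>\<zeta>. \<zeta> \<in> cball 0 1 - {1} \<Longrightarrow> f \<zeta> \<noteq> 0"
    and bound: "\<And>\<zeta>. \<zeta> \<in> cball 0 1 - {1} \<Longrightarrow> \<bar>ln (norm (f \<zeta>))\<bar> \<le> K * norm (1 - \<zeta>) powr (- \<kappa>)"
    and \<kappa>: "0 < \<kappa>" "\<kappa> < 1"
  shows "outer_with f (\<lambda>\<theta>. ln (norm (f (cis \<theta>))))"
proof -
  define u where "u \<theta> = ln (norm (f (cis \<theta>)))" for \<theta>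
  have K: "K \<ge> 0"
    using bound[of 0] by simp
  obtain L where holL: "L holomorphic_on ball 0 1" and L: "\<And>z. z \<in> ball 0 1 \<Longrightarrow> exp (L z) = f z"
  proof (rule holomorphic_logarithm_exists[of "ball 0 1" f 0])
    show "f z \<noteq> 0" if "z \<in> ball 0 1" for z
      using that by (intro nz) auto
  qed (use holf in auto)
  have ReL: "Re (L z) = ln (norm (f z))" if "z \<in> ball 0 1" for z
    using L[OF that] by (metis ln_exp norm_exp_eq_Re)
  have contL: "continuous_on (ball 0 1) L"
    using holL by (rule holomorphic_on_imp_continuous_on)
  \<comment> \<open>Radii increasing to \<open>1\<close>; the shift by \<open>2\<close> keeps them positive.\<close>
  define r where "r n = 1 - 1 / (real n + 2)" for n
  have r: "0 < r n" "r n < 1" for n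
    by (auto simp: r_def field_simps)
  have rlim: "r \<longlonglongrightarrow> 1"
    unfolding r_def by real_asymp
  have rball: "of_real (r n) * z \<in> ball 0 1" if "norm z \<le> 1" for n and z :: complex
  proof -
    have "r n * norm z \<le> r n * 1"
      using that r[of n] by (intro mult_left_mono) auto
    then have "r n * norm z < 1" using r[of n] by linarith
    then show ?thesis using r[of n] by (simp add: norm_mult)
  qed
  define v where "v n \<theta> = Re (L (of_real (r n) * cis \<theta>))" for n \<theta>
  have v: "v n \<theta> = ln (norm (f (of_real (r n) * cis \<theta>)))" for n \<theta>
    unfolding v_def by (intro ReL rball) simp
  have Sch: "L (of_real (r n) * z) = \<i> * Im (L 0) + schwarz_integral (v n) z" if "norm z < 1" for n z
  proof -
    have "(\<lambda>z. L (of_real (r n) * z)) holomorphic_on ball 0 1"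
      using rball by (intro holomorphic_on_compose_gen[OF _ holL, unfolded o_def] holomorphic_intros) auto
    moreover have "continuous_on (cball 0 1) (\<lambda>z. L (of_real (r n) * z))"
      using rball by (intro continuous_on_compose2[OF contL] continuous_intros) auto
    ultimately show ?thesis
      using Schwarz_formula[of "\<lambda>z. L (of_real (r n) * z)" z] that by (simp add: v_def [abs_def])
  qed
  define w where
    "w \<theta> = K * 2 powr \<kappa> * (3 powr \<kappa> * (\<theta> powr (- \<kappa>) + (2 * pi - \<theta>) powr (- \<kappa>)))" for \<theta>
  have intw: "integrable circle_angles w"
    unfolding w_def using integrable_circle_powr[OF \<kappa>(2)] by auto
  have vw: "\<bar>v n \<theta>\<bar> \<le> w \<theta>" if "0 < \<theta>" "\<theta> < 2 * pi" for n \<theta>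
  proof -
    let ?z = "of_real (r n) * cis \<theta>"
    have "norm (1 - cis \<theta>) \<le> norm (1 - ?z) + norm (?z - cis \<theta>)"
      using norm_triangle_ineq[of "1 - ?z" "?z - cis \<theta>"] by simp
    also have "norm (?z - cis \<theta>) = 1 - r n"
    proof -
      have "?z - cis \<theta> = of_real (r n - 1) * cis \<theta>" by (simp add: algebra_simps)
      then show ?thesis using r[of n] by (simp add: norm_mult del: of_real_diff)
    qed
    also have "1 - r n \<le> norm (1 - ?z)"
      using norm_triangle_ineq2[of 1 ?z] r[of n] by (simp add: norm_mult)
    \<comment> \<open>Moving radially inwards at most halves the distance to \<open>1\<close>.\<close>
    finally have le: "norm (1 - cis \<theta>) / 2 \<le> norm (1 - ?z)" by simp
    have pos: "0 < norm (1 - cis \<theta>)"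
      using cis_neq_1[OF that] by simp
    have "\<bar>v n \<theta>\<bar> \<le> K * norm (1 - ?z) powr (- \<kappa>)"
      unfolding v using rball[of "cis \<theta>" n] le pos by (intro bound) auto
    also have "norm (1 - ?z) powr (- \<kappa>) \<le> (norm (1 - cis \<theta>) / 2) powr (- \<kappa>)"
      using le pos \<kappa> by (intro powr_mono2') auto
    also have "\<dots> = 2 powr \<kappa> * norm (1 - cis \<theta>) powr (- \<kappa>)"
      using pos by (simp add: powr_divide powr_minus field_simps)
    also have "norm (1 - cis \<theta>) powr (- \<kappa>)
        \<le> 3 powr \<kappa> * (\<theta> powr (- \<kappa>) + (2 * pi - \<theta>) powr (- \<kappa>))"
      using that \<kappa> by (intro norm_one_minus_cis_powr_le) auto
    finally show ?thesis
      using K by (simp add: w_def mult_left_mono mult.assoc)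
  qed
  have vlim: "(\<lambda>n. v n \<theta>) \<longlonglongrightarrow> u \<theta>" if "0 < \<theta>" "\<theta> < 2 * pi" for \<theta>
  proof -
    have "(\<lambda>n. of_real (r n) * cis \<theta>) \<longlonglongrightarrow> of_real 1 * cis \<theta>"
      by (intro tendsto_intros rlim)
    moreover have "of_real (r n) * cis \<theta> \<in> cball 0 1 - {1}" for n
      using rball[of "cis \<theta>" n] by auto
    moreover have "cis \<theta> \<in> cball 0 1 - {1}"
      using cis_neq_1[OF that] by simp
    ultimately have "(\<lambda>n. f (of_real (r n) * cis \<theta>)) \<longlonglongrightarrow> f (cis \<theta>)"
      using contf by (intro continuous_on_tendsto_compose[OF contf]) auto
    then show ?thesis
      unfolding v u_def using nz[of "cis \<theta>"] cis_neq_1[OF that] by (intro tendsto_intros) auto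
  qed
  have vmeas [measurable]: "v n \<in> borel_measurable circle_angles" for n
  proof -
    have "continuous_on {0..2 * pi} (v n)"
      unfolding v_def using rball by (intro continuous_intros continuous_on_compose2[OF contL]) auto
    then show ?thesis
      by (intro continuous_imp_measurable_on_sets_lebesgue) auto
  qed
  have AElim: "AE \<theta> in circle_angles. (\<lambda>n. v n \<theta>) \<longlonglongrightarrow> u \<theta>"
    using AE_circle_interior by eventually_elim (auto intro: vlim)
  have AEbound: "AE \<theta> in circle_angles. \<bar>v n \<theta>\<bar> \<le> w \<theta>" for n
    using AE_circle_interior by eventually_elim (auto intro: vw)
  \<comment> \<open>The two end points correspond to \<open>1\<close>, at which \<open>f\<close> need not be continuous.\<close>
  have umeas: "u \<in> borel_measurable circle_angles"
  proof -
    have "continuous_on {0<..<2 * pi} u"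
      unfolding u_def using cis_neq_1 nz
      by (intro continuous_intros continuous_on_compose2[OF contf]) auto
    then have "u \<in> borel_measurable (lebesgue_on {0<..<2 * pi})"
      by (intro continuous_imp_measurable_on_sets_lebesgue) auto
    then have "(\<lambda>\<theta>. if \<theta> \<in> {0<..<2 * pi} then u \<theta> else 0) \<in> borel_measurable lebesgue"
      by (subst borel_measurable_if) auto
    then have "(\<lambda>\<theta>. if \<theta> \<in> {0..2 * pi} then u \<theta> else 0) \<in> borel_measurable lebesgue"
      by (rule measurable_discrete_difference[where X = "{0, 2 * pi}"]) auto
    then show ?thesis
      by (subst (asm) borel_measurable_if) auto
  qed
  have "integrable circle_angles u"
    using AElim AEbound
    by (intro integrable_dominated_convergence[OF umeas _ intw AElim]) auto
  moreover have "f \<zeta> = cis (Im (L 0)) * exp (schwarz_integral u \<zeta>)" if \<zeta>: "\<zeta> \<in> ball 0 1" for \<zeta>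
  proof -
    have "(\<lambda>n. \<i> * Im (L 0) + schwarz_integral (v n) \<zeta>) \<longlonglongrightarrow> \<i> * Im (L 0) + schwarz_integral u \<zeta>"
      using \<zeta> umeas AElim AEbound
      by (intro tendsto_intros schwarz_integral_tendsto[OF _ intw]) auto
    moreover have "(\<lambda>n. L (of_real (r n) * \<zeta>)) \<longlonglongrightarrow> L \<zeta>"
    proof (rule continuous_on_tendsto_compose[OF contL])
      have "(\<lambda>n. of_real (r n) * \<zeta>) \<longlonglongrightarrow> of_real 1 * \<zeta>"
        by (intro tendsto_intros rlim)
      then show "(\<lambda>n. of_real (r n) * \<zeta>) \<longlonglongrightarrow> \<zeta>" by simp
      show "\<forall>\<^sub>F n in sequentially. of_real (r n) * \<zeta> \<in> ball 0 1"
        using rball \<zeta> by auto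
    qed (use \<zeta> in auto)
    ultimately have "L \<zeta> = \<i> * Im (L 0) + schwarz_integral u \<zeta>"
      using Sch \<zeta> by (intro LIMSEQ_unique) auto
    then show ?thesis
      using L[OF \<zeta>] by (simp add: exp_add cis_conv_exp)
  qed
  ultimately show ?thesis
    unfolding outer_with_def u_def[symmetric] by (auto intro!: exI[of _ "cis (Im (L 0))"])
qed

section \<open>Subexponential functions in the Smirnov class\<close>

text \<open>
  The power \<open>w \<mapsto> w\<^sup>-\<^sup>\<kappa>\<close> maps the right half-plane into a sector of opening \<open>\<kappa> \<pi> < \<pi>\<close>, on which the
  real part is comparable to the modulus.
\<close>

lemma Re_powr_minus_ge:
  assumes "Re w > 0" "0 < \<kappa>" "\<kappa> < 1"
  shows "cos (\<kappa> * pi / 2) * norm w powr (- \<kappa>) \<le> Re (w powr (- of_real \<kappa>))"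
proof -
  have w: "w \<noteq> 0" using assms by auto
  have "\<bar>Im (Ln w)\<bar> < pi / 2"
    using assms Re_Ln_pos_lt w by auto
  then have "cos (\<kappa> * pi / 2) \<le> cos \<bar>\<kappa> * Im (Ln w)\<bar>"
    using assms by (intro cos_monotone_0_pi_le) (auto simp: abs_mult field_simps)
  then have "norm w powr (- \<kappa>) * cos (\<kappa> * pi / 2) \<le> norm w powr (- \<kappa>) * cos (\<kappa> * Im (Ln w))"
    by (intro mult_left_mono) auto
  also have "\<dots> = Re (w powr (- of_real \<kappa>))"
    using w by (simp add: powr_def Re_exp del: exp_minus exp_of_real)
  finally show ?thesis by (simp add: mult.commute)
qed

text \<open>
  The function is \<open>exp (- (C / a) (1 - \<zeta>)\<^sup>-\<^sup>\<kappa>)\<close>, where \<open>a = cos (\<kappa> \<pi> / 2)\<close> is the loss in passing from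
  modulus to real part.
\<close>

lemma exists_outer_minorant:
  assumes \<kappa>: "0 < \<kappa>" "\<kappa> < 1" and C: "C \<ge> 0"
  obtains h u where "h holomorphic_on ball 0 1" "outer_with h u"
    "\<And>\<zeta>. \<zeta> \<in> ball 0 1 \<Longrightarrow> norm (h \<zeta>) \<le> exp (- C * norm (1 - \<zeta>) powr (- \<kappa>))"
proof -
  define a where "a = cos (\<kappa> * pi / 2)"
  have a: "a > 0"
    unfolding a_def using \<kappa> by (intro cos_gt_zero_pi) (auto simp: field_simps intro: less_le_trans[of _ 0])
  define h where "h \<zeta> = exp (- of_real (C / a) * (1 - \<zeta>) powr (- of_real \<kappa>))" for \<zeta> :: complex
  have Re: "Re (1 - \<zeta>) > 0" if "\<zeta> \<in> cball 0 1 - {1}" for \<zeta> :: complex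
  proof (rule ccontr)
    assume "\<not> 0 < Re (1 - \<zeta>)"
    then have "Re \<zeta> \<ge> 1" by simp
    moreover have "(Re \<zeta>)\<^sup>2 + (Im \<zeta>)\<^sup>2 \<le> 1"
      using that by (simp add: cmod_def)
    moreover have "1 \<le> (Re \<zeta>)\<^sup>2"
      using \<open>Re \<zeta> \<ge> 1\<close> by (rule one_le_power)
    moreover have "0 \<le> (Im \<zeta>)\<^sup>2" by simp
    ultimately have "(Im \<zeta>)\<^sup>2 = 0" "(Re \<zeta>)\<^sup>2 = 1" by linarith+
    then have "Im \<zeta> = 0" "Re \<zeta> = 1"
      using \<open>Re \<zeta> \<ge> 1\<close> by (auto simp: power2_eq_1_iff)
    then show False using that by (auto simp: complex_eq_iff)
  qed
  have nonpos: "1 - \<zeta> \<notin> \<real>\<^sub>\<le>\<^sub>0" if "\<zeta> \<in> cball 0 1 - {1}" for \<zeta> :: complex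
    using Re[OF that] by (auto simp: complex_nonpos_Reals_iff)
  have hol: "h holomorphic_on ball 0 1"
  proof -
    have "1 - \<zeta> \<notin> \<real>\<^sub>\<le>\<^sub>0" if "\<zeta> \<in> ball 0 1" for \<zeta> :: complex
      using that by (intro nonpos) auto
    then show ?thesis
      unfolding h_def by (intro holomorphic_intros) auto
  qed
  have lnh: "ln (norm (h \<zeta>)) = - (C / a) * Re ((1 - \<zeta>) powr (- of_real \<kappa>))" for \<zeta>
    by (simp add: h_def del: of_real_divide)
  have "outer_with h (\<lambda>\<theta>. ln (norm (h (cis \<theta>))))"
  proof (rule outer_with_log_modulus[OF hol _ _ _ \<kappa>])
    show "continuous_on (cball 0 1 - {1}) h"
    proof -
      have "cball 0 1 - {1} \<subseteq> {z. Re (1 - z) \<ge> 0 \<or> Im (1 - z) \<noteq> 0}"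
        using Re by (intro subsetI CollectI disjI1 less_imp_le)
      then show ?thesis
        unfolding h_def
        by (intro continuous_intros continuous_on_powr_complex) auto
    qed
    show "\<bar>ln (norm (h \<zeta>))\<bar> \<le> C / a * norm (1 - \<zeta>) powr (- \<kappa>)" if "\<zeta> \<in> cball 0 1 - {1}" for \<zeta>
    proof -
      have "\<bar>Re ((1 - \<zeta>) powr (- of_real \<kappa>))\<bar> \<le> norm ((1 - \<zeta>) powr (- of_real \<kappa>))"
        by (rule abs_Re_le_cmod)
      also have "\<dots> = norm (1 - \<zeta>) powr (- \<kappa>)"
        using norm_powr_real_powr'[of "- complex_of_real \<kappa>" "1 - \<zeta>"] by simp
      finally show ?thesis
        unfolding lnh abs_mult using C a by (auto intro!: mult_left_mono divide_right_mono)
    qed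
  qed (auto simp: h_def)
  moreover have "norm (h \<zeta>) \<le> exp (- C * norm (1 - \<zeta>) powr (- \<kappa>))" if "\<zeta> \<in> ball 0 1" for \<zeta>
  proof -
    have "\<zeta> \<in> cball 0 1 - {1}" using that by auto
    from Re_powr_minus_ge[OF Re[OF this] \<kappa>]
    have "C / a * (a * norm (1 - \<zeta>) powr (- \<kappa>)) \<le> C / a * Re ((1 - \<zeta>) powr (- of_real \<kappa>))"
      using a C unfolding a_def[symmetric] by (intro mult_left_mono) auto
    then have "- (C / a) * Re ((1 - \<zeta>) powr (- of_real \<kappa>)) \<le> - C * norm (1 - \<zeta>) powr (- \<kappa>)"
      using a by simp
    then have "exp (ln (norm (h \<zeta>))) \<le> exp (- C * norm (1 - \<zeta>) powr (- \<kappa>))"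
      unfolding lnh by simp
    then show ?thesis by (simp add: h_def)
  qed
  ultimately show ?thesis using hol that by blast
qed

text \<open>
  One outer minorant for the larger of the two bounds makes both the numerator and the denominator
  bounded; the denominator stays outer since products of outer functions are outer.
\<close>

lemma smirnov_quotient:
  assumes f: "f holomorphic_on ball 0 1"
    and g: "g holomorphic_on ball 0 1" "\<And>\<zeta>. \<zeta> \<in> ball 0 1 \<Longrightarrow> norm (g \<zeta>) \<le> exp (B * norm (1 - \<zeta>) powr (- \<kappa>))"
    and d: "d holomorphic_on ball 0 1" "\<And>\<zeta>. \<zeta> \<in> ball 0 1 \<Longrightarrow> norm (d \<zeta>) \<le> exp (C * norm (1 - \<zeta>) powr (- \<kappa>))"
    and outer: "outer_with d v"
    and eq: "\<And>\<zeta>. \<zeta> \<in> ball 0 1 \<Longrightarrow> f \<zeta> = g \<zeta> / d \<zeta>"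
    and \<kappa>: "0 < \<kappa>" "\<kappa> < 1"
  shows "f \<in> smirnov"
proof -
  obtain h u where h: "h holomorphic_on ball 0 1" "outer_with h u"
    "\<And>\<zeta>. \<zeta> \<in> ball 0 1 \<Longrightarrow> norm (h \<zeta>) \<le> exp (- max 0 (max B C) * norm (1 - \<zeta>) powr (- \<kappa>))"
    using exists_outer_minorant[OF \<kappa>, of "max 0 (max B C)"] by auto
  have nz: "h \<zeta> \<noteq> 0" if "\<zeta> \<in> ball 0 1" for \<zeta>
    using h(2) that by (force simp: outer_with_def)
  have bdd: "(\<lambda>\<zeta>. k \<zeta> * h \<zeta>) \<in> H_infty"
    if "k holomorphic_on ball 0 1" "D \<le> max 0 (max B C)"
      "\<And>\<zeta>. \<zeta> \<in> ball 0 1 \<Longrightarrow> norm (k \<zeta>) \<le> exp (D * norm (1 - \<zeta>) powr (- \<kappa>))" for k D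
  proof -
    have "norm (k \<zeta> * h \<zeta>) \<le> 1" if "\<zeta> \<in> ball 0 1" for \<zeta>
    proof -
      have "norm (k \<zeta> * h \<zeta>) \<le> exp (D * norm (1 - \<zeta>) powr (- \<kappa>)) *
          exp (- max 0 (max B C) * norm (1 - \<zeta>) powr (- \<kappa>))"
        unfolding norm_mult using \<open>\<zeta> \<in> ball 0 1\<close> by (intro mult_mono h(3) \<open>\<And>\<zeta>. \<zeta> \<in> ball 0 1 \<Longrightarrow> norm (k \<zeta>) \<le> _\<close>) auto
      also have "\<dots> = exp ((D - max 0 (max B C)) * norm (1 - \<zeta>) powr (- \<kappa>))"
        by (simp add: algebra_simps flip: exp_add)
      also have "\<dots> \<le> 1"
        using \<open>D \<le> _\<close> by (simp add: mult_nonpos_nonneg)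
      finally show ?thesis .
    qed
    then show ?thesis
      unfolding H_infty_def bounded_iff using that(1) h(1)
      by (auto intro!: holomorphic_intros exI[of _ 1])
  qed
  have "outer_fun (\<lambda>\<zeta>. d \<zeta> * h \<zeta>)"
    using d(1) h(1)
    by (intro outer_with_imp_outer_fun[OF _ outer_with_mult[OF outer h(2)]] holomorphic_intros)
  moreover have "(\<lambda>\<zeta>. g \<zeta> * h \<zeta>) \<in> H_infty" "(\<lambda>\<zeta>. d \<zeta> * h \<zeta>) \<in> H_infty"
    using bdd[OF g(1) _ g(2)] bdd[OF d(1) _ d(2)] by auto
  ultimately show ?thesis
    unfolding smirnov_def mem_Collect_eq using f nz eq
    by (intro conjI bexI[of _ "\<lambda>\<zeta>. g \<zeta> * h \<zeta>"] bexI[of _ "\<lambda>\<zeta>. d \<zeta> * h \<zeta>"]) auto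
qed

lemma outer_with_one: "outer_with (\<lambda>_. 1) (\<lambda>_. 0)"
  by (auto simp: outer_with_def schwarz_integral_def intro!: exI[of _ 1])

lemma smirnov_subexponential:
  assumes f: "f holomorphic_on ball 0 1"
    and bound: "\<And>\<zeta>. \<zeta> \<in> ball 0 1 \<Longrightarrow> norm (f \<zeta>) \<le> exp (B * norm (1 - \<zeta>) powr (- \<kappa>))"
    and \<kappa>: "0 < \<kappa>" "\<kappa> < 1"
  shows "f \<in> smirnov"
  by (rule smirnov_quotient[where B = B and C = 0, OF f f _ _ _ outer_with_one _ \<kappa>])
    (use bound in auto)

lemma smirnov_cong:
  assumes "g \<in> smirnov" "\<And>\<zeta>. \<zeta> \<in> ball 0 1 \<Longrightarrow> f \<zeta> = g \<zeta>"
  shows "f \<in> smirnov"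
  using assms holomorphic_cong[OF refl, of "ball 0 1" f g] unfolding smirnov_def by auto

lemma smirnov_mat_cong:
  assumes "g \<in> smirnov_mat" "\<And>\<zeta>. \<zeta> \<in> ball 0 1 \<Longrightarrow> f \<zeta> = g \<zeta>"
  shows "f \<in> smirnov_mat"
  unfolding smirnov_mat_def
proof (intro CollectI allI)
  fix i j
  have "(\<lambda>\<zeta>. g \<zeta> $ i $ j) \<in> smirnov"
    using assms(1) by (simp add: smirnov_mat_def)
  then show "(\<lambda>\<zeta>. f \<zeta> $ i $ j) \<in> smirnov"
    by (rule smirnov_cong) (simp add: assms(2))
qed

lemma outer_fun_cong:
  assumes "outer_fun g" "\<And>\<zeta>. \<zeta> \<in> ball 0 1 \<Longrightarrow> f \<zeta> = g \<zeta>"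
  shows "outer_fun f"
  using assms holomorphic_cong[OF refl, of "ball 0 1" f g] unfolding outer_fun_def by simp

section \<open>The map from the disk to the half-plane\<close>

text \<open>
  The substitution hidden in the hat notation: a Moebius map of the disk onto the upper half-plane that
  sends \<open>0\<close> to \<open>z0\<close> and \<open>1\<close> to infinity.
\<close>

definition disk_to_plane :: "complex \<Rightarrow> complex \<Rightarrow> complex"
  where "disk_to_plane z0 \<zeta> = (cnj z0 * \<zeta> - z0) / (\<zeta> - 1)"

lemma Im_disk_to_plane:
  assumes "\<zeta> \<noteq> 1"
  shows "Im (disk_to_plane z0 \<zeta>) = Im z0 * (1 - (norm \<zeta>)\<^sup>2) / (norm (\<zeta> - 1))\<^sup>2"
  unfolding disk_to_plane_def Im_divide cmod_power2
  by (rule arg_cong2[where f = "(/)"]) (simp_all add: power2_eq_square algebra_simps)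

lemma Im_disk_to_plane_nonneg:
  assumes "Im z0 > 0" "\<zeta> \<in> cball 0 1 - {1}"
  shows "0 \<le> Im (disk_to_plane z0 \<zeta>)"
  using assms by (simp add: Im_disk_to_plane power_le_one)

lemma Im_disk_to_plane_pos:
  assumes "Im z0 > 0" "\<zeta> \<in> ball 0 1"
  shows "0 < Im (disk_to_plane z0 \<zeta>)"
proof -
  have "(norm \<zeta>)\<^sup>2 < 1" "\<zeta> \<noteq> 1"
    using assms by (auto simp: power_less_one_iff abs_square_less_1)
  then show ?thesis using assms(1) by (simp add: Im_disk_to_plane)
qed

lemma norm_disk_to_plane_le:
  assumes "\<zeta> \<in> cball 0 1"
  shows "norm (disk_to_plane z0 \<zeta>) \<le> 2 * norm z0 / norm (1 - \<zeta>)"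
proof -
  have "norm (cnj z0 * \<zeta> - z0) \<le> norm (cnj z0 * \<zeta>) + norm z0"
    by (rule norm_triangle_ineq4)
  also have "norm (cnj z0 * \<zeta>) \<le> norm z0 * 1"
    unfolding norm_mult using assms by (intro mult_mono) auto
  finally show ?thesis
    by (simp add: disk_to_plane_def norm_divide norm_minus_commute divide_right_mono)
qed

section \<open>Complex Hilbert spaces and adjoints\<close>

lemma cinner_add_right: "cinner x (y + w) = cinner x y + cinner (x :: 'a::chilbert_space) w"
  by (subst (1 2 3) cinner_commute) (simp add: cinner_add_left)

lemma cinner_scaleC_right: "cinner x (c *\<^sub>C y) = cnj c * cinner (x :: 'a::chilbert_space) y"
  by (subst (1 2) cinner_commute) (simp add: cinner_scaleC_left)

lemma cinner_diff_left: "cinner (x - y) w = cinner x w - cinner (y :: 'a::chilbert_space) w"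
  using cinner_add_left[of "x - y" y w] by simp

lemma cinner_diff_right: "cinner w (x - y) = cinner w x - cinner w (y :: 'a::chilbert_space)"
  using cinner_add_right[of w "x - y" y] by simp

lemma cinner_zero_left [simp]: "cinner 0 (x :: 'a::chilbert_space) = 0"
  using cinner_diff_left[of 0 0 x] by simp

lemma cinner_zero_right [simp]: "cinner (x :: 'a::chilbert_space) 0 = 0"
  using cinner_diff_right[of x 0 0] by simp

lemmas cinner_simps = cinner_add_left cinner_add_right cinner_diff_left cinner_diff_right
  cinner_scaleC_left cinner_scaleC_right

lemma cinner_self: "cinner x x = of_real ((norm (x :: 'a::chilbert_space))\<^sup>2)"
proof (rule complex_eqI)
  show "Re (cinner x x) = Re (of_real ((norm x)\<^sup>2))"
    by (simp add: Re_cinner power2_norm_eq_inner)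
  show "Im (cinner x x) = Im (of_real ((norm x)\<^sup>2))"
    using arg_cong[OF cinner_commute[of x x], of Im] by simp
qed

lemma norm_scaleC: "norm (c *\<^sub>C x) = norm c * norm (x :: 'a::chilbert_space)"
proof -
  have "complex_of_real ((norm (c *\<^sub>C x))\<^sup>2) = of_real ((norm c * norm x)\<^sup>2)"
    unfolding cinner_self[symmetric] cinner_scaleC_left cinner_scaleC_right
    by (simp add: cinner_self power_mult_distrib complex_norm_square[unfolded of_real_power] mult_ac)
  then have "(norm (c *\<^sub>C x))\<^sup>2 = (norm c * norm x)\<^sup>2"
    unfolding of_real_eq_iff .
  then show ?thesis
    by (rule power2_eq_imp_eq) auto
qed

lemma scaleC_zero_right [simp]: "c *\<^sub>C (0 :: 'a::chilbert_space) = 0"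
  using norm_scaleC[of c "0 :: 'a"] by simp

lemma scaleC_diff_left: "(c - d) *\<^sub>C x = c *\<^sub>C x - d *\<^sub>C (x :: 'a::chilbert_space)"
  using scaleC_add_left[of "c - d" d x] by simp

lemma norm_cinner_le: "norm (cinner x y) \<le> norm x * norm (y :: 'a::chilbert_space)"
proof (cases "cinner x y = 0")
  case False
  define a where "a = cinner x y"
  define c where "c = cnj a / of_real (norm a)"
  have a: "norm a \<noteq> 0" using False by (simp add: a_def)
  have "c * a = of_real ((norm a)\<^sup>2) / of_real (norm a)"
    unfolding c_def complex_norm_square by (simp add: mult.commute)
  also have "\<dots> = of_real (norm a)"
    using a by (simp add: power2_eq_square)
  finally have "c * cinner x y = of_real (norm (cinner x y))"
    by (simp only: a_def)
  then have "norm (cinner x y) = Re (cinner (c *\<^sub>C x) y)"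
    by (simp add: cinner_scaleC_left)
  also have "\<dots> \<le> norm (c *\<^sub>C x) * norm y"
    unfolding Re_cinner by (rule norm_cauchy_schwarz)
  also have "norm c = 1"
    using a by (simp add: c_def norm_divide)
  then have "norm (c *\<^sub>C x) = norm x"
    by (simp add: norm_scaleC)
  finally show ?thesis .
qed simp

lemma cinner_left_eqI:
  assumes "\<And>w. cinner w x = cinner w (y :: 'a::chilbert_space)"
  shows "x = y"
proof -
  have "cinner (x - y) (x - y) = 0"
    using assms[of "x - y"] by (simp add: cinner_diff_right)
  then show ?thesis by (simp add: cinner_self)
qed

text \<open>
  The representing vector minimizes \<open>|x|\<^sup>2 - 2 \<phi> x\<close>: by the parallelogram law every minimizing sequence
  is Cauchy, and at the minimum the derivative in every direction vanishes.
\<close>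

lemma Riesz_representation:
  fixes \<phi> :: "'a::{real_inner, complete_space} \<Rightarrow> real"
  assumes "bounded_linear \<phi>"
  obtains y where "\<And>x. \<phi> x = inner x y"
proof -
  have lin: "\<phi> (x + y) = \<phi> x + \<phi> y" "\<phi> (r *\<^sub>R x) = r * \<phi> x" "\<phi> 0 = 0" for x y r
    using bounded_linear.linear[OF assms] by (auto simp: linear_add linear_scale linear_0)
  obtain K where K: "\<And>x. norm (\<phi> x) \<le> norm x * K"
    using bounded_linear.bounded[OF assms] by blast
  define F where "F x = (norm x)\<^sup>2 - 2 * \<phi> x" for x
  have lower: "- K\<^sup>2 \<le> F x" for x
  proof -
    have "0 \<le> (norm x - K)\<^sup>2" by simp
    then show ?thesis using K[of x] by (simp add: F_def power2_eq_square algebra_simps)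
  qed
  have bdd: "bdd_below (range F)"
    using lower by (intro bdd_belowI) auto
  define m where "m = Inf (range F)"
  have m: "m \<le> F x" for x
    unfolding m_def by (intro cInf_lower bdd) auto
  have "\<exists>x. F x < m + inverse (real (Suc n))" for n
  proof -
    have "Inf (range F) < m + inverse (real (Suc n))" by (simp add: m_def)
    then show ?thesis by (subst (asm) cInf_less_iff) (use bdd in auto)
  qed
  then obtain X where X: "\<And>n. F (X n) < m + inverse (real (Suc n))" by metis
  have parallelogram: "(norm (x - y))\<^sup>2 \<le> 2 * (F x - m) + 2 * (F y - m)" for x y
  proof -
    have "(norm (x - y))\<^sup>2 = 2 * F x + 2 * F y - 4 * F ((1/2) *\<^sub>R (x + y))"
      by (simp add: F_def power2_norm_eq_inner inner_simps lin algebra_simps inner_commute)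
    then show ?thesis using m[of "(1/2) *\<^sub>R (x + y)"] by simp
  qed
  have "Cauchy X"
  proof (rule CauchyI)
    fix e :: real assume e: "e > 0"
    then obtain N where N: "inverse (real (Suc N)) < e\<^sup>2 / 4"
      using reals_Archimedean[of "e\<^sup>2 / 4"] by auto
    have "norm (X i - X j) < e" if "i \<ge> N" "j \<ge> N" for i j
    proof -
      have "inverse (real (Suc i)) \<le> inverse (real (Suc N))" "inverse (real (Suc j)) \<le> inverse (real (Suc N))"
        using that by (simp_all add: le_imp_inverse_le del: of_nat_Suc)
      then have "F (X i) - m < e\<^sup>2 / 4" "F (X j) - m < e\<^sup>2 / 4"
        using X[of i] X[of j] N by linarith+
      then have "(norm (X i - X j))\<^sup>2 < e\<^sup>2"
        using parallelogram[of "X i" "X j"] by simp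
      then show ?thesis using e by (simp add: power2_less_imp_less)
    qed
    then show "\<exists>N. \<forall>i\<ge>N. \<forall>j\<ge>N. norm (X i - X j) < e" by blast
  qed
  then obtain y where y: "X \<longlonglongrightarrow> y"
    using Cauchy_convergent convergent_def by blast
  have "(\<lambda>n. F (X n)) \<longlonglongrightarrow> F y"
    unfolding F_def by (intro tendsto_intros y bounded_linear.tendsto[OF assms])
  moreover have "(\<lambda>n. m + inverse (real (Suc n))) \<longlonglongrightarrow> m + 0"
    by (intro tendsto_intros LIMSEQ_inverse_real_of_nat)
  ultimately have "F y \<le> m + 0"
    using X by (intro LIMSEQ_le) (auto intro: less_imp_le)
  then have min: "F y \<le> F x" for x
    using m[of x] by simp
  have "\<phi> x = inner x y" for x
  proof (cases "x = 0")
    case False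
    define b where "b = inner x y - \<phi> x"
    define t where "t = - (b / (norm x)\<^sup>2)"
    have "F (y + t *\<^sub>R x) = F y + 2 * t * b + t * t * (norm x)\<^sup>2"
      by (simp add: F_def b_def power2_norm_eq_inner inner_simps lin algebra_simps inner_commute)
    then have "0 \<le> 2 * t * b + t * t * (norm x)\<^sup>2"
      using min[of "y + t *\<^sub>R x"] by simp
    also have "\<dots> = - (b\<^sup>2 / (norm x)\<^sup>2)"
      using False by (simp add: t_def power2_eq_square field_simps)
    finally have "b\<^sup>2 / (norm x)\<^sup>2 \<le> 0" by simp
    then have "b = 0" using False by (simp add: divide_le_0_iff)
    then show ?thesis by (simp add: b_def)
  qed (simp add: lin)
  then show ?thesis by (rule that)
qed

lemma bounded_clinear_bound:
  assumes "bounded_clinear f"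
  obtains K where "K > 0" "\<And>x. norm (f x) \<le> K * norm x"
  using assms bounded_linear.pos_bounded[of f] unfolding bounded_clinear_def
  by (metis mult.commute)

lemma bounded_clinear_imp:
  assumes "bounded_clinear f"
  shows "f (x + y) = f x + f y" "f (x - y) = f x - f y" "f (c *\<^sub>C x) = c *\<^sub>C f x" "f 0 = 0"
  using assms linear_add[of f] linear_diff[of f] linear_0[of f]
  unfolding bounded_clinear_def by (auto dest: bounded_linear.linear)

lemma bounded_clinearI:
  assumes "\<And>x y. f (x + y) = f x + f y" "\<And>c x. f (c *\<^sub>C x) = c *\<^sub>C f x"
    and "\<And>x. norm (f x) \<le> K * norm x"
  shows "bounded_clinear f"
  unfolding bounded_clinear_def
proof (intro conjI allI assms)
  show "bounded_linear f"
    by (rule bounded_linear_intro[of _ K])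
      (use assms in \<open>auto simp: mult.commute simp flip: scaleC_of_real\<close>)
qed

text \<open>
  The adjoint is a definite description, so existence and uniqueness must be shown before it can be
  used.  Existence follows from the real representation theorem; replacing \<open>x\<close> by \<open>- \<i> x\<close> recovers
  the imaginary part of the complex inner product.
\<close>

lemma cadjoint_works:
  assumes f: "bounded_clinear f"
  shows "cinner (f x) y = cinner x (cadjoint f y)"
proof -
  have ex: "\<exists>g. \<forall>x. cinner (f x) y = cinner x g" for y
  proof -
    have "bounded_linear (\<lambda>x. inner (f x) y)"
      using f unfolding bounded_clinear_def by (intro bounded_linear_inner_left_comp) auto
    then obtain g where g: "\<And>x. inner (f x) y = inner x g"
      using Riesz_representation by blast
    have "cinner (f x) y = cinner x g" for x
    proof (rule complex_eqI)
      show "Re (cinner (f x) y) = Re (cinner x g)" by (simp add: Re_cinner g)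
      have "Re (cinner (f ((-\<i>) *\<^sub>C x)) y) = Re (cinner ((-\<i>) *\<^sub>C x) g)"
        by (simp add: Re_cinner g)
      then show "Im (cinner (f x) y) = Im (cinner x g)"
        by (simp add: bounded_clinear_imp[OF f] cinner_scaleC_left)
    qed
    then show ?thesis by blast
  qed
  then obtain g where g: "\<forall>x y. cinner (f x) y = cinner x (g y)" by metis
  moreover have "h = g" if "\<forall>x y. cinner (f x) y = cinner x (h y)" for h
    by (rule ext, rule cinner_left_eqI) (use that g in metis)
  ultimately have "cadjoint f = g"
    unfolding cadjoint_def by (rule the_equality)
  then show ?thesis using g by simp
qed

lemma cadjoint_works':
  assumes "bounded_clinear f"
  shows "cinner y (f x) = cinner (cadjoint f y) x"
  by (subst (1 2) cinner_commute) (simp add: cadjoint_works[OF assms])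

lemma bounded_clinear_cadjoint:
  assumes f: "bounded_clinear f"
  shows "bounded_clinear (cadjoint f)"
proof -
  obtain K where K: "K > 0" "\<And>x. norm (f x) \<le> K * norm x"
    using bounded_clinear_bound[OF f] by blast
  show ?thesis
  proof (rule bounded_clinearI)
    show "cadjoint f (x + y) = cadjoint f x + cadjoint f y" for x y
      by (rule cinner_left_eqI) (simp add: cinner_simps flip: cadjoint_works[OF f])
    show "cadjoint f (c *\<^sub>C x) = c *\<^sub>C cadjoint f x" for c x
      by (rule cinner_left_eqI) (simp add: cinner_simps flip: cadjoint_works[OF f])
    show "norm (cadjoint f y) \<le> K * norm y" for y
    proof -
      have "(norm (cadjoint f y))\<^sup>2 = norm (cinner (cadjoint f y) (cadjoint f y))"
        by (simp add: cinner_self norm_power)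
      also have "\<dots> = norm (cinner (f (cadjoint f y)) y)"
        by (simp add: cadjoint_works[OF f])
      also have "\<dots> \<le> norm (f (cadjoint f y)) * norm y" by (rule norm_cinner_le)
      also have "\<dots> \<le> (K * norm (cadjoint f y)) * norm y"
        by (intro mult_right_mono K) auto
      finally have "norm (cadjoint f y) * norm (cadjoint f y) \<le> norm (cadjoint f y) * (K * norm y)"
        by (simp add: power2_eq_square mult_ac)
      then show ?thesis
        using K(1) by (cases "cadjoint f y = 0") auto
    qed
  qed
qed

lemma has_bounded_inverse_inv:
  assumes "has_bounded_inverse T"
  shows "bounded_clinear (inv T)" "inv T (T x) = x" "T (inv T x) = x"
proof -
  obtain R where R: "bounded_clinear R" "\<And>x. R (T x) = x" "\<And>x. T (R x) = x"
    using assms unfolding has_bounded_inverse_def by blast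
  then have "inv T = R"
    by (intro inv_equality) auto
  with R show "bounded_clinear (inv T)" "inv T (T x) = x" "T (inv T x) = x" by auto
qed

text \<open>
  For \<open>t = \<epsilon> / K\<^sup>2\<close>, with \<open>K\<close> a bound of \<open>S\<close>, the map \<open>x \<mapsto> x - t S x + t y\<close> is a contraction, and its fixed
  point solves \<open>S x = y\<close>.
\<close>

lemma has_bounded_inverse_coercive:
  fixes S :: "'a::chilbert_space \<Rightarrow> 'a"
  assumes S: "bounded_clinear S" and \<epsilon>: "\<epsilon> > 0"
    and coercive: "\<And>x. \<epsilon> * (norm x)\<^sup>2 \<le> Re (cinner (S x) x)"
  shows "has_bounded_inverse S"
proof -
  note lin = bounded_clinear_imp[OF S]
  have below: "\<epsilon> * norm x \<le> norm (S x)" for x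
  proof (cases "x = 0")
    case False
    have "\<epsilon> * (norm x)\<^sup>2 \<le> norm (S x) * norm x"
      using coercive[of x] complex_Re_le_cmod[of "cinner (S x) x"] norm_cinner_le[of "S x" x] by linarith
    then show ?thesis using False by (simp add: power2_eq_square)
  qed (simp add: lin)
  obtain K0 where K0: "K0 > 0" "\<And>x. norm (S x) \<le> K0 * norm x"
    using bounded_clinear_bound[OF S] by blast
  \<comment> \<open>Taking \<open>K \<ge> \<epsilon>\<close> keeps the number under the root below nonnegative.\<close>
  define K where "K = max K0 \<epsilon>"
  have K: "K > 0" "norm (S x) \<le> K * norm x" "\<epsilon> \<le> K" for x
  proof -
    show "K > 0" "\<epsilon> \<le> K" using K0(1) by (auto simp: K_def)
    have "norm (S x) \<le> K0 * norm x" by (rule K0)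
    also have "\<dots> \<le> K * norm x" by (intro mult_right_mono) (auto simp: K_def)
    finally show "norm (S x) \<le> K * norm x" .
  qed
  define t where "t = \<epsilon> / K\<^sup>2"
  define q where "q = sqrt (1 - \<epsilon>\<^sup>2 / K\<^sup>2)"
  have t: "t > 0" using K \<epsilon> by (simp add: t_def)
  have le1: "\<epsilon>\<^sup>2 / K\<^sup>2 \<le> 1"
    using K \<epsilon> by (simp add: power_mono)
  have q: "0 \<le> q" "q < 1"
    unfolding q_def using le1 K \<epsilon> by auto
  have contract: "norm (x - t *\<^sub>R S x) \<le> q * norm x" for x
  proof -
    have "(norm (x - t *\<^sub>R S x))\<^sup>2 = (norm x)\<^sup>2 - 2 * t * Re (cinner (S x) x) + t * t * (norm (S x))\<^sup>2"
      by (simp add: power2_norm_eq_inner inner_simps Re_cinner inner_commute algebra_simps)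
    also have "\<dots> = (norm x)\<^sup>2 - 2 * t * Re (cinner (S x) x) + t\<^sup>2 * (norm (S x))\<^sup>2"
      by (simp add: power2_eq_square)
    also have "\<dots> \<le> (norm x)\<^sup>2 - 2 * t * (\<epsilon> * (norm x)\<^sup>2) + t\<^sup>2 * (K * norm x)\<^sup>2"
      using t by (intro add_mono diff_mono mult_left_mono coercive power_mono K) auto
    also have "\<dots> = (1 - 2 * (t * \<epsilon>) + t\<^sup>2 * K\<^sup>2) * (norm x)\<^sup>2"
      by (simp add: algebra_simps power_mult_distrib)
    also have "1 - 2 * (t * \<epsilon>) + t\<^sup>2 * K\<^sup>2 = 1 - \<epsilon>\<^sup>2 / K\<^sup>2"
      using K(1) by (simp add: t_def power2_eq_square field_simps)
    also have "(1 - \<epsilon>\<^sup>2 / K\<^sup>2) * (norm x)\<^sup>2 = (q * norm x)\<^sup>2"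
      unfolding q_def power_mult_distrib using le1 by simp
    finally show ?thesis
      by (rule power2_le_imp_le) (use q in auto)
  qed
  have surj: "\<exists>x. S x = y" for y
  proof -
    define T where "T x = x - t *\<^sub>R S x + t *\<^sub>R y" for x
    have "dist (T x) (T x') \<le> q * dist x x'" for x x'
    proof -
      have "T x - T x' = (x - x') - t *\<^sub>R S (x - x')"
        by (simp add: T_def lin scaleR_diff_right)
      then show ?thesis using contract[of "x - x'"] by (simp add: dist_norm)
    qed
    then obtain x where "T x = x"
      using banach_fix_type[OF q, of T] by blast
    then have "t *\<^sub>R (y - S x) = 0" by (simp add: T_def scaleR_diff_right)
    then show ?thesis using t by auto
  qed
  have inj: "S x = S x' \<Longrightarrow> x = x'" for x x'
    using below[of "x - x'"] \<epsilon> by (simp add: lin mult_le_0_iff)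
  have "inj S" "surj S"
    using inj surj by (auto intro: injI simp: surj_def) metis
  then have bij: "inv S (S x) = x" "S (inv S y) = y" for x y
    by (simp_all add: surj_f_inv_f)
  have "bounded_clinear (inv S)"
  proof (rule bounded_clinearI)
    show "inv S (x + y) = inv S x + inv S y" for x y
      by (rule inj) (simp add: bij lin)
    show "inv S (c *\<^sub>C x) = c *\<^sub>C inv S x" for c x
      by (rule inj) (simp add: bij lin)
    show "norm (inv S x) \<le> inverse \<epsilon> * norm x" for x
      using below[of "inv S x"] \<epsilon> by (simp add: bij field_simps)
  qed
  then show ?thesis
    unfolding has_bounded_inverse_def using bij by blast
qed

lemma bounded_clinear_comp:
  assumes "bounded_clinear f" "bounded_clinear g"
  shows "bounded_clinear (\<lambda>x. f (g x))"
  using assms bounded_linear_compose[of f g] unfolding bounded_clinear_def by auto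

lemma bounded_clinear_scaleC:
  assumes "bounded_clinear f"
  shows "bounded_clinear (\<lambda>x. c *\<^sub>C f x)"
proof -
  obtain K where K: "\<And>x. norm (f x) \<le> K * norm x"
    using bounded_clinear_bound[OF assms] by blast
  show ?thesis
  proof (rule bounded_clinearI)
    show "norm (c *\<^sub>C f x) \<le> (norm c * K) * norm x" for x
      using mult_left_mono[OF K[of x], of "norm c"] by (simp add: norm_scaleC mult_ac)
  qed (simp_all add: bounded_clinear_imp[OF assms] scaleC_add_right scaleC_scaleC mult.commute)
qed

lemma bounded_clinear_add:
  assumes "bounded_clinear f" "bounded_clinear g"
  shows "bounded_clinear (\<lambda>x. f x + g x)"
  using assms bounded_linear_add[of f g] unfolding bounded_clinear_def
  by (auto simp: scaleC_add_right)

lemma bounded_clinear_ident: "bounded_clinear (\<lambda>x. x)"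
  by (simp add: bounded_clinear_def bounded_linear_ident)

section \<open>Resolvents\<close>

definition resolvent :: "('h::chilbert_space \<Rightarrow> 'h) \<Rightarrow> complex \<Rightarrow> 'h \<Rightarrow> 'h"
  where "resolvent A w = inv (id_minus w A)"

lemma resolvent_works:
  assumes "has_bounded_inverse (id_minus w A)"
  shows "bounded_clinear (resolvent A w)"
    and "resolvent A w x - w *\<^sub>C A (resolvent A w x) = x"
    and "resolvent A w (x - w *\<^sub>C A x) = x"
  using has_bounded_inverse_inv[OF assms] unfolding resolvent_def by (auto simp: id_minus_def)

lemma resolvent_identity:
  assumes A: "bounded_clinear A"
    and z: "has_bounded_inverse (id_minus z A)" and w: "has_bounded_inverse (id_minus w A)"
  shows "resolvent A z x - resolvent A w x = (z - w) *\<^sub>C resolvent A z (A (resolvent A w x))"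
proof -
  let ?y = "resolvent A w x"
  have "resolvent A z (?y - w *\<^sub>C A ?y - (?y - z *\<^sub>C A ?y))
      = resolvent A z (?y - w *\<^sub>C A ?y) - resolvent A z (?y - z *\<^sub>C A ?y)"
    by (rule bounded_clinear_imp[OF resolvent_works(1)[OF z]])
  also have "\<dots> = resolvent A z x - ?y"
    unfolding resolvent_works(2)[OF w] resolvent_works(3)[OF z] ..
  finally have "resolvent A z (?y - w *\<^sub>C A ?y - (?y - z *\<^sub>C A ?y)) = resolvent A z x - ?y" .
  moreover have "?y - w *\<^sub>C A ?y - (?y - z *\<^sub>C A ?y) = (z - w) *\<^sub>C A ?y"
    by (simp add: scaleC_diff_left)
  ultimately show ?thesis
    by (simp add: bounded_clinear_imp[OF resolvent_works(1)[OF z]])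
qed

lemma bounded_clinear_onorm:
  assumes "bounded_clinear f"
  shows "norm (f x) \<le> onorm f * norm x" "0 \<le> onorm f"
  using assms unfolding bounded_clinear_def by (auto intro: onorm onorm_pos_le)

lemma norm_resolvent_diff_le:
  assumes A: "bounded_clinear A"
    and z: "has_bounded_inverse (id_minus z A)" and w: "has_bounded_inverse (id_minus w A)"
  shows "norm (resolvent A z x - resolvent A w x)
    \<le> norm (z - w) * onorm (resolvent A z) * onorm A * onorm (resolvent A w) * norm x"
proof -
  note bz = bounded_clinear_onorm[OF resolvent_works(1)[OF z]]
  note bw = bounded_clinear_onorm[OF resolvent_works(1)[OF w]]
  note bA = bounded_clinear_onorm[OF A]
  have "norm (resolvent A z x - resolvent A w x) = norm (z - w) * norm (resolvent A z (A (resolvent A w x)))"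
    unfolding resolvent_identity[OF assms] norm_scaleC ..
  also have "norm (resolvent A z (A (resolvent A w x))) \<le> onorm (resolvent A z) * (onorm A * (onorm (resolvent A w) * norm x))"
    by (meson bz bw bA order_trans mult_left_mono)
  then have "norm (z - w) * norm (resolvent A z (A (resolvent A w x)))
      \<le> norm (z - w) * (onorm (resolvent A z) * (onorm A * (onorm (resolvent A w) * norm x)))"
    by (rule mult_left_mono) simp
  finally show ?thesis by (simp add: mult_ac)
qed

text \<open>
  By the resolvent identity the norm at most doubles near \<open>w\<close>, as long as the inverses exist.  So the
  norm is continuous on every set of such points, in particular up to the boundary of a half-plane.
\<close>

lemma continuous_on_onorm_resolvent:
  assumes A: "bounded_clinear A" and U: "\<And>z. z \<in> U \<Longrightarrow> has_bounded_inverse (id_minus z A)"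
  shows "continuous_on U (\<lambda>z. onorm (resolvent A z))"
  unfolding continuous_on_def
proof
  fix w assume w: "w \<in> U"
  define N where "N z = onorm (resolvent A z)" for z
  have Npos: "0 \<le> N z" if "z \<in> U" for z
    unfolding N_def using bounded_clinear_onorm(2)[OF resolvent_works(1)[OF U[OF that]]] .
  have diff: "norm (resolvent A z x - resolvent A z' x) \<le> norm (z - z') * N z * onorm A * N z' * norm x"
    if "z \<in> U" "z' \<in> U" for z z' x
    unfolding N_def using norm_resolvent_diff_le[OF A U[OF that(1)] U[OF that(2)]] .
  have A0: "0 \<le> onorm A" by (rule bounded_clinear_onorm[OF A])
  have step: "N z \<le> N z' + norm (z - z') * N z * onorm A * N z'" if "z \<in> U" "z' \<in> U" for z z'
    unfolding N_def
  proof (rule onorm_bound)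
    show "0 \<le> onorm (resolvent A z') + norm (z - z') * onorm (resolvent A z) * onorm A * onorm (resolvent A z')"
      using Npos that A0 by (auto simp: N_def intro!: add_nonneg_nonneg mult_nonneg_nonneg)
    fix x
    have "norm (resolvent A z x) \<le> norm (resolvent A z' x) + norm (resolvent A z x - resolvent A z' x)"
      by (rule norm_triangle_sub)
    also have "\<dots> \<le> N z' * norm x + norm (z - z') * N z * onorm A * N z' * norm x"
      unfolding N_def using that
      by (intro add_mono bounded_clinear_onorm resolvent_works U diff[unfolded N_def])
    finally show "norm (resolvent A z x) \<le> (onorm (resolvent A z') + norm (z - z') * onorm (resolvent A z) * onorm A
        * onorm (resolvent A z')) * norm x"
      by (simp add: N_def algebra_simps)
  qed
  have small: "\<bar>N z - N w\<bar> \<le> norm (z - w) * (2 * N w * onorm A * N w)"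
    if "z \<in> U" and close: "norm (z - w) * (onorm A * N w) \<le> 1 / 2" for z
  proof -
    have "norm (z - w) * N z * onorm A * N w = N z * (norm (z - w) * (onorm A * N w))"
      by simp
    also have "\<dots> \<le> N z * (1 / 2)"
      using close Npos[OF that(1)] by (intro mult_left_mono)
    finally have "N z \<le> N w + N z / 2"
      using step[OF that(1) w] by simp
    then have le: "N z \<le> 2 * N w" by simp
    have "norm (z - w) * onorm A * N w * N z \<le> norm (z - w) * onorm A * N w * (2 * N w)"
      using le A0 Npos[OF w] by (intro mult_left_mono) auto
    then show ?thesis
      using step[OF that(1) w] step[OF w that(1)] by (simp add: norm_minus_commute mult_ac abs_le_iff)
  qed
  have lim: "((\<lambda>z. norm (z - w) * c) \<longlongrightarrow> 0) (at w within U)" for c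
    by (rule tendsto_eq_intros refl | simp)+
  then have "\<forall>\<^sub>F z in at w within U. norm (z - w) * (onorm A * N w) < 1 / 2"
    by (intro order_tendstoD) auto
  then have "\<forall>\<^sub>F z in at w within U. norm (N z - N w) \<le> norm (z - w) * (2 * N w * onorm A * N w)"
    using eventually_at_topological small
    by (auto simp: eventually_at_filter elim!: eventually_mono)
  then have "((\<lambda>z. N z - N w) \<longlongrightarrow> 0) (at w within U)"
    by (rule Lim_null_comparison) (rule lim)
  then show "((\<lambda>z. onorm (resolvent A z)) \<longlongrightarrow> onorm (resolvent A w)) (at w within U)"
    unfolding N_def by (simp add: LIM_zero_iff)
qed

lemma continuous_on_resolvent:
  assumes A: "bounded_clinear A" and U: "\<And>z. z \<in> U \<Longrightarrow> has_bounded_inverse (id_minus z A)"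
  shows "continuous_on U (\<lambda>z. resolvent A z x)"
  unfolding continuous_on_def
proof
  fix w assume w: "w \<in> U"
  have N: "((\<lambda>z. onorm (resolvent A z)) \<longlongrightarrow> onorm (resolvent A w)) (at w within U)"
    using continuous_on_onorm_resolvent[OF A U] w unfolding continuous_on_def by blast
  have "((\<lambda>z. resolvent A z x - resolvent A w x) \<longlongrightarrow> 0) (at w within U)"
  proof (rule Lim_null_comparison)
    show "\<forall>\<^sub>F z in at w within U. norm (resolvent A z x - resolvent A w x)
        \<le> norm (z - w) * onorm (resolvent A z) * onorm A * onorm (resolvent A w) * norm x"
      using norm_resolvent_diff_le[OF A U U[OF w]] by (auto simp: eventually_at_filter)
    show "((\<lambda>z. norm (z - w) * onorm (resolvent A z) * onorm A * onorm (resolvent A w) * norm x) \<longlongrightarrow> 0)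
        (at w within U)"
      by (rule tendsto_eq_intros N refl | simp)+
  qed
  then show "((\<lambda>z. resolvent A z x) \<longlongrightarrow> resolvent A w x) (at w within U)"
    by (simp add: LIM_zero_iff)
qed

lemma continuous_on_cinner_resolvent:
  assumes A: "bounded_clinear A" and U: "\<And>z. z \<in> U \<Longrightarrow> has_bounded_inverse (id_minus z A)"
  shows "continuous_on U (\<lambda>z. cinner (resolvent A z x) y)"
  unfolding continuous_on_def
proof
  fix w assume w: "w \<in> U"
  have R: "((\<lambda>z. resolvent A z x) \<longlongrightarrow> resolvent A w x) (at w within U)"
    using continuous_on_resolvent[OF A U] w unfolding continuous_on_def by blast
  have "((\<lambda>z. cinner (resolvent A z x) y - cinner (resolvent A w x) y) \<longlongrightarrow> 0) (at w within U)"
  proof (rule Lim_null_comparison)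
    show "\<forall>\<^sub>F z in at w within U. norm (cinner (resolvent A z x) y - cinner (resolvent A w x) y)
        \<le> norm (resolvent A z x - resolvent A w x) * norm y"
      using norm_cinner_le[of _ y] by (simp flip: cinner_diff_left)
    show "((\<lambda>z. norm (resolvent A z x - resolvent A w x) * norm y) \<longlongrightarrow> 0) (at w within U)"
      by (rule tendsto_eq_intros R refl | simp)+
  qed
  then show "((\<lambda>z. cinner (resolvent A z x) y) \<longlongrightarrow> cinner (resolvent A w x) y) (at w within U)"
    by (simp add: LIM_zero_iff)
qed

lemma holomorphic_on_cinner_resolvent:
  assumes A: "bounded_clinear A" and "open V"
    and V: "\<And>z. z \<in> V \<Longrightarrow> has_bounded_inverse (id_minus z A)"
  shows "(\<lambda>z. cinner (resolvent A z x) y) holomorphic_on V"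
  unfolding holomorphic_on_open[OF \<open>open V\<close>]
proof
  fix w assume w: "w \<in> V"
  have "((\<lambda>z. cinner (resolvent A z (A (resolvent A w x))) y) \<longlongrightarrow>
      cinner (resolvent A w (A (resolvent A w x))) y) (at w)"
    using continuous_on_cinner_resolvent[OF A V, of V "A (resolvent A w x)" y] w
    unfolding continuous_on_def using at_within_open[OF w \<open>open V\<close>] by metis
  moreover have "\<forall>\<^sub>F z in at w. cinner (resolvent A z (A (resolvent A w x))) y =
      (cinner (resolvent A z x) y - cinner (resolvent A w x) y) / (z - w)"
  proof -
    have "\<forall>\<^sub>F z in at w. z \<in> V - {w}"
      using w \<open>open V\<close> by (simp add: eventually_at_topological) blast
    then show ?thesis
    proof eventually_elim
      case (elim z)
      then show ?case
        unfolding cinner_diff_left[symmetric] using resolvent_identity[OF A V V[OF w]]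
        by (simp add: cinner_scaleC_left)
    qed
  qed
  ultimately have "((\<lambda>z. (cinner (resolvent A z x) y - cinner (resolvent A w x) y) / (z - w)) \<longlongrightarrow>
      cinner (resolvent A w (A (resolvent A w x))) y) (at w)"
    by (rule Lim_transform_eventually)
  then show "\<exists>f'. ((\<lambda>z. cinner (resolvent A z x) y) has_field_derivative f') (at w)"
    unfolding has_field_derivative_iff by blast
qed

text \<open>
  The inverse is the adjoint of the resolvent of \<open>A\<close> at the conjugate point.
\<close>

lemma has_bounded_inverse_id_minus_cadjoint:
  assumes A: "bounded_clinear A" and inv: "has_bounded_inverse (id_minus (cnj z) A)"
  shows "has_bounded_inverse (id_minus z (cadjoint A))"
proof -
  let ?R = "resolvent A (cnj z)"
  note R = resolvent_works[OF inv]
  have 1: "cadjoint ?R (id_minus z (cadjoint A) y) = y" for y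
  proof (rule cinner_left_eqI)
    fix x
    have "cinner x (cadjoint ?R (id_minus z (cadjoint A) y)) = cinner (?R x) y - cnj z * cinner (A (?R x)) y"
      by (simp add: id_minus_def cinner_simps flip: cadjoint_works[OF R(1)] cadjoint_works[OF A])
    also have "\<dots> = cinner (?R x - cnj z *\<^sub>C A (?R x)) y"
      by (simp add: cinner_simps)
    finally show "cinner x (cadjoint ?R (id_minus z (cadjoint A) y)) = cinner x y"
      by (simp add: R)
  qed
  have 2: "id_minus z (cadjoint A) (cadjoint ?R y) = y" for y
  proof (rule cinner_left_eqI)
    fix x
    have "cinner x (id_minus z (cadjoint A) (cadjoint ?R y)) = cinner (x - cnj z *\<^sub>C A x) (cadjoint ?R y)"
      by (simp add: id_minus_def cinner_simps flip: cadjoint_works[OF A])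
    also have "\<dots> = cinner (?R (x - cnj z *\<^sub>C A x)) y"
      by (rule cadjoint_works[OF R(1), symmetric])
    finally show "cinner x (id_minus z (cadjoint A) (cadjoint ?R y)) = cinner x y"
      by (simp add: R)
  qed
  show ?thesis
    unfolding has_bounded_inverse_def
    using bounded_clinear_cadjoint[OF R(1)] 1 2 by blast
qed

text \<open>
  The limit superior controls the resolvent for large \<open>|w|\<close> only; on the remaining compact part of the
  region, continuity gives a bound, which is absorbed into the constant.  Compactness is also what
  makes the supremum over an annulus finite, so that it bounds its members.
\<close>

lemma resolvent_exponential_growth:
  fixes A :: "'h::chilbert_space \<Rightarrow> 'h"
  assumes A: "bounded_clinear A" and r0: "r0 > 0" and \<kappa>: "0 < \<kappa>"
    and U: "\<And>w. Im w \<le> 0 \<or> r0 \<le> norm w \<Longrightarrow> has_bounded_inverse (id_minus w A)"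
    and growth: "Limsup at_top (\<lambda>r. ereal (ln (resolvent_sup A r0 r) / r powr \<kappa>)) < \<infinity>"
  obtains C where "C \<ge> 0"
    "\<And>w. Im w \<le> 0 \<or> r0 \<le> norm w \<Longrightarrow> onorm (resolvent A w) \<le> exp (C * (1 + norm w powr \<kappa>))"
proof -
  define U where "U = {w. Im w \<le> 0} \<union> {w. r0 \<le> norm w}"
  have inv: "has_bounded_inverse (id_minus w A)" if "w \<in> U" for w
    using that assms(4) by (auto simp: U_def)
  have "closed U"
    unfolding U_def by (intro closed_Un closed_halfspace_Im_le closed_Collect_le continuous_intros)
  have bdd: "\<exists>B. \<forall>w\<in>U \<inter> cball 0 R. onorm (resolvent A w) \<le> B" for R
  proof -
    have "compact (U \<inter> cball 0 R)"
      using \<open>closed U\<close> by (intro closed_Int_compact) auto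
    then have "compact ((\<lambda>w. onorm (resolvent A w)) ` (U \<inter> cball 0 R))"
      by (intro compact_continuous_image continuous_on_onorm_resolvent A inv) auto
    then have "bdd_above ((\<lambda>w. onorm (resolvent A w)) ` (U \<inter> cball 0 R))"
      by (intro bounded_imp_bdd_above compact_imp_bounded)
    then show ?thesis by (auto simp: bdd_above_def)
  qed
  obtain c :: real where "Limsup at_top (\<lambda>r. ereal (ln (resolvent_sup A r0 r) / r powr \<kappa>)) < ereal c"
    using growth by (metis ereal_dense2 less_ereal.simps(4) linorder_not_less)
  then have "\<forall>\<^sub>F r in at_top. ereal (ln (resolvent_sup A r0 r) / r powr \<kappa>) < ereal c"
    by (rule Limsup_lessD)
  then obtain r1 where r1: "\<And>r. r \<ge> r1 \<Longrightarrow> ln (resolvent_sup A r0 r) / r powr \<kappa> < c"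
    by (auto simp: eventually_at_top_linorder)
  define \<rho> where "\<rho> = max r1 r0"
  obtain B where B: "\<And>w. w \<in> U \<Longrightarrow> norm w \<le> \<rho> \<Longrightarrow> onorm (resolvent A w) \<le> B"
    using bdd[of \<rho>] by fastforce
  define C where "C = \<bar>c\<bar> * 2 powr \<kappa> + \<bar>B\<bar>"
  have "onorm (resolvent A w) \<le> exp (C * (1 + norm w powr \<kappa>))" if w: "w \<in> U" for w
  proof (cases "norm w \<le> \<rho>")
    case True
    have "onorm (resolvent A w) \<le> \<bar>B\<bar>"
      using B[OF w True] by linarith
    also have "\<dots> \<le> exp \<bar>B\<bar>"
      using exp_ge_add_one_self[of "\<bar>B\<bar>"] by linarith
    also have "\<bar>B\<bar> \<le> C * (1 + norm w powr \<kappa>)"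
    proof -
      have "\<bar>B\<bar> * 1 \<le> C * (1 + norm w powr \<kappa>)"
        unfolding C_def by (intro mult_mono) auto
      then show ?thesis by simp
    qed
    finally show ?thesis by simp
  next
    case False
    define r where "r = 2 * norm w"
    have w': "r0 < norm w" "norm w < r" "r1 \<le> r"
      using False r0 by (auto simp: r_def \<rho>_def)
    obtain B' where B': "\<And>w. w \<in> U \<Longrightarrow> norm w \<le> r \<Longrightarrow> onorm (resolvent A w) \<le> B'"
      using bdd[of r] by fastforce
    have le: "onorm (resolvent A w) \<le> resolvent_sup A r0 r"
      unfolding resolvent_sup_def resolvent_def[symmetric]
    proof (rule cSUP_upper)
      show "bdd_above ((\<lambda>w. onorm (resolvent A w)) ` {z. r0 < norm z \<and> norm z < r})"
      proof (rule bdd_aboveI2)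
        fix z :: complex assume "z \<in> {z. r0 < norm z \<and> norm z < r}"
        then show "onorm (resolvent A z) \<le> B'"
          by (intro B') (auto simp: U_def)
      qed
    qed (use w' in auto)
    show ?thesis
    proof (cases "onorm (resolvent A w) \<le> 0")
      case True
      then show ?thesis by (meson exp_ge_zero order_trans)
    next
      case False
      have "ln (onorm (resolvent A w)) \<le> ln (resolvent_sup A r0 r)"
        using False le by simp
      also have "\<dots> \<le> c * r powr \<kappa>"
        using r1[OF w'(3)] w' r0 by (simp add: field_simps)
      also have "\<dots> \<le> \<bar>c\<bar> * (2 powr \<kappa> * norm w powr \<kappa>)"
        unfolding r_def by (subst powr_mult) (auto intro!: mult_right_mono)
      also have "\<dots> \<le> C * (1 + norm w powr \<kappa>)"
        unfolding mult.assoc[symmetric] C_def by (intro mult_mono) auto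
      finally show ?thesis
        using False by (subst ln_le_cancel_iff[symmetric]) auto
    qed
  qed
  then show ?thesis
    by (intro that[of C]) (auto simp: C_def U_def)
qed
section \<open>Determinants and matrix pencils\<close>

lemma scaleC_vec_eq: "c *\<^sub>C v = c *s (v :: complex ^ 'n)"
  by (simp add: vec_eq_iff scaleC_vec_def scaleC_complex_def)

lemma cinner_axis: "cinner v (axis i 1) = v $ i" for v :: "complex ^ 'n"
proof -
  have "cinner v (axis i 1) = (\<Sum>j\<in>UNIV. if j = i then v $ j else 0)"
    unfolding cinner_vec_def by (intro sum.cong) (auto simp: axis_def cinner_complex_def)
  then show ?thesis by simp
qed

lemma vec_expand: "v = (\<Sum>j\<in>UNIV. (v $ j) *\<^sub>C axis j 1)" for v :: "complex ^ 'n"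
  by (simp add: vec_eq_iff scaleC_vec_def scaleC_complex_def axis_def if_distrib[of "\<lambda>x. _ * x"] cong: if_cong)

lemma clinear_matrix_vec:
  fixes f :: "complex ^ 'n \<Rightarrow> complex ^ 'n"
  assumes "bounded_clinear f"
  shows "(\<chi> i j. f (axis j 1) $ i) *v v = f v"
proof -
  have sum: "f (\<Sum>j\<in>X. g j) = (\<Sum>j\<in>X. f (g j))" for g and X :: "'n set"
    using assms unfolding bounded_clinear_def by (auto dest: bounded_linear.linear intro: linear_sum)
  have "f v = (\<Sum>j\<in>UNIV. (v $ j) *\<^sub>C f (axis j 1))"
    by (subst vec_expand) (simp add: sum bounded_clinear_imp[OF assms])
  then show ?thesis
    by (simp add: vec_eq_iff matrix_vector_mult_def scaleC_vec_def scaleC_complex_def mult.commute)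
qed

lemma poly_det:
  "poly (det M) x = det (\<chi> i j. poly (M $ i $ j) x)" for M :: "'a::comm_ring_1 poly ^ 'n ^ 'n"
  by (simp add: det_def poly_sum poly_prod)

text \<open>
  Each linear factor \<open>t - x\<close> with \<open>Re x \<le> 0\<close> has nondecreasing modulus in \<open>t \<ge> 0\<close>.
\<close>

lemma norm_poly_mono:
  fixes p :: "complex poly"
  assumes roots: "\<And>x. poly p x = 0 \<Longrightarrow> Re x \<le> 0" and st: "0 \<le> s" "s \<le> t"
  shows "norm (poly p (of_real s)) \<le> norm (poly p (of_real t))"
proof (cases "p = 0")
  case False
  obtain X where X: "p = smult (lead_coeff p) (\<Prod>x\<in>#X. [:-x, 1:])"
    using alg_closed_imp_factorization[OF False] by blast
  have "Re x \<le> 0" if "x \<in># X" for x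
  proof (rule roots)
    show "poly p x = 0"
      by (subst X) (use that in \<open>auto simp: poly_prod_mset prod_mset_zero_iff image_iff\<close>)
  qed
  then have "norm (poly (\<Prod>x\<in>#X. [:-x, 1:]) (of_real s)) \<le> norm (poly (\<Prod>x\<in>#X. [:-x, 1:]) (of_real t))"
  proof (induction X)
    case (add x X)
    have "norm (of_real s - x) \<le> norm (of_real t - x)"
      unfolding cmod_def using add.prems[of x] st
      by (simp add: power_mono)
    moreover have "norm (poly (\<Prod>x\<in>#X. [:-x, 1:]) (of_real s)) \<le> norm (poly (\<Prod>x\<in>#X. [:-x, 1:]) (of_real t))"
      using add.prems by (intro add.IH) auto
    moreover have "poly (\<Prod>x\<in>#add_mset x X. [:-x, 1:]) a = (a - x) * poly (\<Prod>x\<in>#X. [:-x, 1:]) a" for a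
      by (simp add: algebra_simps)
    ultimately show ?case
      by (simp only: norm_mult mult_mono norm_ge_zero)
  qed simp
  then show ?thesis
    by (subst (1 2) X) (simp add: norm_mult mult_left_mono)
qed simp

lemma det_zero_imp_kernel:
  fixes M :: "'a::field ^ 'n ^ 'n"
  assumes "det M = 0"
  obtains v where "v \<noteq> 0" "M *v v = 0"
  using assms invertible_det_nz[of M] invertible_left_inverse[of M] matrix_left_invertible_ker[of M]
  by blast

lemma matrix_mult_axis: "(M *v axis j 1) $ i = M $ i $ j" for M :: "'a::comm_ring_1 ^ 'n ^ 'm"
  by (simp add: matrix_vector_mult_def axis_def if_distrib[of "\<lambda>x. _ * x"] cong: if_cong)

definition pencil :: "'a::comm_ring_1 ^ 'n ^ 'm \<Rightarrow> 'a ^ 'n ^ 'm \<Rightarrow> 'a \<Rightarrow> 'a ^ 'n ^ 'm"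
  where "pencil C D t = (\<chi> i j. C $ i $ j + t * D $ i $ j)"

lemma pencil_0: "pencil C D 0 = C"
  by (simp add: pencil_def vec_eq_iff)

lemma pencil_mult_vec: "pencil C D t *v v = C *v v + t *s (D *v v)"
  by (simp add: pencil_def matrix_vector_mult_def vec_eq_iff sum.distrib sum_distrib_left algebra_simps)

lemma det_pencil_poly: "det (pencil C D t) = poly (det (\<chi> i j. [:C $ i $ j, D $ i $ j:])) t"
  by (simp add: poly_det pencil_def)

text \<open>
  If \<open>C v = - t D v\<close>, then \<open>Re (C v, D v) = - Re t |D v|\<^sup>2\<close>.  The left-hand side is nonnegative, and
  \<open>D v\<close> cannot vanish, since \<open>C v\<close> would vanish with it.
\<close>

lemma det_pencil_root:
  fixes C D :: "complex ^ 'n ^ 'n"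
  assumes pos: "\<And>v. 0 \<le> Re (cinner (C *v v) (D *v v))"
    and ker: "\<And>v. C *v v = 0 \<Longrightarrow> D *v v = 0 \<Longrightarrow> v = 0"
    and root: "det (pencil C D t) = 0"
  shows "Re t \<le> 0"
proof -
  obtain v where v: "v \<noteq> 0" "pencil C D t *v v = 0"
    using det_zero_imp_kernel[OF root] by blast
  then have "C *v v + t *s (D *v v) = 0"
    by (simp add: pencil_mult_vec)
  then have Cv: "C *v v = (- t) *\<^sub>C (D *v v)"
    by (simp add: scaleC_vec_eq eq_neg_iff_add_eq_0)
  have "D *v v \<noteq> 0"
    using ker[of v] v(1) Cv by auto
  moreover have "0 \<le> - (Re t * (norm (D *v v))\<^sup>2)"
    using pos[of v] by (simp add: Cv cinner_scaleC_left cinner_self)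
  ultimately show ?thesis
    by (simp add: mult_le_0_iff)
qed

lemma norm_det_pencil_mono:
  fixes C D :: "complex ^ 'n ^ 'n"
  assumes "\<And>v. 0 \<le> Re (cinner (C *v v) (D *v v))"
    and "\<And>v. C *v v = 0 \<Longrightarrow> D *v v = 0 \<Longrightarrow> v = 0"
    and "0 \<le> s" "s \<le> t"
  shows "norm (det (pencil C D (of_real s))) \<le> norm (det (pencil C D (of_real t)))"
  unfolding det_pencil_poly
  by (rule norm_poly_mono) (use assms det_pencil_root[of C D] in \<open>auto simp: det_pencil_poly\<close>)

lemma norm_det_le:
  fixes M :: "complex ^ 'n ^ 'n"
  assumes "\<And>i j. norm (M $ i $ j) \<le> b"
  shows "norm (det M) \<le> fact CARD('n) * b ^ CARD('n)"
proof -
  have "norm (det M) \<le> (\<Sum>p\<in>{p. p permutes (UNIV :: 'n set)}. b ^ CARD('n))"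
    unfolding det_def
  proof (rule sum_norm_le)
    fix p assume "p \<in> {p. p permutes (UNIV :: 'n set)}"
    have "norm (of_int (sign p) * (\<Prod>i\<in>UNIV. M $ i $ p i)) = (\<Prod>i\<in>UNIV. norm (M $ i $ p i))"
      by (simp add: norm_mult prod_norm sign_def)
    also have "\<dots> \<le> (\<Prod>i\<in>(UNIV :: 'n set). b)"
      by (intro prod_mono) (use assms in auto)
    finally show "norm (of_int (sign p) * (\<Prod>i\<in>UNIV. M $ i $ p i)) \<le> b ^ CARD('n)" by simp
  qed
  also have "\<dots> = fact CARD('n) * b ^ CARD('n)"
    using card_permutations[of "UNIV :: 'n set" "CARD('n)"] by simp
  finally show ?thesis .
qed

lemma le_exp_mult:
  fixes c e :: real
  assumes "1 / 2 \<le> e"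
  shows "\<bar>c\<bar> \<le> exp (2 * \<bar>c\<bar> * e)"
proof -
  have "\<bar>c\<bar> \<le> exp \<bar>c\<bar>"
    using exp_ge_add_one_self[of "\<bar>c\<bar>"] by linarith
  also have "\<dots> \<le> exp (2 * \<bar>c\<bar> * e)"
    using mult_left_mono[of "1/2" e "2 * \<bar>c\<bar>"] assms by simp
  finally show ?thesis .
qed

text \<open>
  The lower bound \<open>1 / 2\<close> for the weight \<open>e\<close> lets the constant \<open>n!\<close> be absorbed into the exponential.
\<close>

lemma norm_det_le_exp:
  fixes M :: "complex ^ 'n ^ 'n"
  assumes "1 / 2 \<le> e" and "\<And>i j. norm (M $ i $ j) \<le> exp (b * e)"
  shows "norm (det M) \<le> exp ((2 * fact CARD('n) + real CARD('n) * b) * e)"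
proof -
  have "norm (det M) \<le> fact CARD('n) * exp (b * e) ^ CARD('n)"
    by (rule norm_det_le) (rule assms)
  also have "fact CARD('n) \<le> exp (2 * fact CARD('n) * e)"
    using le_exp_mult[OF assms(1), of "fact CARD('n)"] by simp
  then have "fact CARD('n) * exp (b * e) ^ CARD('n) \<le> exp (2 * fact CARD('n) * e) * exp (b * e) ^ CARD('n)"
    by (intro mult_right_mono) auto
  also have "\<dots> = exp ((2 * fact CARD('n) + real CARD('n) * b) * e)"
    by (simp add: algebra_simps exp_add flip: exp_of_nat_mult)
  finally show ?thesis .
qed

text \<open>
  The lower bound for \<open>M\<close> is an upper bound for the entries of its inverse, whose determinant is then
  bounded by the expansion into permutations.
\<close>

lemma inverse_norm_det_le:
  fixes M :: "complex ^ 'n ^ 'n"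
  assumes m: "0 < m" and below: "\<And>v. m * norm v \<le> norm (M *v v)"
  shows "det M \<noteq> 0" and "inverse (norm (det M)) \<le> fact CARD('n) * inverse m ^ CARD('n)"
proof -
  show nz: "det M \<noteq> 0"
  proof
    assume "det M = 0"
    then obtain v where "v \<noteq> 0" "M *v v = 0" by (rule det_zero_imp_kernel)
    then show False using below[of v] m by (simp add: mult_le_0_iff)
  qed
  then obtain B where B: "M ** B = mat 1"
    using invertible_det_nz[of M] unfolding invertible_def by blast
  have "norm (B $ i $ j) \<le> inverse m" for i j
  proof -
    have "norm (B $ i $ j) = norm ((B *v axis j 1) $ i)"
      by (simp add: matrix_mult_axis)
    also have "\<dots> \<le> norm (B *v axis j 1)" by (rule Finite_Cartesian_Product.norm_nth_le)
    also have "m * norm (B *v axis j 1) \<le> norm (M *v (B *v axis j 1))" by (rule below)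
    then have "norm (B *v axis j 1) \<le> inverse m"
      using m by (simp add: matrix_vector_mul_assoc B field_simps)
    finally show ?thesis .
  qed
  then have "norm (det B) \<le> fact CARD('n) * inverse m ^ CARD('n)"
    by (rule norm_det_le)
  moreover have "det M * det B = 1"
    unfolding det_mul[symmetric] B by simp
  then have "det B = inverse (det M)"
    using nz by (simp add: field_simps)
  ultimately show "inverse (norm (det M)) \<le> fact CARD('n) * inverse m ^ CARD('n)"
    by (simp add: norm_inverse)
qed

lemma det_cnj_transpose: "det (\<chi> i j. cnj (M $ j $ i)) = cnj (det M)" for M :: "complex ^ 'n ^ 'n"
proof -
  have "det (\<chi> i j. cnj (M $ j $ i)) = det (transpose (\<chi> i j. cnj (M $ i $ j)))"
    by (simp add: transpose_def)
  also have "\<dots> = cnj (det M)"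
    unfolding det_transpose by (simp add: det_def)
  finally show ?thesis .
qed

text \<open>
  Cramer's rule, in the form that shows the entries of the inverse as quotients of determinants.
\<close>

lemma matrix_inv_entry:
  fixes M :: "'a::field ^ 'n ^ 'n"
  assumes "det M \<noteq> 0"
  shows "matrix_inv M $ i $ j = det (\<chi> k l. if l = i then axis j 1 $ k else M $ k $ l) / det M"
proof -
  have inv: "M ** matrix_inv M = mat 1"
    using assms unfolding invertible_det_nz[symmetric] invertible_def matrix_inv_def
    by (rule someI_ex[THEN conjunct1])
  have "M *v (matrix_inv M *v axis j 1) = axis j 1"
    by (simp add: matrix_vector_mul_assoc inv)
  then have "matrix_inv M *v axis j 1 = (\<chi> k. det (\<chi> i l. if l = k then axis j 1 $ i else M $ i $ l) / det M)"
    using cramer[OF assms] by blast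
  then have "(matrix_inv M *v axis j 1) $ i = det (\<chi> k l. if l = i then axis j 1 $ k else M $ k $ l) / det M"
    by simp
  then show ?thesis
    by (simp add: matrix_mult_axis)
qed

lemma holomorphic_on_det:
  assumes "\<And>i j. (\<lambda>z. M z $ i $ j) holomorphic_on X"
  shows "(\<lambda>z. det (M z :: complex ^ 'n ^ 'n)) holomorphic_on X"
  unfolding det_def by (intro holomorphic_intros assms)

lemma continuous_on_det:
  assumes "\<And>i j. continuous_on X (\<lambda>z. M z $ i $ j)"
  shows "continuous_on X (\<lambda>z. det (M z :: complex ^ 'n ^ 'n))"
  unfolding det_def by (intro continuous_intros assms)

section \<open>The blocks of an S-node\<close>

lemma J_mat_mult:
  "(J_mat *v v) $ Inl i = v $ Inr i" "(J_mat *v v) $ Inr i = v $ Inl (i :: 'p::finite)"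
proof -
  have "J_mat $ Inl i $ j * v $ j = (if j = Inr i then v $ j else 0)"
    "J_mat $ Inr i $ j * v $ j = (if j = Inl i then v $ j else 0)" for j
    by (cases j; auto simp: J_mat_def block_mat_def mat_def)+
  then show "(J_mat *v v) $ Inl i = v $ Inr i" "(J_mat *v v) $ Inr i = v $ Inl i"
    by (simp_all add: matrix_vector_mult_def)
qed

lemma cinner_axis_left: "cinner (axis i 1) v = cnj (v $ i)" for v :: "complex ^ 'n"
  by (subst cinner_commute) (simp add: cinner_axis)

lemma row_op_axis:
  fixes \<Phi>1 \<Phi>2 :: "complex ^ 'p::finite \<Rightarrow> 'h::chilbert_space"
  assumes "bounded_clinear \<Phi>1" "bounded_clinear \<Phi>2"
  shows "row_op \<Phi>1 \<Phi>2 (axis (Inl i) 1) = \<Phi>1 (axis i 1)"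
    and "row_op \<Phi>1 \<Phi>2 (axis (Inr i) 1) = \<Phi>2 (axis i 1)"
proof -
  have "(\<chi> k. (axis (Inl i) 1 :: complex ^ ('p + 'p)) $ Inl k) = (axis i 1 :: complex ^ 'p)" "(\<chi> k. (axis (Inl i) 1 :: complex ^ ('p + 'p)) $ Inr k) = (0 :: complex ^ 'p)"
    "(\<chi> k. (axis (Inr i) 1 :: complex ^ ('p + 'p)) $ Inr k) = (axis i 1 :: complex ^ 'p)" "(\<chi> k. (axis (Inr i) 1 :: complex ^ ('p + 'p)) $ Inl k) = (0 :: complex ^ 'p)"
    by (auto simp: vec_eq_iff axis_def)
  then show "row_op \<Phi>1 \<Phi>2 (axis (Inl i) 1) = \<Phi>1 (axis i 1)" "row_op \<Phi>1 \<Phi>2 (axis (Inr i) 1) = \<Phi>2 (axis i 1)"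
    by (simp_all add: row_op_def bounded_clinear_imp[OF assms(1)] bounded_clinear_imp[OF assms(2)])
qed

lemma cadjoint_row_op:
  fixes \<Phi>1 \<Phi>2 :: "complex ^ 'p::finite \<Rightarrow> 'h::chilbert_space"
  assumes \<Phi>1: "bounded_clinear \<Phi>1" and \<Phi>2: "bounded_clinear \<Phi>2"
    and P: "bounded_clinear (row_op \<Phi>1 \<Phi>2)"
  shows "cadjoint (row_op \<Phi>1 \<Phi>2) y $ Inl i = cadjoint \<Phi>1 y $ i"
    and "cadjoint (row_op \<Phi>1 \<Phi>2) y $ Inr i = cadjoint \<Phi>2 y $ i"
proof -
  have "cnj (cadjoint (row_op \<Phi>1 \<Phi>2) y $ Inl i) = cnj (cadjoint \<Phi>1 y $ i)"
    unfolding cinner_axis_left[symmetric] by (simp add: row_op_axis[OF \<Phi>1 \<Phi>2] flip: cadjoint_works[OF P] cadjoint_works[OF \<Phi>1])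
  then show "cadjoint (row_op \<Phi>1 \<Phi>2) y $ Inl i = cadjoint \<Phi>1 y $ i" by simp
  have "cnj (cadjoint (row_op \<Phi>1 \<Phi>2) y $ Inr i) = cnj (cadjoint \<Phi>2 y $ i)"
    unfolding cinner_axis_left[symmetric] by (simp add: row_op_axis[OF \<Phi>1 \<Phi>2] flip: cadjoint_works[OF P] cadjoint_works[OF \<Phi>2])
  then show "cadjoint (row_op \<Phi>1 \<Phi>2) y $ Inr i = cadjoint \<Phi>2 y $ i" by simp
qed

text \<open>
  Multiplication by \<open>J\<close> moves the first unit vectors to the second half, where the row operator acts as
  \<open>\<Phi>2\<close>; the identity matrix does not contribute to the lower left block.
\<close>

lemma c_fun_eq:
  fixes \<Phi>1 \<Phi>2 :: "complex ^ 'p::finite \<Rightarrow> 'h::chilbert_space"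
  assumes \<Phi>1: "bounded_clinear \<Phi>1" and \<Phi>2: "bounded_clinear \<Phi>2"
    and P: "bounded_clinear (row_op \<Phi>1 \<Phi>2)"
  shows "c_fun A S (row_op \<Phi>1 \<Phi>2) z = matrix (\<lambda>u. (- \<i> * z) *\<^sub>C
    cadjoint \<Phi>2 (inv (id_minus z (cadjoint A)) (inv S (\<Phi>2 u))))"
proof -
  have J: "J_mat *v axis (Inl j) 1 = (axis (Inr j) 1 :: complex ^ ('p + 'p))" for j
  proof -
    have "(J_mat *v axis (Inl j) 1) $ k = (axis (Inr j) 1 :: complex ^ ('p + 'p)) $ k" for k
      by (cases k) (auto simp: J_mat_mult axis_def)
    then show ?thesis by (simp add: vec_eq_iff)
  qed
  show ?thesis
    by (simp add: c_fun_def lower_left_def transfer_mat_def matrix_def mat_def vec_eq_iff J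
        row_op_axis[OF \<Phi>1 \<Phi>2] cadjoint_row_op[OF assms] scaleC_vec_def scaleC_complex_def)
qed

section \<open>The J-identity of a positive S-node\<close>

text \<open>
  The hypotheses of the main result, with the operator identity written out in terms of \<open>\<Phi>1\<close> and \<open>\<Phi>2\<close>.
  The resolvent condition is stated for \<open>A\<close>; by taking adjoints it concerns the transfer matrix at the
  conjugate points.
\<close>

locale positive_node =
  fixes A S :: "'h::chilbert_space \<Rightarrow> 'h"
    and \<Phi>1 \<Phi>2 :: "complex ^ 'p::finite \<Rightarrow> 'h"
    and r0 \<epsilon> \<kappa> :: real
  assumes A: "bounded_clinear A" and S: "bounded_clinear S"
    and \<Phi>1: "bounded_clinear \<Phi>1" and \<Phi>2: "bounded_clinear \<Phi>2"
    and S_selfadjoint: "cinner (S x) y = cinner x (S y)"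
    and node: "A (S x) - S (cadjoint A x) = \<i> *\<^sub>C (\<Phi>1 (cadjoint \<Phi>2 x) + \<Phi>2 (cadjoint \<Phi>1 x))"
    and \<epsilon>: "\<epsilon> > 0" and coercive: "\<epsilon> * (norm x)\<^sup>2 \<le> Re (cinner (S x) x)"
    and \<Phi>2_inj: "\<Phi>2 u = 0 \<Longrightarrow> u = 0"
    and r0: "r0 > 0"
    and invertible_resolvent: "Im w \<le> 0 \<or> r0 \<le> norm w \<Longrightarrow> has_bounded_inverse (id_minus w A)"
    and \<kappa>: "0 < \<kappa>" "\<kappa> < 1"
    and growth: "Limsup at_top (\<lambda>r. ereal (ln (resolvent_sup A r0 r) / r powr \<kappa>)) < \<infinity>"
begin

text \<open>
  The lower half-plane appears because \<open>w\<close> stands for the conjugate of a point of the upper one.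
\<close>

definition region where "region = {w. Im w \<le> 0 \<or> r0 \<le> norm w}"

lemma inv_region: "w \<in> region \<Longrightarrow> has_bounded_inverse (id_minus w A)"
  using invertible_resolvent by (auto simp: region_def)

abbreviation "R \<equiv> resolvent A"

lemma S_inverse:
  shows "bounded_clinear (inv S)" "inv S (S x) = x" "S (inv S x) = x"
  using has_bounded_inverse_inv[OF has_bounded_inverse_coercive[OF S \<epsilon> coercive]] .

lemma inv_S_selfadjoint: "cinner (inv S x) y = cinner x (inv S y)"
  using S_selfadjoint[of "inv S x" "inv S y"] by (simp add: S_inverse)

text \<open>
  Below, the transfer matrix is studied through its adjoint.  With \<open>w = cnj z\<close>, the vectors
  \<open>adj_upper w u1 u2\<close> and \<open>adj_lower w u1 u2\<close> are the two halves of the adjoint of the transfer matrix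
  at \<open>z\<close> applied to \<open>(u1, u2)\<close>.  For \<open>u1 = 0\<close> they are \<open>c(z)* u2\<close> and \<open>d(z)* u2\<close>.  This form needs
  only the resolvent of \<open>A\<close> itself.
\<close>

definition state :: "complex \<Rightarrow> complex ^ 'p \<Rightarrow> complex ^ 'p \<Rightarrow> 'h"
  where "state w u1 u2 = R w (\<Phi>1 u1 + \<Phi>2 u2)"

definition adj_upper :: "complex \<Rightarrow> complex ^ 'p \<Rightarrow> complex ^ 'p \<Rightarrow> complex ^ 'p"
  where "adj_upper w u1 u2 = u1 + (\<i> * w) *\<^sub>C cadjoint \<Phi>2 (inv S (state w u1 u2))"

definition adj_lower :: "complex \<Rightarrow> complex ^ 'p \<Rightarrow> complex ^ 'p \<Rightarrow> complex ^ 'p"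
  where "adj_lower w u1 u2 = u2 + (\<i> * w) *\<^sub>C cadjoint \<Phi>1 (inv S (state w u1 u2))"

text \<open>
  The polarized form of the identity for the transfer matrix.  The terms with \<open>A\<close> cancel by the operator
  identity of the node.  Taking \<open>w' = w\<close> gives positivity, and taking \<open>w' = cnj w\<close> makes the last term
  vanish, which says that the transfer matrix is invertible with an explicit inverse.
\<close>

lemma J_identity:
  assumes w: "w \<in> region" and w': "w' \<in> region"
  shows "cinner (adj_upper w u1 u2) (adj_lower w' v1 v2) + cinner (adj_lower w u1 u2) (adj_upper w' v1 v2)
    = cinner u1 v2 + cinner u2 v1
      + \<i> * (w - cnj w') * cinner (inv S (state w u1 u2)) (state w' v1 v2)"
proof -
  define x where "x = state w u1 u2"
  define x' where "x' = state w' v1 v2"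
  define k where "k = inv S x"
  define k' where "k' = inv S x'"
  have Sk: "S k = x" "S k' = x'"
    by (simp_all add: k_def k'_def S_inverse)
  have x: "\<Phi>1 u1 + \<Phi>2 u2 = x - w *\<^sub>C A x" "\<Phi>1 v1 + \<Phi>2 v2 = x' - w' *\<^sub>C A x'"
    unfolding x_def x'_def state_def
    by (simp_all add: resolvent_works(2)[OF inv_region[OF w]] resolvent_works(2)[OF inv_region[OF w']])
  have sym: "cinner x k' = cinner k x'"
    using S_selfadjoint[of k k'] by (simp add: Sk)
  have node': "cinner (A x) k' - cinner k (A x')
      = \<i> * (cinner (cadjoint \<Phi>2 k) (cadjoint \<Phi>1 k') + cinner (cadjoint \<Phi>1 k) (cadjoint \<Phi>2 k'))"
  proof -
    have "cinner (A (S k) - S (cadjoint A k)) k' = cinner (A x) k' - cinner k (A x')"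
      by (simp add: Sk cinner_diff_left S_selfadjoint cadjoint_works'[OF A])
    then show ?thesis
      unfolding node by (simp add: cinner_simps cadjoint_works[OF \<Phi>1] cadjoint_works[OF \<Phi>2])
  qed
  have e1: "cinner u1 (cadjoint \<Phi>1 k') + cinner u2 (cadjoint \<Phi>2 k') = cinner x k' - w * cinner (A x) k'"
    using arg_cong[OF x(1), of "\<lambda>y. cinner y k'"]
    by (simp add: cinner_simps cadjoint_works[OF \<Phi>1] cadjoint_works[OF \<Phi>2])
  have e2: "cinner (cadjoint \<Phi>1 k) v1 + cinner (cadjoint \<Phi>2 k) v2 = cinner k x' - cnj w' * cinner k (A x')"
    using arg_cong[OF x(2), of "\<lambda>y. cinner k y"]
    by (simp add: cinner_simps cadjoint_works'[OF \<Phi>1] cadjoint_works'[OF \<Phi>2])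
  have "cinner (adj_upper w u1 u2) (adj_lower w' v1 v2) + cinner (adj_lower w u1 u2) (adj_upper w' v1 v2)
      = cinner u1 v2 + cinner u2 v1
        - \<i> * cnj w' * (cinner u1 (cadjoint \<Phi>1 k') + cinner u2 (cadjoint \<Phi>2 k'))
        + \<i> * w * (cinner (cadjoint \<Phi>1 k) v1 + cinner (cadjoint \<Phi>2 k) v2)
        + w * cnj w' * (cinner (cadjoint \<Phi>2 k) (cadjoint \<Phi>1 k') + cinner (cadjoint \<Phi>1 k) (cadjoint \<Phi>2 k'))"
    unfolding adj_upper_def adj_lower_def x_def[symmetric] x'_def[symmetric] k_def[symmetric] k'_def[symmetric]
    by (simp add: cinner_simps algebra_simps)
  also have "cinner (cadjoint \<Phi>2 k) (cadjoint \<Phi>1 k') + cinner (cadjoint \<Phi>1 k) (cadjoint \<Phi>2 k')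
      = - \<i> * (cinner (A x) k' - cinner k (A x'))"
    unfolding node' by simp
  finally show ?thesis
    unfolding e1 e2 sym x_def[symmetric] x'_def[symmetric] k_def[symmetric]
    by (simp add: algebra_simps)
qed

lemma inv_S_pos: "x \<noteq> 0 \<Longrightarrow> 0 < Re (cinner (inv S x) x)"
proof -
  assume "x \<noteq> 0"
  then have "inv S x \<noteq> 0"
    using S_inverse(3)[of x] bounded_clinear_imp(4)[OF S] by metis
  then have "0 < \<epsilon> * (norm (inv S x))\<^sup>2"
    using \<epsilon> by simp
  also have "\<dots> \<le> Re (cinner (S (inv S x)) (inv S x))" by (rule coercive)
  also have "\<dots> = Re (cinner (inv S x) x)"
    by (simp add: S_inverse inv_S_selfadjoint)
  finally show ?thesis .
qed

lemma inner_row_eq: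
  assumes w: "w \<in> region"
  shows "2 * Re (cinner (adj_upper w 0 v) (adj_lower w 0 v))
    = - 2 * Im w * Re (cinner (inv S (state w 0 v)) (state w 0 v))"
proof -
  have "cinner (adj_upper w 0 v) (adj_lower w 0 v) + cnj (cinner (adj_upper w 0 v) (adj_lower w 0 v))
      = \<i> * (w - cnj w) * cinner (inv S (state w 0 v)) (state w 0 v)"
    using J_identity[OF w w, of 0 v 0 v] by (simp flip: cinner_commute)
  from arg_cong[OF this, of Re] show ?thesis
    by simp
qed

lemma inner_row_nonneg:
  assumes w: "Im w \<le> 0"
  shows "0 \<le> Re (cinner (adj_upper w 0 v) (adj_lower w 0 v))"
proof -
  have "w \<in> region" using w by (simp add: region_def)
  have "0 \<le> Re (cinner (inv S (state w 0 v)) (state w 0 v))"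
    using inv_S_pos[of "state w 0 v"] by (cases "state w 0 v = 0") auto
  then show ?thesis
    using inner_row_eq[OF \<open>w \<in> region\<close>, of v] w mult_nonpos_nonneg[of "Im w"] by auto
qed

lemma adj_upper_nonzero:
  assumes w: "Im w < 0" and v: "v \<noteq> 0"
  shows "adj_upper w 0 v \<noteq> 0"
proof
  assume 0: "adj_upper w 0 v = 0"
  have U: "w \<in> region" using w by (simp add: region_def)
  have "state w 0 v \<noteq> 0"
  proof
    assume "state w 0 v = 0"
    then have "\<Phi>2 v = 0"
      using resolvent_works(2)[OF inv_region[OF U], of "\<Phi>2 v"]
      by (simp add: state_def bounded_clinear_imp[OF \<Phi>1] bounded_clinear_imp[OF A])
    then show False using \<Phi>2_inj v by auto
  qed
  then have "0 < Re (cinner (inv S (state w 0 v)) (state w 0 v))"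
    by (rule inv_S_pos)
  then show False
    using inner_row_eq[OF U, of v] w by (simp add: 0)
qed

text \<open>
  The case \<open>w' = cnj w\<close> of the J-identity: an upper bound for the upper block row of the transfer
  matrix at one point becomes a lower bound for the lower row \<open>[c d]\<close> at the conjugate point.
\<close>

lemma square_norm_le_row:
  assumes "w \<in> region" "cnj w \<in> region"
  shows "(norm v)\<^sup>2 \<le> norm (adj_upper w 0 v) * norm (adj_lower (cnj w) v 0) + norm (adj_lower w 0 v) * norm (adj_upper (cnj w) v 0)"
proof -
  have "of_real ((norm v)\<^sup>2) = cinner (adj_upper w 0 v) (adj_lower (cnj w) v 0) + cinner (adj_lower w 0 v) (adj_upper (cnj w) v 0)"
    using J_identity[OF assms, of 0 v v 0] by (simp add: cinner_self)
  then have "(norm v)\<^sup>2 = norm (cinner (adj_upper w 0 v) (adj_lower (cnj w) v 0) + cinner (adj_lower w 0 v) (adj_upper (cnj w) v 0))"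
    by (metis norm_of_real abs_power2)
  also have "\<dots> \<le> norm (adj_upper w 0 v) * norm (adj_lower (cnj w) v 0) + norm (adj_lower w 0 v) * norm (adj_upper (cnj w) v 0)"
    by (rule order_trans[OF norm_triangle_ineq add_mono[OF norm_cinner_le norm_cinner_le]])
  finally show ?thesis .
qed

text \<open>
  On the real line positivity degenerates, and the second form of the J-identity takes over.
\<close>

lemma row_kernel:
  assumes w: "Im w \<le> 0" and 0: "adj_upper w 0 v = 0" "adj_lower w 0 v = 0"
  shows "v = 0"
proof (cases "Im w < 0")
  case True
  then show ?thesis using adj_upper_nonzero 0 by blast
next
  case False
  then have "w \<in> region" "cnj w \<in> region" using w by (auto simp: region_def)
  from square_norm_le_row[OF this, of v] show ?thesis by (simp add: 0)
qed

section \<open>Growth of the blocks and of the pencil determinant\<close>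

text \<open>
  The logarithmic growth scale.  The summand \<open>1\<close> lets constants be absorbed into multiples of it.
\<close>

definition weight :: "complex \<Rightarrow> real" where "weight w = 1 + norm w powr \<kappa>"

lemma weight_ge_1: "1 \<le> weight w"
  by (simp add: weight_def)

text \<open>
  Follows from \<open>ln y \<le> y\<close> for \<open>y = |w|\<^sup>\<kappa>\<close>.
\<close>

lemma norm_le_exp_weight: "norm w \<le> exp (weight w / \<kappa>)"
proof (cases "w = 0")
  case False
  have "\<kappa> * ln (norm w) = ln (norm w powr \<kappa>)"
    using False by (simp add: ln_powr)
  also have "\<dots> \<le> weight w"
    using False ln_le_minus_one[of "norm w powr \<kappa>"] by (simp add: weight_def)
  finally have "ln (norm w) \<le> weight w / \<kappa>"
    using \<kappa> by (simp add: field_simps)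
  then show ?thesis
    using False by (metis exp_le_cancel_iff exp_ln zero_less_norm_iff)
qed simp

lemma block_bounds:
  obtains K where "K \<ge> 0"
    "\<And>w u1 u2. w \<in> region \<Longrightarrow> norm (adj_upper w u1 u2) \<le> exp (K * weight w) * (norm u1 + norm u2)"
    "\<And>w u1 u2. w \<in> region \<Longrightarrow> norm (adj_lower w u1 u2) \<le> exp (K * weight w) * (norm u1 + norm u2)"
proof -
  obtain C where C: "C \<ge> 0" "\<And>w. w \<in> region \<Longrightarrow> onorm (R w) \<le> exp (C * weight w)"
    using resolvent_exponential_growth[OF A r0 \<kappa>(1) invertible_resolvent growth]
    by (auto simp: region_def weight_def)
  obtain a1 where a1: "a1 > 0" "\<And>u. norm (\<Phi>1 u) \<le> a1 * norm u"
    using bounded_clinear_bound[OF \<Phi>1] by blast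
  obtain a2 where a2: "a2 > 0" "\<And>u. norm (\<Phi>2 u) \<le> a2 * norm u"
    using bounded_clinear_bound[OF \<Phi>2] by blast
  obtain b1 where b1: "b1 > 0" "\<And>u. norm (cadjoint \<Phi>1 u) \<le> b1 * norm u"
    using bounded_clinear_bound[OF bounded_clinear_cadjoint[OF \<Phi>1]] by blast
  obtain b2 where b2: "b2 > 0" "\<And>u. norm (cadjoint \<Phi>2 u) \<le> b2 * norm u"
    using bounded_clinear_bound[OF bounded_clinear_cadjoint[OF \<Phi>2]] by blast
  obtain s where s: "s > 0" "\<And>x. norm (inv S x) \<le> s * norm x"
    using bounded_clinear_bound[OF S_inverse(1)] by blast
  define a where "a = a1 + a2"
  define b where "b = b1 + b2"
  define m where "m = b * s * a"
  define K where "K = 1 + 1 / \<kappa> + 2 * m + C"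
  have m: "m > 0" using a1 a2 b1 b2 s by (simp add: m_def a_def b_def)
  have K: "K \<ge> 0" using m C \<kappa> by (simp add: K_def)
  have x: "norm (inv S (state w u1 u2)) \<le> s * (exp (C * weight w) * (a * (norm u1 + norm u2)))"
    if "w \<in> region" for w u1 u2
  proof -
    have "norm (\<Phi>1 u1 + \<Phi>2 u2) \<le> a1 * norm u1 + a2 * norm u2"
      by (rule order_trans[OF norm_triangle_ineq add_mono[OF a1(2) a2(2)]])
    also have "\<dots> \<le> a * norm u1 + a * norm u2"
      using a1 a2 by (intro add_mono mult_right_mono) (auto simp: a_def)
    finally have "norm (\<Phi>1 u1 + \<Phi>2 u2) \<le> a * (norm u1 + norm u2)"
      by (simp add: algebra_simps)
    then have "onorm (R w) * norm (\<Phi>1 u1 + \<Phi>2 u2) \<le> exp (C * weight w) * (a * (norm u1 + norm u2))"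
      using C(2)[OF that] by (intro mult_mono) auto
    then have "norm (state w u1 u2) \<le> exp (C * weight w) * (a * (norm u1 + norm u2))"
      unfolding state_def
      using bounded_clinear_onorm(1)[OF resolvent_works(1)[OF inv_region[OF that]], of "\<Phi>1 u1 + \<Phi>2 u2"] by linarith
    then have "s * norm (state w u1 u2) \<le> s * (exp (C * weight w) * (a * (norm u1 + norm u2)))"
      using s by (intro mult_left_mono) auto
    then show ?thesis using s(2)[of "state w u1 u2"] by linarith
  qed
  have main: "norm (u + (\<i> * w) *\<^sub>C y) \<le> exp (K * weight w) * (norm u1 + norm u2)"
    if w: "w \<in> region" and u: "norm u \<le> norm u1 + norm u2"
      and y: "norm y \<le> b * norm (inv S (state w u1 u2))" for w u u1 u2 and y :: "complex ^ 'p"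
  proof -
    let ?n = "norm u1 + norm u2"
    have "b * norm (inv S (state w u1 u2)) \<le> b * (s * (exp (C * weight w) * (a * ?n)))"
      using b1(1) b2(1) by (intro mult_left_mono x w) (simp add: b_def)
    then have "norm y \<le> b * (s * (exp (C * weight w) * (a * ?n)))"
      using y by linarith
    then have y': "norm y \<le> m * exp (C * weight w) * ?n"
      by (simp add: m_def mult_ac)
    have "norm (u + (\<i> * w) *\<^sub>C y) \<le> norm u + norm w * norm y"
      using norm_triangle_ineq[of u "(\<i> * w) *\<^sub>C y"] by (simp add: norm_scaleC norm_mult)
    also have "\<dots> \<le> ?n + exp (weight w / \<kappa>) * (m * exp (C * weight w) * ?n)"
      using u y' norm_le_exp_weight[of w] by (intro add_mono mult_mono) auto
    also have "\<dots> = (1 + exp (weight w / \<kappa>) * m * exp (C * weight w)) * ?n"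
      by (simp add: algebra_simps)
    also have "\<dots> \<le> exp (K * weight w) * ?n"
    proof (rule mult_right_mono)
      have "m \<le> exp (2 * m * weight w)"
        using le_exp_mult[of "weight w" m] weight_ge_1[of w] m by simp
      then have "exp (weight w / \<kappa>) * m * exp (C * weight w) \<le> exp (weight w / \<kappa>) * exp (2 * m * weight w) * exp (C * weight w)"
        by (intro mult_right_mono mult_left_mono) auto
      also have "\<dots> = exp ((K - 1) * weight w)"
        by (simp add: K_def algebra_simps flip: exp_add)
      finally have "1 + exp (weight w / \<kappa>) * m * exp (C * weight w) \<le> 1 + exp ((K - 1) * weight w)"
        by simp
      also have "1 \<le> exp ((K - 1) * weight w)"
        using m C \<kappa> weight_ge_1[of w] by (simp add: K_def)
      then have "1 + exp ((K - 1) * weight w) \<le> 2 * exp ((K - 1) * weight w)"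
        by simp
      also have "2 \<le> exp (weight w)"
        using exp_ge_add_one_self[of "weight w"] weight_ge_1[of w] by linarith
      then have "2 * exp ((K - 1) * weight w) \<le> exp (weight w) * exp ((K - 1) * weight w)"
        by (intro mult_right_mono) auto
      also have "\<dots> = exp (K * weight w)"
        by (simp add: algebra_simps flip: exp_add)
      finally show "1 + exp (weight w / \<kappa>) * m * exp (C * weight w) \<le> exp (K * weight w)" by simp
    qed auto
    finally show ?thesis .
  qed
  show ?thesis
  proof (rule that[OF K])
    fix w u1 u2 assume w: "w \<in> region"
    have "b2 * norm (inv S (state w u1 u2)) \<le> b * norm (inv S (state w u1 u2))"
      "b1 * norm (inv S (state w u1 u2)) \<le> b * norm (inv S (state w u1 u2))"
      using b1 b2 by (auto simp: b_def intro!: mult_right_mono)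
    then have "norm (cadjoint \<Phi>2 (inv S (state w u1 u2))) \<le> b * norm (inv S (state w u1 u2))"
      "norm (cadjoint \<Phi>1 (inv S (state w u1 u2))) \<le> b * norm (inv S (state w u1 u2))"
      using b1(2)[of "inv S (state w u1 u2)"] b2(2)[of "inv S (state w u1 u2)"] by linarith+
    then show "norm (adj_upper w u1 u2) \<le> exp (K * weight w) * (norm u1 + norm u2)"
      "norm (adj_lower w u1 u2) \<le> exp (K * weight w) * (norm u1 + norm u2)"
      unfolding adj_upper_def adj_lower_def by (intro main w; simp)+
  qed
qed

text \<open>
  The matrices of \<open>c(z)*\<close> and \<open>d(z)*\<close> as functions of \<open>w = cnj z\<close>.  In each entry every
  operator but the resolvent is moved to the second argument of the inner product, so that
  holomorphy in \<open>w\<close> is that of the resolvent.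
\<close>

definition c_mat :: "complex \<Rightarrow> complex ^ 'p ^ 'p"
  where "c_mat w = (\<chi> i j. \<i> * w * cinner (R w (\<Phi>2 (axis j 1))) (inv S (\<Phi>2 (axis i 1))))"

definition d_mat :: "complex \<Rightarrow> complex ^ 'p ^ 'p"
  where "d_mat w = (\<chi> i j. (if i = j then 1 else 0) + \<i> * w * cinner (R w (\<Phi>2 (axis j 1))) (inv S (\<Phi>1 (axis i 1))))"

lemma c_mat_vec:
  assumes w: "w \<in> region"
  shows "c_mat w *v v = adj_upper w 0 v"
proof -
  have "bounded_clinear (\<lambda>v. (\<i> * w) *\<^sub>C cadjoint \<Phi>2 (inv S (R w (\<Phi>2 v))))"
    by (rule bounded_clinear_scaleC[OF bounded_clinear_comp[OF bounded_clinear_cadjoint[OF \<Phi>2]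
          bounded_clinear_comp[OF S_inverse(1) bounded_clinear_comp[OF resolvent_works(1)[OF inv_region[OF w]] \<Phi>2]]]])
  from clinear_matrix_vec[OF this, of v]
  have *: "(\<chi> i j. ((\<i> * w) *\<^sub>C cadjoint \<Phi>2 (inv S (R w (\<Phi>2 (axis j 1))))) $ i) *v v
      = adj_upper w 0 v"
    by (simp add: adj_upper_def state_def bounded_clinear_imp[OF \<Phi>1])
  have "((\<i> * w) *\<^sub>C cadjoint \<Phi>2 (inv S y)) $ i = \<i> * w * cinner y (inv S (\<Phi>2 (axis i 1)))" for y i
    by (simp add: cinner_scaleC_left cinner_axis[symmetric] cadjoint_works'[OF \<Phi>2, symmetric] inv_S_selfadjoint)
  with * show ?thesis
    by (simp add: c_mat_def)
qed

lemma d_mat_vec: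
  assumes w: "w \<in> region"
  shows "d_mat w *v v = adj_lower w 0 v"
proof -
  have "bounded_clinear (\<lambda>v. v + (\<i> * w) *\<^sub>C cadjoint \<Phi>1 (inv S (R w (\<Phi>2 v))))"
    by (rule bounded_clinear_add[OF bounded_clinear_ident
          bounded_clinear_scaleC[OF bounded_clinear_comp[OF bounded_clinear_cadjoint[OF \<Phi>1]
          bounded_clinear_comp[OF S_inverse(1) bounded_clinear_comp[OF resolvent_works(1)[OF inv_region[OF w]] \<Phi>2]]]]])
  from clinear_matrix_vec[OF this, of v]
  have *: "(\<chi> i j. (axis j 1 + (\<i> * w) *\<^sub>C cadjoint \<Phi>1 (inv S (R w (\<Phi>2 (axis j 1))))) $ i) *v v
      = adj_lower w 0 v"
    by (simp add: adj_lower_def state_def bounded_clinear_imp[OF \<Phi>1])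
  have "(axis j 1 + (\<i> * w) *\<^sub>C cadjoint \<Phi>1 (inv S y)) $ i
      = (if i = j then 1 else 0) + \<i> * w * cinner y (inv S (\<Phi>1 (axis i 1)))" for y i j
  proof -
    have "((\<i> * w) *\<^sub>C cadjoint \<Phi>1 (inv S y)) $ i = \<i> * w * cinner y (inv S (\<Phi>1 (axis i 1)))"
      by (simp add: cinner_scaleC_left cinner_axis[symmetric] cadjoint_works'[OF \<Phi>1, symmetric] inv_S_selfadjoint)
    moreover have "(axis j 1 :: complex ^ 'p) $ i = (if i = j then 1 else 0)"
      by (simp add: axis_def)
    ultimately show ?thesis by simp
  qed
  with * show ?thesis
    by (simp add: d_mat_def)
qed

lemma continuous_on_entries:
  shows "continuous_on region (\<lambda>w. c_mat w $ i $ j)" "continuous_on region (\<lambda>w. d_mat w $ i $ j)"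
  unfolding c_mat_def d_mat_def using inv_region
  by (auto intro!: continuous_intros continuous_on_cinner_resolvent[OF A])

lemma holomorphic_on_entries:
  shows "(\<lambda>w. c_mat w $ i $ j) holomorphic_on {w. Im w < 0}"
    "(\<lambda>w. d_mat w $ i $ j) holomorphic_on {w. Im w < 0}"
proof -
  have V: "has_bounded_inverse (id_minus w A)" if "w \<in> {w. Im w < 0}" for w
    using that by (intro inv_region) (auto simp: region_def)
  show "(\<lambda>w. c_mat w $ i $ j) holomorphic_on {w. Im w < 0}"
    "(\<lambda>w. d_mat w $ i $ j) holomorphic_on {w. Im w < 0}"
    unfolding c_mat_def d_mat_def
    by (auto intro!: holomorphic_intros holomorphic_on_cinner_resolvent[OF A _ V] open_halfspace_Im_lt)
qed

lemma entry_bounds: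
  obtains K where "K \<ge> 0"
    "\<And>w i j. w \<in> region \<Longrightarrow> norm (c_mat w $ i $ j) \<le> exp (K * weight w)"
    "\<And>w i j. w \<in> region \<Longrightarrow> norm (d_mat w $ i $ j) \<le> exp (K * weight w)"
proof -
  obtain K where K: "K \<ge> 0"
    "\<And>w u1 u2. w \<in> region \<Longrightarrow> norm (adj_upper w u1 u2) \<le> exp (K * weight w) * (norm u1 + norm u2)"
    "\<And>w u1 u2. w \<in> region \<Longrightarrow> norm (adj_lower w u1 u2) \<le> exp (K * weight w) * (norm u1 + norm u2)"
    using block_bounds by blast
  show ?thesis
  proof (rule that[OF K(1)])
    fix w i j assume w: "w \<in> region"
    have "norm (c_mat w $ i $ j) = norm (adj_upper w 0 (axis j 1) $ i)"
      by (simp flip: c_mat_vec[OF w] add: matrix_mult_axis)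
    also have "\<dots> \<le> norm (adj_upper w 0 (axis j 1))" by (rule Finite_Cartesian_Product.norm_nth_le)
    finally show "norm (c_mat w $ i $ j) \<le> exp (K * weight w)"
      using K(2)[OF w, of 0 "axis j 1"] by simp
    have "norm (d_mat w $ i $ j) = norm (adj_lower w 0 (axis j 1) $ i)"
      by (simp flip: d_mat_vec[OF w] add: matrix_mult_axis)
    also have "\<dots> \<le> norm (adj_lower w 0 (axis j 1))" by (rule Finite_Cartesian_Product.norm_nth_le)
    finally show "norm (d_mat w $ i $ j) \<le> exp (K * weight w)"
      using K(3)[OF w, of 0 "axis j 1"] by simp
  qed
qed

lemma det_pencil_nonzero:
  assumes w: "Im w \<le> 0" and \<delta>: "\<delta> > 0"
  shows "det (pencil (c_mat w) (d_mat w) (of_real \<delta>)) \<noteq> 0"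
proof
  have U: "w \<in> region" using w by (simp add: region_def)
  assume "det (pencil (c_mat w) (d_mat w) (of_real \<delta>)) = 0"
  then have "Re (of_real \<delta>) \<le> 0"
    by (rule det_pencil_root[rotated 2])
      (use inner_row_nonneg[OF w] row_kernel[OF w] in \<open>auto simp: c_mat_vec[OF U] d_mat_vec[OF U]\<close>)
  then show False using \<delta> by simp
qed

lemma det_c_mat_nonzero:
  assumes w: "Im w < 0"
  shows "det (c_mat w) \<noteq> 0"
proof
  have U: "w \<in> region" using w by (simp add: region_def)
  assume "det (c_mat w) = 0"
  then obtain v where "v \<noteq> 0" "c_mat w *v v = 0" by (rule det_zero_imp_kernel)
  then show False using adj_upper_nonzero[OF w] by (simp add: c_mat_vec[OF U])
qed

lemma norm_det_pencil_decreasing: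
  assumes w: "Im w \<le> 0" and "0 \<le> s" "s \<le> t"
  shows "norm (det (pencil (c_mat w) (d_mat w) (of_real s))) \<le> norm (det (pencil (c_mat w) (d_mat w) (of_real t)))"
proof -
  have U: "w \<in> region" using w by (simp add: region_def)
  show ?thesis
    by (rule norm_det_pencil_mono)
      (use inner_row_nonneg[OF w] row_kernel[OF w] assms in \<open>auto simp: c_mat_vec[OF U] d_mat_vec[OF U]\<close>)
qed

text \<open>
  The upper bound holds for every \<open>\<delta>\<close>; the lower bound is where \<open>\<delta> > 0\<close> matters.  For \<open>|w| \<ge> r0\<close> the point
  \<open>cnj w\<close> is admissible too, and the row \<open>[c d]\<close> is bounded below; since the mixed term is nonnegative,
  \<open>|C v + \<delta> D v|\<^sup>2 \<ge> \<delta>\<^sup>2 (|C v|\<^sup>2 + |D v|\<^sup>2)\<close>, which bounds the pencil below.  On the remaining compact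
  half-disk the determinant is continuous without zeros.
\<close>

lemma ln_det_pencil_bound:
  assumes \<delta>: "0 < \<delta>" "\<delta> \<le> 1"
  obtains K where "\<And>w. Im w \<le> 0 \<Longrightarrow> \<bar>ln (norm (det (pencil (c_mat w) (d_mat w) (of_real \<delta>))))\<bar> \<le> K * weight w"
proof -
  let ?N = "\<lambda>w. pencil (c_mat w) (d_mat w) (of_real \<delta>)"
  obtain K where K: "K \<ge> 0"
    "\<And>w u1 u2. w \<in> region \<Longrightarrow> norm (adj_upper w u1 u2) \<le> exp (K * weight w) * (norm u1 + norm u2)"
    "\<And>w u1 u2. w \<in> region \<Longrightarrow> norm (adj_lower w u1 u2) \<le> exp (K * weight w) * (norm u1 + norm u2)"
    using block_bounds by blast
  obtain L where L: "L \<ge> 0"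
    "\<And>w i j. w \<in> region \<Longrightarrow> norm (c_mat w $ i $ j) \<le> exp (L * weight w)"
    "\<And>w i j. w \<in> region \<Longrightarrow> norm (d_mat w $ i $ j) \<le> exp (L * weight w)"
    using entry_bounds by blast
  define K1 where "K1 = 2 * fact CARD('p) + real CARD('p) * (L + 1)"
  have above: "ln (norm (det (?N w))) \<le> K1 * weight w" if w: "Im w \<le> 0" for w
  proof -
    have U: "w \<in> region" using w by (simp add: region_def)
    have "norm (?N w $ i $ j) \<le> exp ((L + 1) * weight w)" for i j
    proof -
      have "norm (?N w $ i $ j) \<le> norm (c_mat w $ i $ j) + norm (of_real \<delta> * d_mat w $ i $ j)"
        unfolding pencil_def by (simp add: norm_triangle_ineq)
      also have "norm (of_real \<delta> * d_mat w $ i $ j) \<le> 1 * norm (d_mat w $ i $ j)"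
        unfolding norm_mult using \<delta> by (intro mult_right_mono) auto
      finally have "norm (?N w $ i $ j) \<le> 2 * exp (L * weight w)"
        using L(2,3)[OF U, of i j] by linarith
      also have "2 \<le> exp (weight w)"
        using exp_ge_add_one_self[of "weight w"] weight_ge_1[of w] by linarith
      then have "2 * exp (L * weight w) \<le> exp (weight w) * exp (L * weight w)"
        by (intro mult_right_mono) auto
      also have "\<dots> = exp ((L + 1) * weight w)"
        by (simp add: algebra_simps flip: exp_add)
      finally show ?thesis .
    qed
    then have "norm (det (?N w)) \<le> exp (K1 * weight w)"
      unfolding K1_def using weight_ge_1[of w] by (intro norm_det_le_exp) auto
    then have "ln (norm (det (?N w))) \<le> ln (exp (K1 * weight w))"
      using det_pencil_nonzero[OF w \<delta>(1)] by (subst ln_le_cancel_iff) auto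
    then show ?thesis by simp
  qed
  define q where "q = 2 / \<delta>"
  have q: "q > 0" using \<delta> by (simp add: q_def)
  define K2 where "K2 = 2 * fact CARD('p) + real CARD('p) * (2 * q + K)"
  have far: "- ln (norm (det (?N w))) \<le> K2 * weight w" if w: "Im w \<le> 0" "r0 \<le> norm w" for w
  proof -
    have U: "w \<in> region" "cnj w \<in> region" using w by (auto simp: region_def)
    define m where "m = \<delta> / 2 * exp (- (K * weight w))"
    have m: "m > 0" using \<delta> by (simp add: m_def)
    have "m * norm v \<le> norm (?N w *v v)" for v
    proof -
      let ?c = "adj_upper w 0 v" and ?d = "adj_lower w 0 v"
      have weight_cnj: "weight (cnj w) = weight w" by (simp add: weight_def)
      have "(norm v)\<^sup>2 \<le> norm ?c * (exp (K * weight w) * norm v) + norm ?d * (exp (K * weight w) * norm v)"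
        using square_norm_le_row[OF U, of v]
          mult_left_mono[OF K(3)[OF U(2), of v 0], of "norm ?c"] mult_left_mono[OF K(2)[OF U(2), of v 0], of "norm ?d"]
        by (simp add: weight_cnj)
      then have "norm v * norm v \<le> (exp (K * weight w) * (norm ?c + norm ?d)) * norm v"
        by (simp add: power2_eq_square algebra_simps)
      then have "norm v \<le> exp (K * weight w) * (norm ?c + norm ?d)"
        by (cases "v = 0") auto
      then have 1: "exp (- (K * weight w)) * norm v \<le> norm ?c + norm ?d"
        by (simp add: exp_minus field_simps)
      have "(\<delta> / 2 * (norm ?c + norm ?d))\<^sup>2 \<le> (norm (?c + of_real \<delta> *\<^sub>C ?d))\<^sup>2"
      proof -
        have "(norm ?c + norm ?d)\<^sup>2 \<le> 2 * (norm ?c)\<^sup>2 + 2 * (norm ?d)\<^sup>2"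
          using sum_squares_bound[of "norm ?c" "norm ?d"] by (simp add: power2_eq_square algebra_simps)
        also have "\<dots> \<le> 4 * ((norm ?c)\<^sup>2 + (norm ?d)\<^sup>2)" by simp
        finally have "(\<delta> / 2)\<^sup>2 * (norm ?c + norm ?d)\<^sup>2 \<le> (\<delta> / 2)\<^sup>2 * (4 * ((norm ?c)\<^sup>2 + (norm ?d)\<^sup>2))"
          by (rule mult_left_mono) simp
        also have "\<dots> = \<delta>\<^sup>2 * (norm ?c)\<^sup>2 + \<delta>\<^sup>2 * (norm ?d)\<^sup>2"
          by (simp add: power2_eq_square algebra_simps)
        also have "\<dots> \<le> 1 * (norm ?c)\<^sup>2 + \<delta>\<^sup>2 * (norm ?d)\<^sup>2"
          using \<delta> by (intro add_right_mono mult_right_mono) (auto simp: power_le_one)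
        also have "\<dots> \<le> (norm (?c + of_real \<delta> *\<^sub>C ?d))\<^sup>2"
        proof -
          have "(norm (?c + of_real \<delta> *\<^sub>C ?d))\<^sup>2
              = (norm ?c)\<^sup>2 + 2 * (\<delta> * Re (cinner ?c ?d)) + \<delta> * \<delta> * (norm ?d)\<^sup>2"
            by (simp add: scaleC_of_real power2_norm_eq_inner inner_simps Re_cinner inner_commute algebra_simps)
          moreover have "0 \<le> \<delta> * Re (cinner ?c ?d)"
            using inner_row_nonneg[OF w(1), of v] \<delta> by simp
          ultimately show ?thesis by (simp add: power2_eq_square)
        qed
        finally show ?thesis by (simp only: power_mult_distrib)
      qed
      then have "\<delta> / 2 * (norm ?c + norm ?d) \<le> norm (?c + of_real \<delta> *\<^sub>C ?d)"
        by (rule power2_le_imp_le) simp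
      then have 2: "\<delta> / 2 * (norm ?c + norm ?d) \<le> norm (?N w *v v)"
        by (simp add: pencil_mult_vec c_mat_vec[OF U(1)] d_mat_vec[OF U(1)] scaleC_vec_eq)
      have "m * norm v \<le> \<delta> / 2 * (norm ?c + norm ?d)"
        unfolding m_def mult.assoc using 1 \<delta> by (intro mult_left_mono) auto
      then show ?thesis using 2 by linarith
    qed
    then have "inverse (norm (det (?N w))) \<le> fact CARD('p) * inverse m ^ CARD('p)"
      using inverse_norm_det_le[OF m, of "?N w"] by blast
    also have "inverse m = q * exp (K * weight w)"
      by (simp add: m_def q_def exp_minus field_simps)
    also have "q * exp (K * weight w) \<le> exp ((2 * q + K) * weight w)"
    proof -
      have "q \<le> exp (2 * q * weight w)"
        using le_exp_mult[of "weight w" q] weight_ge_1[of w] q by simp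
      then have "q * exp (K * weight w) \<le> exp (2 * q * weight w) * exp (K * weight w)"
        by (intro mult_right_mono) auto
      then show ?thesis by (simp add: algebra_simps flip: exp_add)
    qed
    then have "fact CARD('p) * (q * exp (K * weight w)) ^ CARD('p) \<le> fact CARD('p) * exp ((2 * q + K) * weight w) ^ CARD('p)"
      using q by (intro mult_left_mono power_mono) auto
    also have "\<dots> \<le> exp (2 * fact CARD('p) * weight w) * exp ((2 * q + K) * weight w) ^ CARD('p)"
      using le_exp_mult[of "weight w" "fact CARD('p)"] weight_ge_1[of w] by (intro mult_right_mono) auto
    also have "\<dots> = exp (K2 * weight w)"
      by (simp add: K2_def algebra_simps exp_add flip: exp_of_nat_mult)
    finally have "ln (inverse (norm (det (?N w)))) \<le> ln (exp (K2 * weight w))"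
      using det_pencil_nonzero[OF w(1) \<delta>(1)] by (subst ln_le_cancel_iff) auto
    then show ?thesis
      using det_pencil_nonzero[OF w(1) \<delta>(1)] by (simp add: ln_inverse)
  qed
  have "\<exists>B. \<forall>w\<in>{w. Im w \<le> 0} \<inter> cball 0 r0. - ln (norm (det (?N w))) \<le> B"
  proof -
    have "continuous_on ({w. Im w \<le> 0} \<inter> cball 0 r0) (\<lambda>w. det (?N w))"
    proof (rule continuous_on_det)
      fix i j
      have "{w. Im w \<le> 0} \<inter> cball 0 r0 \<subseteq> region" by (auto simp: region_def)
      then show "continuous_on ({w. Im w \<le> 0} \<inter> cball 0 r0) (\<lambda>w. ?N w $ i $ j)"
        unfolding pencil_def
        by (auto intro!: continuous_intros continuous_on_subset[OF continuous_on_entries(1)]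
            continuous_on_subset[OF continuous_on_entries(2)])
    qed
    then have cont: "continuous_on ({w. Im w \<le> 0} \<inter> cball 0 r0) (\<lambda>w. - ln (norm (det (?N w))))"
      using det_pencil_nonzero[OF _ \<delta>(1)]
      by (intro continuous_on_minus continuous_on_ln continuous_on_norm) auto
    have "compact ({w. Im w \<le> 0} \<inter> cball 0 r0)"
      by (intro closed_Int_compact closed_halfspace_Im_le) auto
    then have "bdd_above ((\<lambda>w. - ln (norm (det (?N w)))) ` ({w. Im w \<le> 0} \<inter> cball 0 r0))"
      by (intro bounded_imp_bdd_above compact_imp_bounded compact_continuous_image cont)
    then show ?thesis by (auto simp: bdd_above_def)
  qed
  then obtain B where B: "\<And>w. Im w \<le> 0 \<Longrightarrow> norm w \<le> r0 \<Longrightarrow> - ln (norm (det (?N w))) \<le> B"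
    by fastforce
  show ?thesis
  proof (rule that[of "\<bar>K1\<bar> + \<bar>K2\<bar> + \<bar>B\<bar>"])
    fix w assume w: "Im w \<le> 0"
    have "K1 * weight w \<le> \<bar>K1\<bar> * weight w" "K2 * weight w \<le> \<bar>K2\<bar> * weight w" "\<bar>B\<bar> * 1 \<le> \<bar>B\<bar> * weight w"
      "0 \<le> \<bar>K1\<bar> * weight w" "0 \<le> \<bar>K2\<bar> * weight w"
      using weight_ge_1[of w] by (auto intro!: mult_right_mono mult_left_mono mult_nonneg_nonneg simp del: mult_1_right)
    then show "\<bar>ln (norm (det (?N w)))\<bar> \<le> (\<bar>K1\<bar> + \<bar>K2\<bar> + \<bar>B\<bar>) * weight w"
      using above[OF w] far[OF w] B[OF w] unfolding distrib_right
      by (cases "r0 \<le> norm w") linarith+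
  qed
qed

section \<open>Transport to the disk\<close>

context
  fixes z0 :: complex
  assumes z0: "Im z0 > 0"
begin

abbreviation "conj_point \<zeta> \<equiv> cnj (disk_to_plane z0 \<zeta>)"

lemma Im_conj_point_nonpos: "\<zeta> \<in> cball 0 1 - {1} \<Longrightarrow> Im (conj_point \<zeta>) \<le> 0"
  using Im_disk_to_plane_nonneg[OF z0] by simp

lemma Im_conj_point_neg: "\<zeta> \<in> ball 0 1 \<Longrightarrow> Im (conj_point \<zeta>) < 0"
  using Im_disk_to_plane_pos[OF z0] by simp

definition disk_weight :: "complex \<Rightarrow> real" where "disk_weight \<zeta> = norm (1 - \<zeta>) powr (- \<kappa>)"

lemma disk_weight_ge_half:
  assumes "\<zeta> \<in> cball 0 1 - {1}"
  shows "1 / 2 \<le> disk_weight \<zeta>"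
proof -
  have "norm (1 - \<zeta>) \<le> 2"
    using norm_triangle_ineq4[of 1 \<zeta>] assms by simp
  then have "2 powr (- \<kappa>) \<le> disk_weight \<zeta>"
    unfolding disk_weight_def using \<kappa> assms by (intro powr_mono2') auto
  moreover have "2 powr (- 1) \<le> (2 :: real) powr (- \<kappa>)"
    using \<kappa> by (intro powr_mono) auto
  ultimately show ?thesis by (simp add: powr_minus)
qed

definition weight_factor :: real where "weight_factor = 2 + (2 * norm z0) powr \<kappa>"

text \<open>
  Since \<open>|z| \<le> 2 |z0| / |1 - \<zeta>|\<close>, growth at infinity becomes growth at the point \<open>1\<close> of the circle.
\<close>

lemma weight_le_disk_weight:
  assumes "\<zeta> \<in> cball 0 1 - {1}"
  shows "weight (conj_point \<zeta>) \<le> weight_factor * disk_weight \<zeta>"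
proof -
  have "norm (disk_to_plane z0 \<zeta>) powr \<kappa> \<le> (2 * norm z0 / norm (1 - \<zeta>)) powr \<kappa>"
    using norm_disk_to_plane_le[of \<zeta> z0] assms \<kappa> by (intro powr_mono2) auto
  also have "\<dots> = (2 * norm z0) powr \<kappa> * disk_weight \<zeta>"
    by (simp add: disk_weight_def powr_divide powr_minus field_simps)
  finally show ?thesis
    using disk_weight_ge_half[OF assms] by (simp add: weight_def weight_factor_def algebra_simps)
qed

lemma exp_weight_le:
  assumes "K \<ge> 0" "\<zeta> \<in> cball 0 1 - {1}"
  shows "exp (K * weight (conj_point \<zeta>)) \<le> exp (K * weight_factor * disk_weight \<zeta>)"
  using mult_left_mono[OF weight_le_disk_weight[OF assms(2)] assms(1)] by (simp add: mult.assoc)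

lemma holomorphic_pullback:
  assumes "g holomorphic_on {w. Im w < 0}"
  shows "(\<lambda>\<zeta>. cnj (g (conj_point \<zeta>))) holomorphic_on ball 0 1"
proof -
  have eq: "cnj ` {z. 0 < Im z} = {w. Im w < 0}"
    by (auto intro!: image_eqI[of _ _ "cnj x" for x])
  have "cnj \<circ> g \<circ> cnj holomorphic_on {z. 0 < Im z}"
    by (rule holomorphic_on_compose_cnj_cnj) (use assms in \<open>auto simp: eq open_halfspace_Im_gt\<close>)
  moreover have "disk_to_plane z0 holomorphic_on ball 0 1"
    unfolding disk_to_plane_def by (intro holomorphic_intros) auto
  moreover have "disk_to_plane z0 ` ball 0 1 \<subseteq> {z. 0 < Im z}"
    using Im_disk_to_plane_pos[OF z0] by blast
  ultimately have "(cnj \<circ> g \<circ> cnj) \<circ> disk_to_plane z0 holomorphic_on ball 0 1"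
    by (intro holomorphic_on_compose_gen[of "disk_to_plane z0" _ "cnj \<circ> g \<circ> cnj"])
  then show ?thesis by (simp add: o_def)
qed

lemma continuous_pullback:
  assumes "continuous_on region g"
  shows "continuous_on (cball 0 1 - {1}) (\<lambda>\<zeta>. cnj (g (conj_point \<zeta>)))"
proof -
  have "continuous_on (cball 0 1 - {1}) (disk_to_plane z0)"
    unfolding disk_to_plane_def by (intro continuous_intros) auto
  then have "continuous_on (cball 0 1 - {1}) conj_point"
    by (rule continuous_on_cnj)
  moreover have "conj_point ` (cball 0 1 - {1}) \<subseteq> region"
    using Im_conj_point_nonpos by (auto simp: region_def)
  ultimately show ?thesis
    by (intro continuous_on_cnj[OF continuous_on_compose2[OF assms]])
qed

text \<open>
  Conjugation turns the matrices of \<open>c(z)*\<close> and \<open>d(z)*\<close> back into \<open>c\<close> and \<open>d\<close>: for real \<open>\<delta>\<close> this is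
  \<open>det (c + \<delta> d)\<close>, pulled back to the disk.
\<close>

definition det_disk :: "real \<Rightarrow> complex \<Rightarrow> complex"
  where "det_disk \<delta> \<zeta> = cnj (det (pencil (c_mat (conj_point \<zeta>)) (d_mat (conj_point \<zeta>)) (of_real \<delta>)))"

lemma holomorphic_det_disk: "det_disk \<delta> holomorphic_on ball 0 1"
  unfolding det_disk_def
  by (rule holomorphic_pullback, unfold pencil_def)
    (auto intro!: holomorphic_on_det holomorphic_intros holomorphic_on_entries)

lemma outer_with_det_disk:
  assumes \<delta>: "0 < \<delta>" "\<delta> \<le> 1"
  shows "outer_with (det_disk \<delta>) (\<lambda>\<theta>. ln (norm (det_disk \<delta> (cis \<theta>))))"
proof -
  obtain K where K: "\<And>w. Im w \<le> 0 \<Longrightarrow> \<bar>ln (norm (det (pencil (c_mat w) (d_mat w) (of_real \<delta>))))\<bar> \<le> K * weight w"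
    using ln_det_pencil_bound[OF \<delta>] by blast
  show ?thesis
  proof (rule outer_with_log_modulus[OF holomorphic_det_disk _ _ _ \<kappa>])
    show "continuous_on (cball 0 1 - {1}) (det_disk \<delta>)"
      unfolding det_disk_def
      by (rule continuous_pullback, unfold pencil_def)
        (auto intro!: continuous_on_det continuous_intros continuous_on_entries)
    fix \<zeta> :: complex assume \<zeta>: "\<zeta> \<in> cball 0 1 - {1}"
    show "det_disk \<delta> \<zeta> \<noteq> 0"
      using det_pencil_nonzero[OF Im_conj_point_nonpos[OF \<zeta>] \<delta>(1)] by (simp add: det_disk_def)
    have "\<bar>ln (norm (det_disk \<delta> \<zeta>))\<bar> \<le> K * weight (conj_point \<zeta>)"
      using K[OF Im_conj_point_nonpos[OF \<zeta>]] by (simp add: det_disk_def)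
    also have "\<dots> \<le> \<bar>K\<bar> * weight (conj_point \<zeta>)"
      using weight_ge_1[of "conj_point \<zeta>"] by (intro mult_right_mono) auto
    also have "\<dots> \<le> \<bar>K\<bar> * (weight_factor * disk_weight \<zeta>)"
      by (intro mult_left_mono weight_le_disk_weight \<zeta>) auto
    finally show "\<bar>ln (norm (det_disk \<delta> \<zeta>))\<bar> \<le> \<bar>K\<bar> * weight_factor * norm (1 - \<zeta>) powr (- \<kappa>)"
      by (simp add: disk_weight_def mult.assoc)
  qed
qed

lemma det_disk_nonzero: "\<zeta> \<in> ball 0 1 \<Longrightarrow> det_disk 0 \<zeta> \<noteq> 0"
  using det_c_mat_nonzero[OF Im_conj_point_neg] by (simp add: det_disk_def pencil_0)

text \<open>
  The pencil parameter runs through \<open>1 / (n + 1)\<close>.  The moduli on the circle decrease with \<open>n\<close>, away from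
  the point \<open>1\<close>, which corresponds to infinity and has measure zero.
\<close>

lemma outer_with_det_disk_0:
  obtains v where "outer_with (det_disk 0) v"
proof -
  define \<delta> where "\<delta> n = inverse (real (Suc n))" for n
  have \<delta>: "0 < \<delta> n" "\<delta> n \<le> 1" for n
    by (auto simp: \<delta>_def field_simps)
  have anti: "\<delta> n \<le> \<delta> m" if "m \<le> n" for m n
    using that by (simp add: \<delta>_def le_imp_inverse_le)
  show ?thesis
  proof (rule outer_with_decreasing_limit[of "\<lambda>n. det_disk (\<delta> n)" "\<lambda>n \<theta>. ln (norm (det_disk (\<delta> n) (cis \<theta>)))" "det_disk 0"])
    show "outer_with (det_disk (\<delta> n)) (\<lambda>\<theta>. ln (norm (det_disk (\<delta> n) (cis \<theta>))))" for n
      by (rule outer_with_det_disk[OF \<delta>])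
    show "AE \<theta> in circle_angles. decseq (\<lambda>n. ln (norm (det_disk (\<delta> n) (cis \<theta>))))"
      using AE_circle_interior
    proof eventually_elim
      case (elim \<theta>)
      then have "cis \<theta> \<in> cball 0 1 - {1}" using cis_neq_1 by simp
      then have w: "Im (conj_point (cis \<theta>)) \<le> 0" by (rule Im_conj_point_nonpos)
      show ?case
        unfolding decseq_def
      proof (intro allI impI)
        fix m n :: nat assume "m \<le> n"
        then have "norm (det_disk (\<delta> n) (cis \<theta>)) \<le> norm (det_disk (\<delta> m) (cis \<theta>))"
          unfolding det_disk_def complex_mod_cnj
          using \<delta>(1)[of n] by (intro norm_det_pencil_decreasing w anti) auto
        moreover have "0 < norm (det_disk (\<delta> n) (cis \<theta>))"
          using det_pencil_nonzero[OF w \<delta>(1)] by (simp add: det_disk_def)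
        ultimately show "ln (norm (det_disk (\<delta> n) (cis \<theta>))) \<le> ln (norm (det_disk (\<delta> m) (cis \<theta>)))"
          by (subst ln_le_cancel_iff) auto
      qed
    qed
    show "(\<lambda>n. det_disk (\<delta> n) \<zeta>) \<longlonglongrightarrow> det_disk 0 \<zeta>" for \<zeta>
    proof -
      have "(\<lambda>n. of_real (\<delta> n) :: complex) \<longlonglongrightarrow> of_real 0"
        unfolding \<delta>_def by (intro tendsto_of_real LIMSEQ_inverse_real_of_nat)
      then show ?thesis
        unfolding det_disk_def det_pencil_poly by (intro tendsto_cnj tendsto_poly)
    qed
    show "det_disk 0 0 \<noteq> 0" by (rule det_disk_nonzero) simp
  qed (rule that)
qed

definition c_disk :: "complex \<Rightarrow> complex ^ 'p ^ 'p"
  where "c_disk \<zeta> = (\<chi> i j. cnj (c_mat (conj_point \<zeta>) $ j $ i))"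

lemma det_c_disk: "det (c_disk \<zeta>) = det_disk 0 \<zeta>"
  by (simp add: c_disk_def det_cnj_transpose det_disk_def pencil_0)

lemma holomorphic_c_disk: "(\<lambda>\<zeta>. c_disk \<zeta> $ i $ j) holomorphic_on ball 0 1"
  using holomorphic_pullback[OF holomorphic_on_entries(1)[of j i]] by (simp add: c_disk_def)

lemma c_disk_bound:
  obtains K where "K \<ge> 0" "\<And>\<zeta> i j. \<zeta> \<in> ball 0 1 \<Longrightarrow> norm (c_disk \<zeta> $ i $ j) \<le> exp (K * norm (1 - \<zeta>) powr (- \<kappa>))"
proof -
  obtain K where K: "K \<ge> 0" "\<And>w i j. w \<in> region \<Longrightarrow> norm (c_mat w $ i $ j) \<le> exp (K * weight w)"
    "\<And>w i j. w \<in> region \<Longrightarrow> norm (d_mat w $ i $ j) \<le> exp (K * weight w)"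
    using entry_bounds by blast
  show ?thesis
  proof (rule that[of "K * weight_factor"])
    show "K * weight_factor \<ge> 0" using K(1) by (simp add: weight_factor_def)
    fix \<zeta> :: complex and i j assume \<zeta>: "\<zeta> \<in> ball 0 1"
    then have \<zeta>': "\<zeta> \<in> cball 0 1 - {1}" by auto
    have "conj_point \<zeta> \<in> region" using Im_conj_point_nonpos[OF \<zeta>'] by (simp add: region_def)
    then have "norm (c_disk \<zeta> $ i $ j) \<le> exp (K * weight (conj_point \<zeta>))"
      using K(2) by (simp add: c_disk_def)
    also have "\<dots> \<le> exp (K * weight_factor * disk_weight \<zeta>)"
      by (rule exp_weight_le[OF K(1) \<zeta>'])
    finally show "norm (c_disk \<zeta> $ i $ j) \<le> exp (K * weight_factor * norm (1 - \<zeta>) powr (- \<kappa>))"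
      by (simp add: disk_weight_def)
  qed
qed

lemma c_disk_smirnov: "c_disk \<in> smirnov_mat"
proof -
  obtain K where "K \<ge> 0" "\<And>\<zeta> i j. \<zeta> \<in> ball 0 1 \<Longrightarrow> norm (c_disk \<zeta> $ i $ j) \<le> exp (K * norm (1 - \<zeta>) powr (- \<kappa>))"
    using c_disk_bound by blast
  then show ?thesis
    unfolding smirnov_mat_def by (auto intro!: smirnov_subexponential[OF holomorphic_c_disk _ \<kappa>])
qed

lemma det_c_disk_outer: "outer_fun (\<lambda>\<zeta>. det (c_disk \<zeta>))"
  using outer_with_det_disk_0 outer_with_imp_outer_fun[OF holomorphic_det_disk] by (auto simp: det_c_disk)

text \<open>
  By Cramer's rule an entry of the inverse is a subexponential function divided by \<open>det c\<close>, which is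
  outer and subexponential.
\<close>

lemma c_disk_inverse_smirnov: "(\<lambda>\<zeta>. matrix_inv (c_disk \<zeta>)) \<in> smirnov_mat"
  unfolding smirnov_mat_def mem_Collect_eq
proof (intro allI)
  fix i j
  obtain K where K: "K \<ge> 0"
    "\<And>\<zeta> i j. \<zeta> \<in> ball 0 1 \<Longrightarrow> norm (c_disk \<zeta> $ i $ j) \<le> exp (K * norm (1 - \<zeta>) powr (- \<kappa>))"
    using c_disk_bound by blast
  obtain v where v: "outer_with (det_disk 0) v" by (rule outer_with_det_disk_0)
  define M where "M \<zeta> = (\<chi> k l. if l = i then axis j 1 $ k else c_disk \<zeta> $ k $ l)" for \<zeta>
  have entry: "matrix_inv (c_disk \<zeta>) $ i $ j = det (M \<zeta>) / det_disk 0 \<zeta>" if "\<zeta> \<in> ball 0 1" for \<zeta>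
    using matrix_inv_entry[of "c_disk \<zeta>" i j] det_disk_nonzero[OF that] by (simp add: det_c_disk M_def)
  have hol: "(\<lambda>\<zeta>. det (M \<zeta>)) holomorphic_on ball 0 1"
  proof (rule holomorphic_on_det)
    show "(\<lambda>\<zeta>. M \<zeta> $ k $ l) holomorphic_on ball 0 1" for k l
      by (cases "l = i") (simp_all add: M_def holomorphic_c_disk)
  qed
  have bound: "norm (det N) \<le> exp ((2 * fact CARD('p) + real CARD('p) * K) * norm (1 - \<zeta>) powr (- \<kappa>))"
    if \<zeta>: "(\<zeta> :: complex) \<in> ball 0 1"
      and "\<And>k l. norm (N $ k $ l) \<le> exp (K * norm (1 - \<zeta>) powr (- \<kappa>))" for \<zeta> and N :: "complex ^ 'p ^ 'p"
  proof (rule norm_det_le_exp)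
    have "\<zeta> \<in> cball 0 1 - {1}" using \<zeta> by auto
    then show "1 / 2 \<le> norm (1 - \<zeta>) powr (- \<kappa>)"
      unfolding disk_weight_def[symmetric] by (rule disk_weight_ge_half)
  qed (rule that(2))
  have "norm (M \<zeta> $ k $ l) \<le> exp (K * norm (1 - \<zeta>) powr (- \<kappa>))" if "\<zeta> \<in> ball 0 1" for \<zeta> k l
    using K(2)[OF that] K(1) by (simp add: M_def axis_def)
  note Mbound = bound[OF _ this]
  have Cbound: "norm (det_disk 0 \<zeta>) \<le> exp ((2 * fact CARD('p) + real CARD('p) * K) * norm (1 - \<zeta>) powr (- \<kappa>))"
    if "\<zeta> \<in> ball 0 1" for \<zeta>
    unfolding det_c_disk[symmetric] by (rule bound[OF that K(2)[OF that]])
  have "(\<lambda>\<zeta>. det (M \<zeta>) / det_disk 0 \<zeta>) holomorphic_on ball 0 1"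
    by (intro holomorphic_intros hol holomorphic_det_disk det_disk_nonzero)
  then have "(\<lambda>\<zeta>. matrix_inv (c_disk \<zeta>) $ i $ j) holomorphic_on ball 0 1"
    by (rule holomorphic_transform) (simp add: entry)
  then show "(\<lambda>\<zeta>. matrix_inv (c_disk \<zeta>) $ i $ j) \<in> smirnov"
    by (rule smirnov_quotient[OF _ hol _ holomorphic_det_disk _ v _ \<kappa>]) (auto intro: Mbound Cbound simp: entry)
qed

end

end
section \<open>The main result\<close>

theorem proposition4p1:
  fixes A S :: "'h::chilbert_space \<Rightarrow> 'h"
    and \<Phi>1 \<Phi>2 :: "complex ^ 'p::finite \<Rightarrow> 'h"
    and P :: "complex ^ ('p + 'p) \<Rightarrow> 'h"
    and r0 \<epsilon> \<kappa> :: real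
    and z0 :: complex
  assumes "bounded_clinear \<Phi>1" and "bounded_clinear \<Phi>2"
    and "P = row_op \<Phi>1 \<Phi>2"
    and "S_node A S P"
    and "r0 > 0"
    and "\<And>z. Im z \<le> 0 \<Longrightarrow> has_bounded_inverse (id_minus z A)"
    and "\<And>z. Im z > 0 \<Longrightarrow> norm z \<ge> r0 \<Longrightarrow> has_bounded_inverse (id_minus z A)"
    and "\<epsilon> > 0" and "\<And>x. \<epsilon> * (norm x)\<^sup>2 \<le> Re (cinner (S x) x)"
    and "{u. \<Phi>2 u = 0} = {0}"
    and "0 < \<kappa>" and "\<kappa> < 1"
    and "Limsup at_top (\<lambda>r. ereal (ln (resolvent_sup A r0 r) / r powr \<kappa>)) < \<infinity>"
    and "Im z0 > 0"
  shows "(\<forall>z. Im z > 0 \<longrightarrow> c_fun A S P z = matrix (\<lambda>u. (- \<i> * z) *\<^sub>C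
           cadjoint \<Phi>2 (inv (id_minus z (cadjoint A)) (inv S (\<Phi>2 u)))))
    \<and> hat z0 (c_fun A S P) \<in> smirnov_mat
    \<and> (\<forall>\<zeta>\<in>ball 0 1. invertible (hat z0 (c_fun A S P) \<zeta>))
    \<and> (\<lambda>\<zeta>. matrix_inv (hat z0 (c_fun A S P) \<zeta>)) \<in> smirnov_mat
    \<and> outer_mat_fun (hat z0 (c_fun A S P))"
proof -
  note P = assms(3)
  have A: "bounded_clinear A" and S: "bounded_clinear S" and bP: "bounded_clinear (row_op \<Phi>1 \<Phi>2)"
    and S_adj: "cadjoint S = S"
    and node: "\<And>x. A (S x) - S (cadjoint A x) = \<i> *\<^sub>C P (J_mat *v cadjoint P x)"
    using assms(4) unfolding S_node_def P by auto
  note row = cadjoint_row_op[OF assms(1,2) bP]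
  interpret positive_node A S \<Phi>1 \<Phi>2 r0 \<epsilon> \<kappa>
  proof
    show "cinner (S x) y = cinner x (S y)" for x y
      using cadjoint_works[OF S, of x y] by (simp add: S_adj)
    show "A (S x) - S (cadjoint A x) = \<i> *\<^sub>C (\<Phi>1 (cadjoint \<Phi>2 x) + \<Phi>2 (cadjoint \<Phi>1 x))" for x
      unfolding node P by (simp add: row_op_def J_mat_mult row)
    show "has_bounded_inverse (id_minus w A)" if "Im w \<le> 0 \<or> r0 \<le> norm w" for w
      using that assms(6,7)[of w] by (cases "Im w \<le> 0") auto
    show "u = 0" if "\<Phi>2 u = 0" for u
      using that assms(10) by blast
  qed (use assms A S in auto)
  have formula: "c_fun A S P z = matrix (\<lambda>u. (- \<i> * z) *\<^sub>C
      cadjoint \<Phi>2 (inv (id_minus z (cadjoint A)) (inv S (\<Phi>2 u))))" for z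
    unfolding P by (rule c_fun_eq[OF assms(1,2) bP])
  have hat_eq: "hat z0 (c_fun A S P) \<zeta> = c_disk z0 \<zeta>" if \<zeta>: "\<zeta> \<in> ball 0 1" for \<zeta>
  proof -
    define z where "z = disk_to_plane z0 \<zeta>"
    have z: "has_bounded_inverse (id_minus (cnj z) A)"
      using Im_disk_to_plane_pos[OF assms(14) \<zeta>] by (intro assms(6)) (simp add: z_def)
    note zA = has_bounded_inverse_inv[OF has_bounded_inverse_id_minus_cadjoint[OF A z]]
    have entry: "c_fun A S P z $ i $ j = cnj (c_mat (cnj z) $ j $ i)" for i j
    proof -
      \<comment> \<open>Both sides are the inner product of \<open>k\<close> and \<open>x\<close>, up to the factor \<open>- \<i> z\<close>.\<close>
      define k where "k = inv S (\<Phi>2 (axis j 1))"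
      define y where "y = inv (id_minus z (cadjoint A)) k"
      define x where "x = R (cnj z) (\<Phi>2 (axis i 1))"
      have "c_fun A S P z $ i $ j = - \<i> * z * cinner (cadjoint \<Phi>2 y) (axis i 1)"
        unfolding formula by (simp add: matrix_def scaleC_vec_def scaleC_complex_def cinner_axis y_def k_def)
      also have "cinner (cadjoint \<Phi>2 y) (axis i 1) = cinner y (x - cnj z *\<^sub>C A x)"
        unfolding x_def resolvent_works(2)[OF z] by (simp add: cadjoint_works'[OF assms(2)])
      also have "\<dots> = cinner (id_minus z (cadjoint A) y) x"
        by (simp add: id_minus_def cinner_simps cadjoint_works'[OF A])
      also have "\<dots> = cinner k x"
        unfolding y_def zA ..
      finally show ?thesis
        by (simp add: c_mat_def x_def k_def flip: cinner_commute)
    qed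
    have "hat z0 (c_fun A S P) \<zeta> = c_fun A S P z"
      by (simp add: hat_def z_def disk_to_plane_def)
    then show ?thesis
      using entry by (simp add: vec_eq_iff c_disk_def[OF assms(14)] z_def)
  qed
  have inv: "invertible (hat z0 (c_fun A S P) \<zeta>)" if "\<zeta> \<in> ball 0 1" for \<zeta>
    using det_disk_nonzero[OF assms(14) that] by (simp add: hat_eq[OF that] invertible_det_nz det_c_disk[OF assms(14)])
  have smirnov: "hat z0 (c_fun A S P) \<in> smirnov_mat"
    using c_disk_smirnov[OF assms(14)] by (rule smirnov_mat_cong) (rule hat_eq)
  moreover have "(\<lambda>\<zeta>. matrix_inv (hat z0 (c_fun A S P) \<zeta>)) \<in> smirnov_mat"
    using c_disk_inverse_smirnov[OF assms(14)] by (rule smirnov_mat_cong) (simp add: hat_eq)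
  moreover have "outer_fun (\<lambda>\<zeta>. det (hat z0 (c_fun A S P) \<zeta>))"
    using det_c_disk_outer[OF assms(14)] by (rule outer_fun_cong) (simp add: hat_eq)
  ultimately show ?thesis
    using formula inv unfolding outer_mat_fun_def by blast
qed

end
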